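(* Assume Assumption A-1 holds, let $T\ge1$, let $(b_N)$ be positive reals with $b_N\to\infty$, $\sqrt N/b_N\to\infty$, and let $\psi_T:\mathbb{R}^d\to\mathbb{R}$ be measurable. (1) If $\psi_T\in\mathcal E_T$, then $V_T(\psi_T)<\infty$ and $M_N^T(\psi_T)$ satisfies under $\mathbb{P}_T$ the moderate deviation principle with speed $b_N^2$ and good rate function $I_T(x)=\sup_{\lambda\in\mathbb{R}}\{\lambda x-\lambda^2V_T(\psi_T)/2\}$ (i.e. $x^2/(2V_T(\psi_T))$ when $V_T(\psi_T)>0$). (2) If $0<\alpha<1/2$, $b_N=N^\alpha$ and $\psi_T\in\mathcal E_T^\alpha$, then $V_T(\psi_T)<\infty$ and $M_N^T(\psi_T)$ satisfies under $\mathbb{P}_T$ the moderate deviation principle with speed $b_N^2$ and the same good rate function $I_T$.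
   Context: Hidden Markov model: Markov chain $(X_t)$ on $\mathbb{R}^d$ with initial density $a_0$ and transition densities $a_t(x,x')$ w.r.t. a measure $\mu$; observation densities $b_t(x,y)$ w.r.t. a measure $\nu$; observations $y_1,\dots,y_T$ fixed, $\mathbb{P}_T=\mathbb{P}(\cdot\mid Y_1=y_1,\dots,Y_T=y_T)$; write $b_t(x)=b_t(x,y_t)$. Filter: $f_{0|0}=a_0$, $f_{t|t}(x)\propto b_t(x,y_t)\int f_{t-1|t-1}(u)a_t(u,x)\mu(du)$ (normalized). Particle filter: $(x_{i,0})_{i\le N}$ i.i.d. with law $a_0d\mu$; given generations up to $t-1$, $(x_{i,t})_{i\le N}$ i.i.d. with law $f^N_{t|t}d\mu$, $f^N_{t|t}(x)\propto b_t(x,y_t)\frac1N\sum_ia_t(x_{i,t-1},x)$ (normalized). Notation: $m_t(\psi)=\int\psi f_{t|t}d\mu$; $L_t\psi(x)=\int a_t(x,u)b_t(u,y_t)\psi(u)\mu(du)$; $\mathbb{1}\equiv1$; $M_N^T(\psi)=\frac1{b_N\sqrt N}\sum_{i=1}^N(\psi(x_{i,T})-m_T(\psi))$; $\kappa_t=\int L_t\mathbb{1}f_{t-1|t-1}d\mu$. Variances: $\sigma_t^2(\psi)=\int(\psi-m_t(\psi))^2f_{t|t}d\mu$; $V_0(\psi)=\sigma_0^2(\psi)$, $V_t(\psi)=\sigma_t^2(\psi)+\kappa_t^{-2}V_{t-1}(L_t\psi-m_t(\psi)L_t\mathbb{1})$. Assumption A-1: there is a constant $C_a>0$ such that for each $t\ge1$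 there are nonnegative functions $h_t^+,h_t^-$ with $C_a^{-1}h_t^-(x')\le a_t(x,x')\le C_ah_t^+(x')$ for all $x,x'$, and $0<C_a^{-1}\int h_t^-b_t\,d\mu\le C_a\int h_t^+b_t\,d\mu<\infty$ (for the observed $y_t$). Function classes: $\mathcal E_T=\{\psi:\exists\beta>0,\ \int e^{\beta|\psi(x)|}h_T^+(x)b_T(x,y_T)\mu(dx)<\infty\}$; $\mathcal E_T^\alpha=\{\psi:\forall\beta>0,\ \int e^{\beta|\psi(x)|^{4\alpha/(1+2\alpha)}}h_T^+(x)b_T(x,y_T)\mu(dx)<\infty\}$. A moderate deviation principle with speed $b_N^2$ and rate $I$ means: for every Borel $\Gamma$, $-\inf_{\mathrm{int}\Gamma}I\le\liminf\frac1{b_N^2}\log\mathbb{P}_T(\cdot\in\Gamma)\le\limsup\frac1{b_N^2}\log\mathbb{P}_T(\cdot\in\Gamma)\le-\inf_{\overline\Gamma}I$. *)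

theory Defs
  imports "HOL-Probability.Probability"
begin

text \<open>Hidden Markov model / particle filter setting.  The observations y_1..y_T are fixed,
  and bt t x stands for b_t(x, y_t).  Transition densities a t x x' = a_t(x,x'),
  initial density a0, reference measure mu on the state space.\<close>

primrec filt :: "'a measure \<Rightarrow> ('a \<Rightarrow> real) \<Rightarrow> (nat \<Rightarrow> 'a \<Rightarrow> 'a \<Rightarrow> real)
    \<Rightarrow> (nat \<Rightarrow> 'a \<Rightarrow> real) \<Rightarrow> nat \<Rightarrow> 'a \<Rightarrow> real" where
  "filt mu a0 a bt 0 = a0"
| "filt mu a0 a bt (Suc t) =
     (let g = (\<lambda>x. bt (Suc t) x * (\<integral>u. filt mu a0 a bt t u * a (Suc t) u x \<partial>mu))
      in (\<lambda>x. g x / (\<integral>z. g z \<partial>mu)))"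

definition mfilt :: "'a measure \<Rightarrow> ('a \<Rightarrow> real) \<Rightarrow> (nat \<Rightarrow> 'a \<Rightarrow> 'a \<Rightarrow> real)
    \<Rightarrow> (nat \<Rightarrow> 'a \<Rightarrow> real) \<Rightarrow> nat \<Rightarrow> ('a \<Rightarrow> real) \<Rightarrow> real" where
  "mfilt mu a0 a bt t psi = (\<integral>x. psi x * filt mu a0 a bt t x \<partial>mu)"

definition Lop :: "'a measure \<Rightarrow> (nat \<Rightarrow> 'a \<Rightarrow> 'a \<Rightarrow> real) \<Rightarrow> (nat \<Rightarrow> 'a \<Rightarrow> real)
    \<Rightarrow> nat \<Rightarrow> ('a \<Rightarrow> real) \<Rightarrow> 'a \<Rightarrow> real" where
  "Lop mu a bt t psi = (\<lambda>x. \<integral>u. a t x u * bt t u * psi u \<partial>mu)"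

definition kappa :: "'a measure \<Rightarrow> ('a \<Rightarrow> real) \<Rightarrow> (nat \<Rightarrow> 'a \<Rightarrow> 'a \<Rightarrow> real)
    \<Rightarrow> (nat \<Rightarrow> 'a \<Rightarrow> real) \<Rightarrow> nat \<Rightarrow> real" where
  "kappa mu a0 a bt t = (\<integral>x. Lop mu a bt t (\<lambda>_. 1) x * filt mu a0 a bt (t - 1) x \<partial>mu)"

definition sigma2 :: "'a measure \<Rightarrow> ('a \<Rightarrow> real) \<Rightarrow> (nat \<Rightarrow> 'a \<Rightarrow> 'a \<Rightarrow> real)
    \<Rightarrow> (nat \<Rightarrow> 'a \<Rightarrow> real) \<Rightarrow> nat \<Rightarrow> ('a \<Rightarrow> real) \<Rightarrow> ennreal" where
  "sigma2 mu a0 a bt t psi =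
     (\<integral>\<^sup>+x. ennreal ((psi x - mfilt mu a0 a bt t psi)\<^sup>2 * filt mu a0 a bt t x) \<partial>mu)"

primrec Vvar :: "'a measure \<Rightarrow> ('a \<Rightarrow> real) \<Rightarrow> (nat \<Rightarrow> 'a \<Rightarrow> 'a \<Rightarrow> real)
    \<Rightarrow> (nat \<Rightarrow> 'a \<Rightarrow> real) \<Rightarrow> nat \<Rightarrow> ('a \<Rightarrow> real) \<Rightarrow> ennreal" where
  "Vvar mu a0 a bt 0 = (\<lambda>psi. sigma2 mu a0 a bt 0 psi)"
| "Vvar mu a0 a bt (Suc t) = (\<lambda>psi. sigma2 mu a0 a bt (Suc t) psi
     + ennreal (1 / (kappa mu a0 a bt (Suc t))\<^sup>2)
       * Vvar mu a0 a bt t (\<lambda>x. Lop mu a bt (Suc t) psi x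
            - mfilt mu a0 a bt (Suc t) psi * Lop mu a bt (Suc t) (\<lambda>_. 1) x))"

definition fN :: "'a measure \<Rightarrow> (nat \<Rightarrow> 'a \<Rightarrow> 'a \<Rightarrow> real) \<Rightarrow> (nat \<Rightarrow> 'a \<Rightarrow> real)
    \<Rightarrow> nat \<Rightarrow> nat \<Rightarrow> (nat \<Rightarrow> 'a) \<Rightarrow> 'a \<Rightarrow> real" where
  "fN mu a bt N t prev =
     (let g = (\<lambda>x. bt t x * ((\<Sum>i<N. a t (prev i) x) / real N))
      in (\<lambda>x. g x / (\<integral>z. g z \<partial>mu)))"

text \<open>Law (under P_T) of the t-th generation (x_{i,t})_{i<N} of the particle system
  with N particles: generation 0 is i.i.d. with law a0 d mu; generation t is, given the
  previous ones, i.i.d. with law f^N_{t|t} d mu, which only depends on generation t-1.\<close>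
primrec particle_gen :: "'a measure \<Rightarrow> ('a \<Rightarrow> real) \<Rightarrow> (nat \<Rightarrow> 'a \<Rightarrow> 'a \<Rightarrow> real)
    \<Rightarrow> (nat \<Rightarrow> 'a \<Rightarrow> real) \<Rightarrow> nat \<Rightarrow> nat \<Rightarrow> (nat \<Rightarrow> 'a) measure" where
  "particle_gen mu a0 a bt N 0 = PiM {..<N} (\<lambda>_. density mu (\<lambda>x. ennreal (a0 x)))"
| "particle_gen mu a0 a bt N (Suc t) =
     Giry_Monad.bind (particle_gen mu a0 a bt N t)
       (\<lambda>prev. PiM {..<N} (\<lambda>_. density mu (\<lambda>x. ennreal (fN mu a bt N (Suc t) prev x))))"

definition elog :: "real \<Rightarrow> ereal" where
  "elog p = (if p = 0 then -\<infinity> else ereal (ln p))"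

definition dev_principle :: "(nat \<Rightarrow> 'w measure) \<Rightarrow> (nat \<Rightarrow> 'w \<Rightarrow> real) \<Rightarrow> (nat \<Rightarrow> real)
    \<Rightarrow> (real \<Rightarrow> ereal) \<Rightarrow> bool" where
  "dev_principle P Z s I \<longleftrightarrow>
    (\<forall>\<Gamma> \<in> sets (borel :: real measure).
      let q = (\<lambda>N. elog (measure (P N) {w \<in> space (P N). Z N w \<in> \<Gamma>}) / ereal ((s N)\<^sup>2))
      in - (INF x\<in>interior \<Gamma>. I x) \<le> liminf q
         \<and> liminf q \<le> limsup q
         \<and> limsup q \<le> - (INF x\<in>closure \<Gamma>. I x))"

definition good_rate_function :: "(real \<Rightarrow> ereal) \<Rightarrow> bool" where
  "good_rate_function I \<longleftrightarrow> (\<forall>x. 0 \<le> I x) \<and> (\<forall>c::real. compact {x. I x \<le> ereal c})"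

end

theory Submission
  imports Defs
begin

text \<open>Given generation \<open>t\<close>, the particles of generation \<open>t + 1\<close> are i.i.d., so the conditional Laplace
  transform of the centred sum is an \<open>N\<close>-th power. Expanding its logarithm to second order gives
  \<open>s N = (b N)\<^sup>2\<close> times the conditional variance plus a drift, and the drift is the normalised sum, over
  generation \<open>t\<close>, of the bounded function \<open>L\<^sub>t\<^sub>+\<^sub>1 \<psi> - m\<^sub>t\<^sub>+\<^sub>1(\<psi>) L\<^sub>t\<^sub>+\<^sub>1 1\<close> divided by the empirical mean of \<open>L\<^sub>t\<^sub>+\<^sub>1 1\<close>.
  Empirical means of bounded functions concentrate superexponentially fast, so by induction the
  log-Laplace transform at \<open>\<lambda>\<close>, divided by \<open>s N\<close>, tends to \<open>\<lambda>\<^sup>2 V\<^sub>t(\<psi>) / 2\<close> for bounded \<open>\<psi>\<close>.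
  An unbounded \<open>\<psi>\<close> occurs only in the last generation; it is truncated at level \<open>b N * sqrt N\<close>,
  which changes the sum only with superexponentially small probability. The deviation principle follows by a one-dimensional
  Gaertner-Ellis argument with quadratic limit.\<close>

section \<open>Exponential rates of Laplace transforms\<close>

text \<open>The upper half of A-1 makes \<open>L\<close> send every function integrable against
  \<open>hp b dmu\<close> to a bounded one; this is why the induction closes on bounded functions.
  Both halves together dominate each conditional law by a fixed multiple of \<open>hp b dmu\<close>,
  whatever the previous generation is, which makes the expansion uniform. The obstacle is the random
  denominator of the drift. The drift can be as large as a multiple of \<open>sqrt N / b N\<close>,
  so an exceptional event of probability exp(- C * \<open>s N\<close>) cannot simply be discarded:
  it must be negligible at speed \<open>s N * sqrt N / b N = b N * sqrt N\<close>. The quadratic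
  Laplace limit gives this itself, since its parameter may be taken as large as desired. The limit
  of the denominator is kappa, and its square enters the variance recursion. Truncation is forced by
  the second function class: its exponent is below 1, so its members need not have any exponential
  moment and the Laplace transform of the full sum may be infinite. For unbounded \<open>psi\<close>
  the Laplace limit is therefore proved for the truncated sum, centred at the untruncated
  mean.\<close>

abbreviation eexp :: "real \<Rightarrow> ennreal" where
  "eexp x \<equiv> ennreal (exp x)"

abbreviation mgf :: "'w measure \<Rightarrow> real \<Rightarrow> ('w \<Rightarrow> real) \<Rightarrow> ennreal" where
  "mgf M c f \<equiv> (\<integral>\<^sup>+w. eexp (c * f w) \<partial>M)"

text \<open>The normalised log-Laplace transforms \<open>ln E exp (s N * f N) / s N\<close> tend to \<open>l\<close>; the
  two-sided bound avoids logarithms of expectations that may be infinite.\<close>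
definition exp_rate ::
  "(nat \<Rightarrow> 'w measure) \<Rightarrow> (nat \<Rightarrow> real) \<Rightarrow> (nat \<Rightarrow> 'w \<Rightarrow> real) \<Rightarrow> real \<Rightarrow> bool" where
  "exp_rate P s f l \<longleftrightarrow> (\<forall>\<eta>>0. \<forall>\<^sub>F N in sequentially.
     eexp (s N * (l - \<eta>)) \<le> mgf (P N) (s N) (f N) \<and>
     mgf (P N) (s N) (f N) \<le> eexp (s N * (l + \<eta>)))"

lemma exp_rate_upper:
  assumes "exp_rate P s f l" "l < u"
  shows "\<forall>\<^sub>F N in sequentially. mgf (P N) (s N) (f N) \<le> eexp (s N * u)"
  using assms(1)[unfolded exp_rate_def, rule_format, of "u - l"] assms(2)
  by (auto elim: eventually_mono)

lemma exp_rate_lower: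
  assumes "exp_rate P s f l" "u < l"
  shows "\<forall>\<^sub>F N in sequentially. eexp (s N * u) \<le> mgf (P N) (s N) (f N)"
  using assms(1)[unfolded exp_rate_def, rule_format, of "l - u"] assms(2)
  by (auto elim: eventually_mono)

lemma exp_rate_cong:
  assumes "\<forall>\<^sub>F N in sequentially. f N = g N"
  shows "exp_rate P s f x \<longleftrightarrow> exp_rate P s g x"
proof -
  have "exp_rate P s g x" if "\<forall>\<^sub>F N in sequentially. f N = g N" "exp_rate P s f x" for f g
    unfolding exp_rate_def
  proof (intro allI impI)
    fix \<eta> :: real assume "\<eta> > 0"
    from that(2)[unfolded exp_rate_def, rule_format, OF this] that(1)
    show "\<forall>\<^sub>F N in sequentially. eexp (s N * (x - \<eta>)) \<le> mgf (P N) (s N) (g N) \<and>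
       mgf (P N) (s N) (g N) \<le> eexp (s N * (x + \<eta>))"
      by eventually_elim simp
  qed
  from this[of f g] this[of g f] assms show ?thesis by (auto simp: eq_commute)
qed

text \<open>A strict gap between the exponents absorbs any constant factor, because
  \<open>s N * (v - u)\<close> eventually exceeds \<open>\<bar>c\<bar>\<close>. All counting factors
  2 and 3 below are removed in this way.\<close>

lemma eventually_const_exp_le:
  fixes s :: "nat \<Rightarrow> real"
  assumes "filterlim s at_top sequentially" "u < v"
  shows "\<forall>\<^sub>F N in sequentially. c * exp (s N * u) \<le> exp (s N * v)"
proof -
  have "\<forall>\<^sub>F N in sequentially. s N \<ge> \<bar>c\<bar> / (v - u)"
    using assms(1) by (simp add: filterlim_at_top)
  then show ?thesis
  proof (rule eventually_mono)
    fix N assume "s N \<ge> \<bar>c\<bar> / (v - u)"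
    then have "c \<le> s N * (v - u)"
      using assms(2) by (simp add: field_simps)
    also have "... \<le> exp (s N * (v - u))"
      using exp_ge_add_one_self[of "s N * (v - u)"] by linarith
    finally have "c * exp (s N * u) \<le> exp (s N * (v - u)) * exp (s N * u)"
      by (simp add: mult_right_mono)
    also have "... = exp (s N * v)"
      by (simp add: exp_add[symmetric] algebra_simps)
    finally show "c * exp (s N * u) \<le> exp (s N * v)" .
  qed
qed

text \<open>Mutual domination up to a subexponential factor preserves the rate. The additive term
  with arbitrary \<open>R\<close> leaves room for exceptional events; only values of
  \<open>R\<close> at or below \<open>l\<close> are useful.\<close>

lemma exp_rate_transfer:
  fixes P :: "nat \<Rightarrow> 'w measure" and Q :: "nat \<Rightarrow> 'v measure"
  assumes s: "filterlim s at_top sequentially"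
    and f: "exp_rate P s f l"
    and gf: "\<And>\<eta> R. \<eta> > 0 \<Longrightarrow> \<forall>\<^sub>F N in sequentially. mgf (Q N) (s N) (g N)
        \<le> eexp (s N * \<eta>) * mgf (P N) (s N) (f N) + eexp (s N * R)"
    and fg: "\<And>\<eta> R. \<eta> > 0 \<Longrightarrow> \<forall>\<^sub>F N in sequentially. mgf (P N) (s N) (f N)
        \<le> eexp (s N * \<eta>) * mgf (Q N) (s N) (g N) + eexp (s N * R)"
  shows "exp_rate Q s g l"
  unfolding exp_rate_def
proof (intro allI impI eventually_conj)
  fix \<eta> :: real assume \<eta>: "\<eta> > 0"
  \<comment> \<open>One third of \<open>\<eta>\<close> goes to the factor, one to the rate of
    \<open>f\<close>, and the last absorbs the number of summands. Here
    \<open>R = l\<close>.\<close>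
  have "\<forall>\<^sub>F N in sequentially. 2 * exp (s N * (l + 2 * (\<eta>/3))) \<le> exp (s N * (l + \<eta>))"
    by (rule eventually_const_exp_le[OF s]) (use \<eta> in auto)
  moreover have "\<forall>\<^sub>F N in sequentially. s N \<ge> 0"
    using s by (simp add: filterlim_at_top)
  ultimately show "\<forall>\<^sub>F N in sequentially. mgf (Q N) (s N) (g N) \<le> eexp (s N * (l + \<eta>))"
    using gf[of "\<eta>/3" l, OF divide_pos_pos[OF \<eta>]] exp_rate_upper[OF f, of "l + \<eta>/3"] \<eta>
  proof (simp, elim eventually_rev_mp, intro always_eventually allI impI)
    fix N
    let ?g = "mgf (Q N) (s N) (g N)" and ?f = "mgf (P N) (s N) (f N)"
    assume 1: "?f \<le> eexp (s N * (l + \<eta>/3))"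
      and 2: "?g \<le> eexp (s N * \<eta> / 3) * ?f + eexp (s N * l)"
      and 3: "0 \<le> s N" and 4: "2 * exp (s N * (l + 2 * \<eta>/3)) \<le> exp (s N * (l + \<eta>))"
    have "?g \<le> eexp (s N * \<eta> / 3) * eexp (s N * (l + \<eta>/3)) + eexp (s N * l)"
      by (rule order.trans[OF 2]) (intro add_mono mult_left_mono 1; simp)
    also have "... = ennreal (exp (s N * (l + 2 * \<eta>/3)) + exp (s N * l))"
      by (simp add: ennreal_mult[symmetric] ennreal_plus[symmetric] exp_add[symmetric] algebra_simps del: ennreal_plus)
    also have "... \<le> eexp (s N * (l + \<eta>))"
    proof (rule ennreal_leI)
      have "exp (s N * l) \<le> exp (s N * (l + 2 * \<eta>/3))"
        using 3 \<eta> by (simp add: mult_left_mono)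
      with 4 show "exp (s N * (l + 2 * \<eta>/3)) + exp (s N * l) \<le> exp (s N * (l + \<eta>))" by linarith
    qed
    finally show "?g \<le> eexp (s N * (l + \<eta>))" .
  qed
  \<comment> \<open>Now \<open>R\<close> has to lie strictly below \<open>l\<close>, or the additive
    term could account for the whole transform of \<open>f\<close>.\<close>
  have "\<forall>\<^sub>F N in sequentially. 3 * exp (s N * (l - 2 * \<eta>/3)) \<le> exp (s N * (l - \<eta>/3))"
    by (rule eventually_const_exp_le[OF s]) (use \<eta> in auto)
  then show "\<forall>\<^sub>F N in sequentially. eexp (s N * (l - \<eta>)) \<le> mgf (Q N) (s N) (g N)"
    using fg[of "\<eta>/3" "l - 2 * \<eta>/3", OF divide_pos_pos[OF \<eta>]] exp_rate_lower[OF f, of "l - \<eta>/3"] \<eta>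
  proof (simp, elim eventually_rev_mp, intro always_eventually allI impI)
    fix N
    let ?g = "mgf (Q N) (s N) (g N)" and ?f = "mgf (P N) (s N) (f N)"
    assume 1: "eexp (s N * (l - \<eta>/3)) \<le> ?f"
      and 2: "?f \<le> eexp (s N * \<eta> / 3) * ?g + eexp (s N * (l - 2 * \<eta>/3))"
      and 4: "3 * exp (s N * (l - 2 * \<eta>/3)) \<le> exp (s N * (l - \<eta>/3))"
    show "eexp (s N * (l - \<eta>)) \<le> ?g"
    \<comment> \<open>Arguing by contradiction avoids subtraction in \<open>ennreal\<close>: if
      \<open>?g\<close> were too small, both summands would be at most exp(s N * (l - 2\<eta>/3)),
      and their sum would be too small for \<open>?f\<close>.\<close>
    proof (rule ccontr)
      assume "\<not> ?thesis"
      then have 3: "?g \<le> eexp (s N * (l - \<eta>))" by simp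
      have "eexp (s N * (l - \<eta>/3)) \<le> eexp (s N * \<eta> / 3) * ?g + eexp (s N * (l - 2 * \<eta>/3))"
        using 1 2 by (rule order.trans)
      also have "... \<le> eexp (s N * \<eta> / 3) * eexp (s N * (l - \<eta>)) + eexp (s N * (l - 2 * \<eta>/3))"
        by (intro add_mono mult_left_mono 3; simp)
      also have "... = ennreal (2 * exp (s N * (l - 2 * \<eta>/3)))"
        by (simp add: ennreal_mult[symmetric] ennreal_plus[symmetric] exp_add[symmetric] algebra_simps del: ennreal_plus)
      finally have "exp (s N * (l - \<eta>/3)) \<le> 2 * exp (s N * (l - 2 * \<eta>/3))"
        by (subst (asm) ennreal_le_iff) auto
      with 4 have "exp (s N * (l - 2 * \<eta>/3)) \<le> 0" by linarith
      then show False by simp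
    qed
  qed
qed

lemma markov_two_sided:
  fixes Z :: "'w \<Rightarrow> real"
  assumes [measurable]: "Z \<in> borel_measurable M" and "0 \<le> c"
  shows "emeasure M {w \<in> space M. d \<le> \<bar>Z w\<bar>}
    \<le> eexp (- c * d) * ((\<integral>\<^sup>+w. eexp (c * Z w) \<partial>M) + (\<integral>\<^sup>+w. eexp (- c * Z w) \<partial>M))"
proof -
  have "emeasure M {w \<in> space M. d \<le> \<bar>Z w\<bar>} = (\<integral>\<^sup>+w. indicator {w \<in> space M. d \<le> \<bar>Z w\<bar>} w \<partial>M)"
    by simp
  also have "... \<le> (\<integral>\<^sup>+w. eexp (- c * d) * (eexp (c * Z w) + eexp (- c * Z w)) \<partial>M)"
  proof (intro nn_integral_mono)
    fix w
    have "indicator {w \<in> space M. d \<le> \<bar>Z w\<bar>} w \<le> exp (- c * d) * (exp (c * Z w) + exp (- c * Z w))"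
    proof (cases "d \<le> \<bar>Z w\<bar>")
      case True
      have "c * d \<le> c * \<bar>Z w\<bar>" using True assms(2) by (rule mult_left_mono)
      then have "1 \<le> exp (- c * d) * exp (c * \<bar>Z w\<bar>)" by (simp add: exp_add[symmetric])
      also have "... \<le> exp (- c * d) * (exp (c * Z w) + exp (- c * Z w))" by (intro mult_left_mono) (auto simp: abs_if)
      finally show ?thesis by (simp add: indicator_def)
    qed simp
    from ennreal_leI[OF this]
    show "indicator {w \<in> space M. d \<le> \<bar>Z w\<bar>} w \<le> eexp (- c * d) * (eexp (c * Z w) + eexp (- c * Z w))"
      by (simp add: ennreal_mult ennreal_indicator)
  qed
  finally show ?thesis by (simp add: nn_integral_add nn_integral_cmult)
qed

text \<open>Turns a case distinction on the sample point into one pointwise bound that can be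
  integrated term by term.\<close>

lemma real_le_add4:
  fixes a b c d x :: real
  assumes "0 \<le> a" "0 \<le> b" "0 \<le> c" "0 \<le> d" "x \<le> a \<or> x \<le> b \<or> x \<le> c \<or> x \<le> d"
  shows "x \<le> a + b + (c + d)"
  using assms by auto

lemma real_le_add3:
  fixes a b c x :: real
  assumes "0 \<le> a" "0 \<le> b" "0 \<le> c" "x \<le> a \<or> x \<le> b \<or> x \<le> c"
  shows "x \<le> a + b + c"
  using assms by auto

text \<open>Negligible at any speed \<open>C * s N * r N\<close>, hence also after multiplication by \<open>exp (C * s N * r N)\<close>.\<close>
abbreviation superneg ::
  "(nat \<Rightarrow> 'w measure) \<Rightarrow> (nat \<Rightarrow> real) \<Rightarrow> (nat \<Rightarrow> real) \<Rightarrow> (nat \<Rightarrow> 'w set) \<Rightarrow> bool" where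
  "superneg P s r B \<equiv> \<forall>C. \<forall>\<^sub>F N in sequentially. B N \<in> sets (P N) \<and> emeasure (P N) (B N) \<le> eexp (- (s N * r N * C))"

text \<open>The space is split into three parts. On \<open>B\<close> only
  \<open>F \<le> C * r N\<close> is available, and the probability of \<open>B\<close> beats it.
  Where \<open>\<bar>Z\<bar> \<le> L\<close>, \<open>F\<close> is close to \<open>G\<close>. Where
  \<open>\<bar>Z\<bar>\<close> is large, the linear growth of \<open>F\<close> is paid for by a
  larger exponential moment of \<open>Z\<close>.\<close>

lemma exp_rate_perturb_aux:
  fixes P :: "nat \<Rightarrow> 'w measure" and s r :: "nat \<Rightarrow> real" and Z F G :: "nat \<Rightarrow> 'w \<Rightarrow> real"
  assumes s: "filterlim s at_top sequentially" and r: "filterlim r at_top sequentially"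
    and Z: "\<And>l. exp_rate P s (\<lambda>N w. l * Z N w) (l\<^sup>2 * v / 2)"
    and meas: "\<forall>\<^sub>F N in sequentially. Z N \<in> borel_measurable (P N) \<and> F N \<in> borel_measurable (P N) \<and> G N \<in> borel_measurable (P N)"
    and growth: "\<forall>\<^sub>F N in sequentially. \<forall>w\<in>space (P N). F N w \<le> C * r N"
    and near: "\<And>L \<eta>. \<eta> > 0 \<Longrightarrow> \<exists>B.
      superneg P s r B \<and>
      (\<forall>\<^sub>F N in sequentially. \<forall>w\<in>space (P N) - B N. F N w \<le> K * \<bar>Z N w\<bar> + K \<and>
          (\<bar>Z N w\<bar> \<le> L \<longrightarrow> F N w \<le> G N w + \<eta>))"
    and \<eta>: "\<eta> > 0"
  shows "\<forall>\<^sub>F N in sequentially. mgf (P N) (s N) (F N)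
        \<le> eexp (s N * \<eta>) * mgf (P N) (s N) (G N) + eexp (s N * R)"
proof -
  \<comment> \<open>\<open>u\<close> bounds the normalised log-Laplace transforms at both slopes
    \<open>k + 1\<close> and \<open>- (k + 1)\<close>. \<open>L\<close> solves k - L + u = R - 1, so
    each half of the large-\<open>\<bar>Z\<bar>\<close> part contributes exp(s N * (R - 1)).\<close>
  define k where "k = \<bar>K\<bar>"
  define u where "u = (k + 1)\<^sup>2 * v / 2 + 1"
  define L where "L = k + u + 1 - R"
  obtain B where B: "\<And>C. \<forall>\<^sub>F N in sequentially. B N \<in> sets (P N) \<and> emeasure (P N) (B N) \<le> eexp (- (s N * r N * C))"
    and BFG: "\<forall>\<^sub>F N in sequentially. \<forall>w\<in>space (P N) - B N. F N w \<le> K * \<bar>Z N w\<bar> + K \<and>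
          (\<bar>Z N w\<bar> \<le> L \<longrightarrow> F N w \<le> G N w + \<eta>)"
    using near[OF \<eta>, of L] by blast
  have s1: "\<forall>\<^sub>F N in sequentially. s N \<ge> 1" using s by (simp add: filterlim_at_top)
  have r1: "\<forall>\<^sub>F N in sequentially. r N \<ge> 1 - R" using r by (simp add: filterlim_at_top)
  have up1: "\<forall>\<^sub>F N in sequentially. (\<integral>\<^sup>+w. eexp (s N * ((k + 1) * Z N w)) \<partial>P N) \<le> eexp (s N * u)"
    by (rule exp_rate_upper[OF Z]) (simp add: u_def)
  have up2: "\<forall>\<^sub>F N in sequentially. (\<integral>\<^sup>+w. eexp (s N * (- (k + 1) * Z N w)) \<partial>P N) \<le> eexp (s N * u)"
    by (rule exp_rate_upper[OF Z]) (simp add: u_def power2_eq_square algebra_simps)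
  have e3: "\<forall>\<^sub>F N in sequentially. 3 * exp (s N * (R - 1)) \<le> exp (s N * R)"
    by (rule eventually_const_exp_le[OF s]) simp
  from meas growth B[of "C + 1"] BFG s1 r1 up1 up2 e3 show ?thesis
  proof eventually_elim
    case (elim N)
    note [measurable] = conjunct1[OF elim(1)] conjunct1[OF conjunct2[OF elim(1)]] conjunct2[OF conjunct2[OF elim(1)]] conjunct1[OF elim(3)]
    have s0: "s N \<ge> 0" using elim(5) by simp
    have pt: "exp (s N * F N w) \<le> exp (s N * \<eta>) * exp (s N * G N w) + exp (s N * (C * r N)) * indicator (B N) w
        + exp (s N * (k - L)) * (exp (s N * ((k + 1) * Z N w)) + exp (s N * (- (k + 1) * Z N w)))" (is "?l \<le> ?a + ?b + ?c * (?d + ?e)")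
      if w: "w \<in> space (P N)" for w
    proof -
      have nn: "0 \<le> ?a" "0 \<le> ?b" "0 \<le> ?c * ?d" "0 \<le> ?c * ?e" by (auto simp: indicator_def)
      consider "w \<in> B N" | "w \<notin> B N" "\<bar>Z N w\<bar> \<le> L" | "w \<notin> B N" "\<bar>Z N w\<bar> > L" by linarith
      then have "?l \<le> ?a \<or> ?l \<le> ?b \<or> ?l \<le> ?c * ?d \<or> ?l \<le> ?c * ?e"
      proof cases
        case 1
        then show ?thesis using elim(2) w s0 by (simp add: mult_left_mono)
      next
        case 2
        then have "F N w \<le> \<eta> + G N w" using elim(4) w by auto
        then have "s N * F N w \<le> s N * (\<eta> + G N w)" using s0 by (rule mult_left_mono)
        then show ?thesis by (simp add: exp_add[symmetric] algebra_simps)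
      next
        case 3
        then have "F N w \<le> K * \<bar>Z N w\<bar> + K" using elim(4) w by auto
        also have "... \<le> k * \<bar>Z N w\<bar> + k" unfolding k_def by (intro add_mono mult_right_mono) auto
        \<comment> \<open>Exponential Markov inequality in pointwise form: raising the slope by one
          gains the constant \<open>L\<close>.\<close>
        also have "... \<le> (k + 1) * \<bar>Z N w\<bar> + (k - L)" using 3 by (simp add: algebra_simps)
        finally have *: "s N * F N w \<le> s N * ((k + 1) * \<bar>Z N w\<bar> + (k - L))" using s0 by (rule mult_left_mono)
        show ?thesis
        proof (cases "Z N w \<ge> 0")
          case True
          then have "?l \<le> ?c * ?d" using * by (simp add: exp_add[symmetric] algebra_simps)
          then show ?thesis by blast
        next
          case False
          then have "?l \<le> ?c * ?e" using * by (simp add: exp_add[symmetric] algebra_simps)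
          then show ?thesis by blast
        qed
      qed
      with nn have "?l \<le> ?a + ?b + (?c * ?d + ?c * ?e)" by (rule real_le_add4)
      then show ?thesis by (simp only: distrib_left)
    qed
    have "mgf (P N) (s N) (F N) \<le>
       (\<integral>\<^sup>+w. eexp (s N * \<eta>) * eexp (s N * G N w) + eexp (s N * (C * r N)) * indicator (B N) w
        + eexp (s N * (k - L)) * (eexp (s N * ((k + 1) * Z N w)) + eexp (s N * (- (k + 1) * Z N w))) \<partial>P N)"
      by (intro nn_integral_mono order.trans[OF ennreal_leI[OF pt]]) (simp_all add: ennreal_mult ennreal_indicator add_nonneg_nonneg)
    also have "... = eexp (s N * \<eta>) * mgf (P N) (s N) (G N) + eexp (s N * (C * r N)) * emeasure (P N) (B N)
        + eexp (s N * (k - L)) * ((\<integral>\<^sup>+w. eexp (s N * ((k + 1) * Z N w)) \<partial>P N) + (\<integral>\<^sup>+w. eexp (s N * (- (k + 1) * Z N w)) \<partial>P N))"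
      by (simp add: nn_integral_add nn_integral_cmult)
    also have "... \<le> eexp (s N * \<eta>) * mgf (P N) (s N) (G N) + eexp (s N * (C * r N)) * eexp (- (s N * r N * (C + 1)))
        + eexp (s N * (k - L)) * (eexp (s N * u) + eexp (s N * u))"
      using elim by (intro add_mono mult_left_mono order.refl) auto
    also have "... = eexp (s N * \<eta>) * mgf (P N) (s N) (G N) + ennreal (exp (s N * (- r N)) + 2 * exp (s N * (R - 1)))"
      by (simp add: ennreal_mult[symmetric] ennreal_plus[symmetric] exp_add[symmetric] algebra_simps L_def del: ennreal_plus)
    also have "... \<le> eexp (s N * \<eta>) * mgf (P N) (s N) (G N) + eexp (s N * R)"
    proof (intro add_mono order.refl ennreal_leI)
      have "exp (s N * (- r N)) \<le> exp (s N * (R - 1))" using s0 elim(6) by (subst exp_le_cancel_iff) (intro mult_left_mono, auto)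
      then show "exp (s N * (- r N)) + 2 * exp (s N * (R - 1)) \<le> exp (s N * R)" using elim(9) by linarith
    qed
    finally show ?case .
  qed
qed

text \<open>\<open>U\<close> may be as large as \<open>C * r N\<close> with \<open>r N \<rightarrow> \<infinity>\<close>, so the exceptional sets must be
  negligible at the faster speed \<open>s N * r N\<close>.\<close>
lemma exp_rate_perturb:
  fixes P :: "nat \<Rightarrow> 'w measure" and s r :: "nat \<Rightarrow> real" and Z U :: "nat \<Rightarrow> 'w \<Rightarrow> real"
  assumes s: "filterlim s at_top sequentially" and r: "filterlim r at_top sequentially"
    and P: "\<forall>\<^sub>F N in sequentially. prob_space (P N)"
    and Z: "\<And>l. exp_rate P s (\<lambda>N w. l * Z N w) (l\<^sup>2 * v / 2)"
    and meas: "\<forall>\<^sub>F N in sequentially. Z N \<in> borel_measurable (P N) \<and> U N \<in> borel_measurable (P N)"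
    and growth: "\<forall>\<^sub>F N in sequentially. \<forall>w\<in>space (P N). \<bar>U N w\<bar> \<le> C * r N \<and> \<bar>Z N w\<bar> \<le> C * r N"
    and near: "\<And>L \<eta>. \<eta> > 0 \<Longrightarrow> \<exists>B.
      superneg P s r B \<and>
      (\<forall>\<^sub>F N in sequentially. \<forall>w\<in>space (P N) - B N. \<bar>U N w\<bar> \<le> K * \<bar>Z N w\<bar> + K \<and>
          (\<bar>Z N w\<bar> \<le> L \<longrightarrow> \<bar>U N w - (l * Z N w + c)\<bar> \<le> \<eta>))"
  shows "exp_rate P s U (l\<^sup>2 * v / 2 + c)"
proof (rule exp_rate_transfer[OF s])
  show "exp_rate P s (\<lambda>N w. l * Z N w + c) (l\<^sup>2 * v / 2 + c)"
    unfolding exp_rate_def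
  proof (intro allI impI)
    fix \<eta> :: real assume "\<eta> > 0"
    from Z[unfolded exp_rate_def, rule_format, OF this, of l] meas
    show "\<forall>\<^sub>F N in sequentially.
            eexp (s N * (l\<^sup>2 * v / 2 + c - \<eta>)) \<le> (\<integral>\<^sup>+w. eexp (s N * (l * Z N w + c)) \<partial>P N) \<and>
            (\<integral>\<^sup>+w. eexp (s N * (l * Z N w + c)) \<partial>P N) \<le> eexp (s N * (l\<^sup>2 * v / 2 + c + \<eta>))"
    proof eventually_elim
      case (elim N)
      note [measurable] = conjunct1[OF elim(2)]
      have "(\<integral>\<^sup>+w. eexp (s N * (l * Z N w + c)) \<partial>P N) = eexp (s N * c) * (\<integral>\<^sup>+w. eexp (s N * (l * Z N w)) \<partial>P N)"
        by (subst nn_integral_cmult[symmetric]) (simp_all add: ennreal_mult[symmetric] exp_add[symmetric] algebra_simps)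
      moreover have "eexp (s N * (l\<^sup>2 * v / 2 + c + x)) = eexp (s N * c) * eexp (s N * (l\<^sup>2 * v / 2 + x))" for x
        by (simp add: ennreal_mult[symmetric] exp_add[symmetric] algebra_simps)
      from this[of \<eta>] this[of "- \<eta>"]
      have "eexp (s N * (l\<^sup>2 * v / 2 + c + \<eta>)) = eexp (s N * c) * eexp (s N * (l\<^sup>2 * v / 2 + \<eta>))"
        "eexp (s N * (l\<^sup>2 * v / 2 + c - \<eta>)) = eexp (s N * c) * eexp (s N * (l\<^sup>2 * v / 2 - \<eta>))"
        by auto
      ultimately show ?case using elim(1) by (auto intro!: mult_left_mono)
    qed
  qed
next
  fix \<eta> R :: real assume \<eta>: "\<eta> > 0"
  show "\<forall>\<^sub>F N in sequentially. mgf (P N) (s N) (U N)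
        \<le> eexp (s N * \<eta>) * (\<integral>\<^sup>+w. eexp (s N * (l * Z N w + c)) \<partial>P N) + eexp (s N * R)"
  proof (rule exp_rate_perturb_aux[OF s r Z _ _ _ \<eta>])
    show "\<forall>\<^sub>F N in sequentially. Z N \<in> borel_measurable (P N) \<and> U N \<in> borel_measurable (P N) \<and> (\<lambda>w. l * Z N w + c) \<in> borel_measurable (P N)"
      using meas by eventually_elim auto
    show "\<forall>\<^sub>F N in sequentially. \<forall>w\<in>space (P N). U N w \<le> C * r N"
      using growth by eventually_elim force
  next
    fix L \<eta>' :: real assume "\<eta>' > 0"
    from near[OF this, of L] obtain B where B: "superneg P s r B"
      and 2: "\<forall>\<^sub>F N in sequentially. \<forall>w\<in>space (P N) - B N. \<bar>U N w\<bar> \<le> K * \<bar>Z N w\<bar> + K \<and>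
          (\<bar>Z N w\<bar> \<le> L \<longrightarrow> \<bar>U N w - (l * Z N w + c)\<bar> \<le> \<eta>')" by blast
    from 2 have "\<forall>\<^sub>F N in sequentially. \<forall>w\<in>space (P N) - B N. U N w \<le> K * \<bar>Z N w\<bar> + K \<and>
          (\<bar>Z N w\<bar> \<le> L \<longrightarrow> U N w \<le> (l * Z N w + c) + \<eta>')"
      by eventually_elim force
    with B show "\<exists>B. superneg P s r B \<and>
      (\<forall>\<^sub>F N in sequentially. \<forall>w\<in>space (P N) - B N. U N w \<le> K * \<bar>Z N w\<bar> + K \<and>
          (\<bar>Z N w\<bar> \<le> L \<longrightarrow> U N w \<le> (l * Z N w + c) + \<eta>'))" by blast
  qed
  \<comment> \<open>Reverse comparison: the affine function takes the place of \<open>F\<close>, and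
    its growth bounds come from those of \<open>Z\<close> and from
    \<open>r N \<ge> 1\<close>.\<close>
  show "\<forall>\<^sub>F N in sequentially. (\<integral>\<^sup>+w. eexp (s N * (l * Z N w + c)) \<partial>P N)
        \<le> eexp (s N * \<eta>) * mgf (P N) (s N) (U N) + eexp (s N * R)"
  proof (rule exp_rate_perturb_aux[OF s r Z _ _ _ \<eta>])
    show "\<forall>\<^sub>F N in sequentially. Z N \<in> borel_measurable (P N) \<and> (\<lambda>w. l * Z N w + c) \<in> borel_measurable (P N) \<and> U N \<in> borel_measurable (P N)"
      using meas by eventually_elim auto
    have "\<forall>\<^sub>F N in sequentially. r N \<ge> 1" using r by (simp add: filterlim_at_top)
    then show "\<forall>\<^sub>F N in sequentially. \<forall>w\<in>space (P N). l * Z N w + c \<le> (\<bar>l\<bar> * C + \<bar>c\<bar>) * r N"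
      using growth
    proof eventually_elim
      case (elim N)
      show ?case
      proof
        fix w assume "w \<in> space (P N)"
        then have "\<bar>l\<bar> * \<bar>Z N w\<bar> \<le> \<bar>l\<bar> * (C * r N)" using elim by (intro mult_left_mono) auto
        moreover have "\<bar>c\<bar> * 1 \<le> \<bar>c\<bar> * r N" using elim by (intro mult_left_mono) auto
        moreover have "l * Z N w \<le> \<bar>l\<bar> * \<bar>Z N w\<bar>" by (simp add: abs_mult[symmetric])
        ultimately show "l * Z N w + c \<le> (\<bar>l\<bar> * C + \<bar>c\<bar>) * r N" by (simp add: algebra_simps)
      qed
    qed
  next
    fix L \<eta>' :: real assume "\<eta>' > 0"
    from near[OF this, of L] obtain B where B: "superneg P s r B"
      and 2: "\<forall>\<^sub>F N in sequentially. \<forall>w\<in>space (P N) - B N. \<bar>U N w\<bar> \<le> K * \<bar>Z N w\<bar> + K \<and>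
          (\<bar>Z N w\<bar> \<le> L \<longrightarrow> \<bar>U N w - (l * Z N w + c)\<bar> \<le> \<eta>')" by blast
    have 3: "l * z + c \<le> max \<bar>l\<bar> \<bar>c\<bar> * \<bar>z\<bar> + max \<bar>l\<bar> \<bar>c\<bar>" for z
    proof -
      have "l * z \<le> \<bar>l\<bar> * \<bar>z\<bar>" by (simp add: abs_mult[symmetric])
      also have "... \<le> max \<bar>l\<bar> \<bar>c\<bar> * \<bar>z\<bar>" by (intro mult_right_mono) auto
      finally show ?thesis by linarith
    qed
    from 2 have "\<forall>\<^sub>F N in sequentially. \<forall>w\<in>space (P N) - B N. l * Z N w + c \<le> max \<bar>l\<bar> \<bar>c\<bar> * \<bar>Z N w\<bar> + max \<bar>l\<bar> \<bar>c\<bar> \<and>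
          (\<bar>Z N w\<bar> \<le> L \<longrightarrow> l * Z N w + c \<le> U N w + \<eta>')"
      by eventually_elim (use 3 in force)
    with B show "\<exists>B. superneg P s r B \<and>
      (\<forall>\<^sub>F N in sequentially. \<forall>w\<in>space (P N) - B N. l * Z N w + c \<le> max \<bar>l\<bar> \<bar>c\<bar> * \<bar>Z N w\<bar> + max \<bar>l\<bar> \<bar>c\<bar> \<and>
          (\<bar>Z N w\<bar> \<le> L \<longrightarrow> l * Z N w + c \<le> U N w + \<eta>'))" by blast
  qed
qed

text \<open>The Laplace bounds at slopes \<open>l\<close> and \<open>- l\<close> do not involve the
  level, so the estimate holds for all \<open>d\<close> from one index on. This uniformity allows
  levels that grow with \<open>N\<close>.\<close>

lemma exp_rate_tail:
  fixes P :: "nat \<Rightarrow> 'w measure" and s r :: "nat \<Rightarrow> real" and Z :: "nat \<Rightarrow> 'w \<Rightarrow> real"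
  assumes s: "filterlim s at_top sequentially"
    and Z: "\<And>l. exp_rate P s (\<lambda>N w. l * Z N w) (l\<^sup>2 * v / 2)"
    and meas: "\<forall>\<^sub>F N in sequentially. Z N \<in> borel_measurable (P N)"
    and l: "l \<ge> 0" and u: "l\<^sup>2 * v / 2 < u"
  shows "\<forall>\<^sub>F N in sequentially. \<forall>d. emeasure (P N) {w\<in>space (P N). d \<le> \<bar>Z N w\<bar>} \<le> ennreal (2 * exp (s N * (u - l * d)))"
proof -
  have "\<forall>\<^sub>F N in sequentially. s N \<ge> 0" using s by (simp add: filterlim_at_top)
  moreover have "\<forall>\<^sub>F N in sequentially. (\<integral>\<^sup>+w. eexp (s N * (l * Z N w)) \<partial>P N) \<le> eexp (s N * u)"
    by (rule exp_rate_upper[OF Z u])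
  moreover have "\<forall>\<^sub>F N in sequentially. (\<integral>\<^sup>+w. eexp (s N * (- l * Z N w)) \<partial>P N) \<le> eexp (s N * u)"
    by (rule exp_rate_upper[OF Z]) (use u in simp)
  ultimately show ?thesis using meas
  proof eventually_elim
    case (elim N)
    show ?case
    proof
      fix d
      have "emeasure (P N) {w\<in>space (P N). d \<le> \<bar>Z N w\<bar>} \<le> eexp (- (s N * l) * d) *
          ((\<integral>\<^sup>+w. eexp (s N * (l * Z N w)) \<partial>P N) + (\<integral>\<^sup>+w. eexp (s N * (- l * Z N w)) \<partial>P N))"
        using markov_two_sided[OF elim(4), of "s N * l" d] elim(1) l by (simp add: mult.assoc)
      also have "... \<le> eexp (- (s N * l) * d) * (eexp (s N * u) + eexp (s N * u))"
        by (intro add_mono mult_left_mono elim) auto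
      also have "... = ennreal (2 * exp (s N * (u - l * d)))"
        by (simp add: ennreal_mult[symmetric] ennreal_plus[symmetric] exp_add[symmetric] algebra_simps del: ennreal_plus)
      finally show "emeasure (P N) {w\<in>space (P N). d \<le> \<bar>Z N w\<bar>} \<le> ennreal (2 * exp (s N * (u - l * d)))" .
    qed
  qed
qed

text \<open>Markov's inequality with a fixed exponent \<open>l\<close>, chosen large in terms of \<open>C\<close>, turns the Laplace
  asymptotics into a bound at speed \<open>s N * r N\<close>; no Hoeffding-type inequality is needed.\<close>
lemma exp_rate_concentration:
  fixes P :: "nat \<Rightarrow> 'w measure" and s r :: "nat \<Rightarrow> real" and Z :: "nat \<Rightarrow> 'w \<Rightarrow> real"
  assumes s: "filterlim s at_top sequentially" and r: "filterlim r at_top sequentially"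
    and Z: "\<And>l. exp_rate P s (\<lambda>N w. l * Z N w) (l\<^sup>2 * v / 2)"
    and meas: "\<forall>\<^sub>F N in sequentially. Z N \<in> borel_measurable (P N)"
    and \<delta>: "\<delta> > 0"
  shows "\<forall>\<^sub>F N in sequentially. emeasure (P N) {w\<in>space (P N). \<delta> * r N \<le> \<bar>Z N w\<bar>} \<le> eexp (- (s N * r N * C))"
proof -
  \<comment> \<open>The slope makes \<open>l * (\<delta> * r N)\<close> equal to
    \<open>(\<bar>C\<bar> + 1) * r N\<close>; the spare \<open>r N\<close> eventually absorbs
    \<open>u\<close> and the factor 2.\<close>
  define l where "l = (\<bar>C\<bar> + 1) / \<delta>"
  define u where "u = l\<^sup>2 * v / 2 + 1"
  have l: "l \<ge> 0" using \<delta> by (simp add: l_def)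
  have "\<forall>\<^sub>F N in sequentially. s N \<ge> 0" using s by (simp add: filterlim_at_top)
  moreover have "\<forall>\<^sub>F N in sequentially. r N \<ge> max 0 (u + 1)" using r by (simp only: filterlim_at_top)
  moreover have "\<forall>\<^sub>F N in sequentially. 2 * exp (s N * (-1)) \<le> exp (s N * 0)"
    by (rule eventually_const_exp_le[OF s]) simp
  moreover have "\<forall>\<^sub>F N in sequentially. \<forall>d. emeasure (P N) {w\<in>space (P N). d \<le> \<bar>Z N w\<bar>} \<le> ennreal (2 * exp (s N * (u - l * d)))"
    by (rule exp_rate_tail[OF s Z meas l]) (simp add: u_def)
  ultimately show ?thesis
  proof eventually_elim
    case (elim N)
    have "emeasure (P N) {w\<in>space (P N). \<delta> * r N \<le> \<bar>Z N w\<bar>} \<le> ennreal (2 * exp (s N * (u - l * (\<delta> * r N))))"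
      using elim by blast
    also have "... \<le> eexp (- (s N * r N * C))"
    proof (rule ennreal_leI)
      have "l * (\<delta> * r N) = (\<bar>C\<bar> + 1) * r N" using \<delta> by (simp add: l_def)
      moreover have "C * r N \<le> \<bar>C\<bar> * r N" using elim by (intro mult_right_mono) auto
      ultimately have "u - l * (\<delta> * r N) \<le> - 1 - r N * C" using elim by (simp add: algebra_simps)
      then have "s N * (u - l * (\<delta> * r N)) \<le> s N * (- 1 - r N * C)" using elim(1) by (rule mult_left_mono)
      then have "2 * exp (s N * (u - l * (\<delta> * r N))) \<le> 2 * exp (s N * (-1)) * exp (- (s N * r N * C))"
        by (simp add: exp_add[symmetric] algebra_simps)
      also have "... \<le> 1 * exp (- (s N * r N * C))" using elim(3) by (intro mult_right_mono) auto
      finally show "2 * exp (s N * (u - l * (\<delta> * r N))) \<le> exp (- (s N * r N * C))" by simp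
    qed
    finally show ?case .
  qed
qed

text \<open>Exponential tilting by \<open>l\<close>: under the tilted law \<open>Z\<close> concentrates at \<open>l * v\<close>.\<close>
lemma exp_rate_ball_lower:
  fixes P :: "nat \<Rightarrow> 'w measure" and s :: "nat \<Rightarrow> real" and Z :: "nat \<Rightarrow> 'w \<Rightarrow> real"
  assumes s: "filterlim s at_top sequentially"
    and P: "\<forall>\<^sub>F N in sequentially. prob_space (P N)"
    and Z: "\<And>l. exp_rate P s (\<lambda>N w. l * Z N w) (l\<^sup>2 * v / 2)"
    and meas: "\<forall>\<^sub>F N in sequentially. Z N \<in> borel_measurable (P N)"
    and v: "v \<ge> 0" and \<delta>: "\<delta> > 0" and \<eta>: "\<eta> > 0"
  shows "\<forall>\<^sub>F N in sequentially. exp (s N * (- l\<^sup>2 * v / 2 - \<bar>l\<bar> * \<delta> - \<eta>)) \<le> measure (P N) {w\<in>space (P N). \<bar>Z N w - l * v\<bar> < \<delta>}"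
proof -
  define x where "x = l * v"
  \<comment> \<open>\<open>\<mu>\<close> is the additional tilt that tests for deviations from
    \<open>x\<close>. It satisfies \<open>\<mu>\<^sup>2 * v \<le> \<mu> * \<delta>\<close>, so each
    tail has exponent at most A - \<mu>\<delta>/2 + g, which is A - 2g for g = \<mu>\<delta>/6. The
    denominator \<open>v + 1\<close> covers \<open>v = 0\<close>.\<close>
  define \<mu> where "\<mu> = \<delta> / (v + 1)"
  define g where "g = \<mu> * \<delta> / 6"
  define A where "A = l\<^sup>2 * v / 2"
  define \<eta>2 where "\<eta>2 = min (\<eta> / 2) g"
  have \<mu>: "\<mu> > 0" and g: "g > 0" and \<eta>2: "\<eta>2 > 0" using v \<delta> \<eta> by (auto simp: \<mu>_def g_def \<eta>2_def)
  have "\<mu> * v \<le> \<delta>" using v \<delta> by (simp add: \<mu>_def field_simps)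
  then have \<mu>v: "\<mu>\<^sup>2 * v \<le> \<mu> * \<delta>" using \<mu> by (simp add: power2_eq_square)
  have s0: "\<forall>\<^sub>F N in sequentially. s N \<ge> 0" using s by (simp add: filterlim_at_top)
  have low: "\<forall>\<^sub>F N in sequentially. eexp (s N * (A - \<eta>2)) \<le> (\<integral>\<^sup>+w. eexp (s N * (l * Z N w)) \<partial>P N)"
    by (rule exp_rate_lower[OF Z]) (use \<eta>2 in \<open>simp add: A_def\<close>)
  have up1: "\<forall>\<^sub>F N in sequentially. (\<integral>\<^sup>+w. eexp (s N * ((l + \<mu>) * Z N w)) \<partial>P N) \<le> eexp (s N * ((l + \<mu>)\<^sup>2 * v / 2 + g))"
    by (rule exp_rate_upper[OF Z]) (use g in simp)
  have up2: "\<forall>\<^sub>F N in sequentially. (\<integral>\<^sup>+w. eexp (s N * ((l - \<mu>) * Z N w)) \<partial>P N) \<le> eexp (s N * ((l - \<mu>)\<^sup>2 * v / 2 + g))"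
    by (rule exp_rate_upper[OF Z]) (use g in simp)
  have e3: "\<forall>\<^sub>F N in sequentially. 3 * exp (s N * (A - 2 * g)) \<le> exp (s N * (A - \<eta>2))"
    by (rule eventually_const_exp_le[OF s]) (use g in \<open>simp add: \<eta>2_def\<close>)
  have e4: "\<forall>\<^sub>F N in sequentially. 3 * exp (s N * (- A - \<bar>l\<bar> * \<delta> - \<eta>)) \<le> exp (s N * (- A - \<bar>l\<bar> * \<delta> - \<eta>2))"
    by (rule eventually_const_exp_le[OF s]) (use \<eta> in \<open>simp add: \<eta>2_def\<close>)
  from P meas s0 low up1 up2 e3 e4 have "\<forall>\<^sub>F N in sequentially. exp (s N * (- A - \<bar>l\<bar> * \<delta> - \<eta>)) \<le> measure (P N) {w\<in>space (P N). \<bar>Z N w - x\<bar> < \<delta>}"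
  proof eventually_elim
    case (elim N)
    interpret prob_space "P N" by fact
    note [measurable] = elim(2)
    let ?S = "{w\<in>space (P N). \<bar>Z N w - x\<bar> < \<delta>}"
    \<comment> \<open>Outside the ball, the weight is multiplied by exp(s N * \<mu> * (\<bar>Z -
      x\<bar> - \<delta>)), which is at least 1 and turns the slope \<open>l\<close> into
      \<open>l + \<mu>\<close> or \<open>l - \<mu>\<close>.\<close>
    have pt: "exp (s N * (l * Z N w)) \<le> exp (s N * (l * x + \<bar>l\<bar> * \<delta>)) * indicator ?S w
        + exp (s N * (- \<mu> * \<delta> - \<mu> * x)) * exp (s N * ((l + \<mu>) * Z N w)) + exp (s N * (- \<mu> * \<delta> + \<mu> * x)) * exp (s N * ((l - \<mu>) * Z N w))"
       (is "?l \<le> ?a + ?b + ?c") if w: "w \<in> space (P N)" for w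
    proof -
      have nn: "0 \<le> ?a" "0 \<le> ?b" "0 \<le> ?c" by (auto simp: indicator_def)
      consider "\<bar>Z N w - x\<bar> < \<delta>" | "\<delta> \<le> Z N w - x" | "\<delta> \<le> x - Z N w" by linarith
      then have "?l \<le> ?a \<or> ?l \<le> ?b \<or> ?l \<le> ?c"
      proof cases
        case 1
        have "l * (Z N w - x) \<le> \<bar>l\<bar> * \<bar>Z N w - x\<bar>" by (simp add: abs_mult[symmetric])
        also have "... \<le> \<bar>l\<bar> * \<delta>" using 1 by (intro mult_left_mono) auto
        finally have "s N * (l * Z N w) \<le> s N * (l * x + \<bar>l\<bar> * \<delta>)" using elim(3) by (intro mult_left_mono) (auto simp: algebra_simps)
        then show ?thesis using 1 w by simp
      next
        case 2
        then have "0 \<le> s N * (\<mu> * (Z N w - x - \<delta>))" using \<mu> elim(3) by simp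
        then have "?l \<le> ?b" by (simp add: exp_add[symmetric] algebra_simps)
        then show ?thesis by blast
      next
        case 3
        then have "0 \<le> s N * (\<mu> * (x - Z N w - \<delta>))" using \<mu> elim(3) by simp
        then have "?l \<le> ?c" by (simp add: exp_add[symmetric] algebra_simps)
        then show ?thesis by blast
      qed
      with nn show ?thesis by (rule real_le_add3)
    qed
    have "(\<integral>\<^sup>+w. eexp (s N * (l * Z N w)) \<partial>P N) \<le>
      (\<integral>\<^sup>+w. eexp (s N * (l * x + \<bar>l\<bar> * \<delta>)) * indicator ?S w
        + eexp (s N * (- \<mu> * \<delta> - \<mu> * x)) * eexp (s N * ((l + \<mu>) * Z N w))
        + eexp (s N * (- \<mu> * \<delta> + \<mu> * x)) * eexp (s N * ((l - \<mu>) * Z N w)) \<partial>P N)"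
      by (intro nn_integral_mono order.trans[OF ennreal_leI[OF pt]]) (simp_all add: ennreal_mult ennreal_indicator)
    also have "... = eexp (s N * (l * x + \<bar>l\<bar> * \<delta>)) * emeasure (P N) ?S
        + eexp (s N * (- \<mu> * \<delta> - \<mu> * x)) * (\<integral>\<^sup>+w. eexp (s N * ((l + \<mu>) * Z N w)) \<partial>P N)
        + eexp (s N * (- \<mu> * \<delta> + \<mu> * x)) * (\<integral>\<^sup>+w. eexp (s N * ((l - \<mu>) * Z N w)) \<partial>P N)"
      by (simp add: nn_integral_add nn_integral_cmult)
    also have "... \<le> eexp (s N * (l * x + \<bar>l\<bar> * \<delta>)) * ennreal (prob ?S)
        + eexp (s N * (- \<mu> * \<delta> - \<mu> * x)) * eexp (s N * ((l + \<mu>)\<^sup>2 * v / 2 + g))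
        + eexp (s N * (- \<mu> * \<delta> + \<mu> * x)) * eexp (s N * ((l - \<mu>)\<^sup>2 * v / 2 + g))"
      unfolding emeasure_eq_measure by (intro add_mono mult_left_mono elim order.refl) auto
    also have "... = ennreal (exp (s N * (l * x + \<bar>l\<bar> * \<delta>)) * prob ?S
        + exp (s N * ((- \<mu> * \<delta> - \<mu> * x) + ((l + \<mu>)\<^sup>2 * v / 2 + g))) + exp (s N * ((- \<mu> * \<delta> + \<mu> * x) + ((l - \<mu>)\<^sup>2 * v / 2 + g))))"
      by (simp add: ennreal_mult[symmetric] exp_add[symmetric] distrib_left)
    finally have "eexp (s N * (A - \<eta>2)) \<le> ..." using elim(4) by (rule order.trans[rotated])
    then have 1: "exp (s N * (A - \<eta>2)) \<le> exp (s N * (l * x + \<bar>l\<bar> * \<delta>)) * prob ?S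
        + exp (s N * ((- \<mu> * \<delta> - \<mu> * x) + ((l + \<mu>)\<^sup>2 * v / 2 + g))) + exp (s N * ((- \<mu> * \<delta> + \<mu> * x) + ((l - \<mu>)\<^sup>2 * v / 2 + g)))"
      by (subst (asm) ennreal_le_iff) (auto intro!: add_nonneg_nonneg)
    have "(- \<mu> * \<delta> - \<mu> * x) + ((l + \<mu>)\<^sup>2 * v / 2 + g) \<le> A - 2 * g"
      using \<mu>v by (simp add: A_def x_def g_def power2_eq_square field_simps)
    then have 2: "exp (s N * ((- \<mu> * \<delta> - \<mu> * x) + ((l + \<mu>)\<^sup>2 * v / 2 + g))) \<le> exp (s N * (A - 2 * g))"
      using elim(3) by (subst exp_le_cancel_iff) (rule mult_left_mono)
    have "(- \<mu> * \<delta> + \<mu> * x) + ((l - \<mu>)\<^sup>2 * v / 2 + g) \<le> A - 2 * g"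
      using \<mu>v by (simp add: A_def x_def g_def power2_eq_square field_simps)
    then have 3: "exp (s N * ((- \<mu> * \<delta> + \<mu> * x) + ((l - \<mu>)\<^sup>2 * v / 2 + g))) \<le> exp (s N * (A - 2 * g))"
      using elim(3) by (subst exp_le_cancel_iff) (rule mult_left_mono)
    \<comment> \<open>The two tails hold at most two thirds of the tilted mass, so the ball holds a
      third. Dividing by the largest weight on the ball changes the exponent \<open>A\<close> into
      -A - \<bar>l\<bar>\<delta>, because l * x = 2A.\<close>
    have "exp (s N * (A - \<eta>2)) \<le> 3 * (exp (s N * (l * x + \<bar>l\<bar> * \<delta>)) * prob ?S)"
      using 1 2 3 elim(7) by linarith
    then have "exp (- s N * (l * x + \<bar>l\<bar> * \<delta>)) * exp (s N * (A - \<eta>2)) \<le> exp (- s N * (l * x + \<bar>l\<bar> * \<delta>)) * (3 * (exp (s N * (l * x + \<bar>l\<bar> * \<delta>)) * prob ?S))"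
      by (intro mult_left_mono) auto
    also have "... = 3 * prob ?S" by (simp add: exp_minus)
    also have "exp (- s N * (l * x + \<bar>l\<bar> * \<delta>)) * exp (s N * (A - \<eta>2)) = exp (s N * (- A - \<bar>l\<bar> * \<delta> - \<eta>2))"
      by (simp add: exp_add[symmetric] x_def A_def power2_eq_square algebra_simps)
    finally show ?case using elim(8) by linarith
  qed
  then show ?thesis by (simp add: A_def x_def)
qed

section \<open>Second order expansion for truncated variables\<close>

definition trunc :: "real \<Rightarrow> real \<Rightarrow> real" where
  "trunc t x = (if \<bar>x\<bar> \<le> t then x else 0)"

lemma trunc_measurable [measurable]: "trunc t \<in> borel_measurable borel"
  unfolding trunc_def by measurable

lemma abs_trunc_le: "\<bar>trunc t x\<bar> \<le> \<bar>x\<bar>"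
  by (auto simp: trunc_def)

lemma abs_trunc_le_level: "0 \<le> t \<Longrightarrow> \<bar>trunc t x\<bar> \<le> t"
  by (auto simp: trunc_def)

text \<open>The error lives where \<bar>x\<bar> > t, and there powers of \<bar>x\<bar>/t can be
  inserted at no cost. A third moment thus makes the truncation error of order 1/t^2 in the mean
  and, by the next lemma, 1/t in the second moment.\<close>

lemma abs_diff_trunc_le:
  assumes "t > 0"
  shows "\<bar>x - trunc t x\<bar> \<le> \<bar>x\<bar> ^ 3 / t\<^sup>2"
proof (cases "\<bar>x\<bar> \<le> t")
  case False
  then have "t\<^sup>2 \<le> \<bar>x\<bar>\<^sup>2" using assms by (intro power_mono) auto
  then have "\<bar>x\<bar> * t\<^sup>2 \<le> \<bar>x\<bar> * \<bar>x\<bar>\<^sup>2" by (rule mult_left_mono) auto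
  then show ?thesis using assms False by (simp add: trunc_def field_simps power3_eq_cube power2_eq_square)
qed (simp add: trunc_def assms)

lemma abs_diff_trunc_sq_le:
  assumes "t > 0"
  shows "\<bar>x\<^sup>2 - (trunc t x)\<^sup>2\<bar> \<le> \<bar>x\<bar> ^ 3 / t"
proof (cases "\<bar>x\<bar> \<le> t")
  case False
  then have "t * \<bar>x\<bar>\<^sup>2 \<le> \<bar>x\<bar> * \<bar>x\<bar>\<^sup>2" by (intro mult_right_mono) auto
  then show ?thesis using assms False by (simp add: trunc_def field_simps power3_eq_cube power2_eq_square)
qed (simp add: trunc_def assms)

lemma exp_taylor2: "\<bar>exp x - (1 + x + x\<^sup>2 / 2)\<bar> \<le> \<bar>x\<bar> ^ 3 * exp \<bar>x :: real\<bar>"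
proof -
  obtain t where t: "\<bar>t\<bar> \<le> \<bar>x\<bar>" "exp x = (\<Sum>m<3. x ^ m / fact m) + exp t / fact 3 * x ^ 3"
    using Maclaurin_exp_le[of x 3] by blast
  have "exp x - (1 + x + x\<^sup>2 / 2) = exp t / 6 * x ^ 3"
    unfolding t(2) by (simp add: eval_nat_numeral fact_numeral)
  then have "\<bar>exp x - (1 + x + x\<^sup>2 / 2)\<bar> = exp t / 6 * \<bar>x\<bar> ^ 3"
    by (simp only: abs_mult power_abs) simp
  also have "... \<le> exp \<bar>x\<bar> * \<bar>x\<bar> ^ 3"
  proof (rule mult_right_mono)
    have "exp t \<le> exp \<bar>x\<bar>" using t(1) by simp
    then show "exp t / 6 \<le> exp \<bar>x\<bar>" using exp_gt_zero[of t] by linarith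
  qed simp
  finally show ?thesis by (simp add: mult.commute)
qed

lemma exp_le_quadratic:
  assumes "x \<le> (1::real)"
  shows "exp x \<le> 1 + x + x\<^sup>2"
proof (cases "x \<ge> 0")
  case True then show ?thesis using exp_bound assms by blast
next
  case False
  \<comment> \<open>For negative arguments the claim amounts to 1 \<le> (1 - y + y^2) * exp y, for
    which the quadratic Taylor lower bound of exp y is already enough.\<close>
  define y where "y = - x"
  have y: "y > 0" using False by (simp add: y_def)
  have "1 + y + y\<^sup>2 / 2 \<le> exp y" using exp_lower_Taylor_quadratic[of y] y by simp
  moreover have "1 \<le> (1 - y + y\<^sup>2) * (1 + y + y\<^sup>2 / 2)"
  proof -
    have "(1 - y + y\<^sup>2) * (1 + y + y\<^sup>2 / 2) = 1 + y\<^sup>2 * (1/2 + y / 2 + y\<^sup>2 / 2)"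
      by (simp add: field_simps power2_eq_square)
    then show ?thesis using y by simp
  qed
  moreover have pos: "0 \<le> 1 - y + y\<^sup>2" 
  proof -
    have "1 - y + y\<^sup>2 = (y - 1/2)\<^sup>2 + 3/4" by (simp add: algebra_simps power2_eq_square)
    then show ?thesis by simp
  qed
  ultimately have "1 \<le> (1 - y + y\<^sup>2) * exp y"
    by (meson mult_left_mono order.trans)
  then have "exp (- y) \<le> 1 - y + y\<^sup>2"
    by (simp add: exp_minus field_simps)
  then show ?thesis by (simp add: y_def)
qed

lemma cube_add_le:
  assumes "0 \<le> a" "0 \<le> (b::real)"
  shows "(a + b) ^ 3 \<le> 8 * (a ^ 3 + b ^ 3)"
proof -
  have "(a + b) ^ 3 \<le> (2 * max a b) ^ 3" using assms by (intro power_mono) auto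
  also have "... = 8 * (max a b) ^ 3" by (simp add: power_mult_distrib)
  also have "(max a b) ^ 3 \<le> a ^ 3 + b ^ 3" using assms by (auto simp: max_def)
  finally show ?thesis by simp
qed

lemma one_add_cube_ge: "\<bar>x\<bar> \<le> 1 + \<bar>x\<bar> ^ 3" "x\<^sup>2 \<le> 1 + \<bar>x :: real\<bar> ^ 3"
proof -
  have "\<bar>x\<bar> ^ k \<le> 1 + \<bar>x\<bar> ^ 3" if "k \<le> 3" for k
  proof (cases "\<bar>x\<bar> \<le> 1")
    case True
    then have "\<bar>x\<bar> ^ k \<le> 1" by (simp add: power_le_one)
    then show ?thesis by (simp add: add_increasing2)
  next
    case False
    then have "\<bar>x\<bar> ^ k \<le> \<bar>x\<bar> ^ 3" using that by (intro power_increasing) auto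
    then show ?thesis by simp
  qed
  from this[of 1] this[of 2] show "\<bar>x\<bar> \<le> 1 + \<bar>x\<bar> ^ 3" "x\<^sup>2 \<le> 1 + \<bar>x\<bar> ^ 3" by auto
qed

lemma (in finite_measure) third_moment_integrable:
  assumes [measurable]: "X \<in> borel_measurable M" and fin: "(\<integral>\<^sup>+x. ennreal (\<bar>X x\<bar> ^ 3) \<partial>M) < \<infinity>"
  shows "integrable M (\<lambda>x. \<bar>X x\<bar> ^ 3)" "integrable M X" "integrable M (\<lambda>x. (X x)\<^sup>2)"
proof -
  show 3: "integrable M (\<lambda>x. \<bar>X x\<bar> ^ 3)"
    by (rule integrableI_bounded) (use fin in simp_all)
  have i: "integrable M (\<lambda>x. 1 + \<bar>X x\<bar> ^ 3)" using 3 by simp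
  show "integrable M X" by (rule Bochner_Integration.integrable_bound[OF i]) (use one_add_cube_ge(1) in \<open>auto intro!: AE_I2 simp: add_nonneg_nonneg\<close>)
  show "integrable M (\<lambda>x. (X x)\<^sup>2)" by (rule Bochner_Integration.integrable_bound[OF i]) (use one_add_cube_ge(2) in \<open>auto intro!: AE_I2 simp: add_nonneg_nonneg\<close>)
qed

lemma (in prob_space) third_moment_bounds:
  assumes [measurable]: "X \<in> borel_measurable M" and K: "(\<integral>\<^sup>+x. ennreal (\<bar>X x\<bar> ^ 3) \<partial>M) \<le> ennreal K" "K \<ge> 0"
  shows "integrable M (\<lambda>x. \<bar>X x\<bar> ^ 3)" "(\<integral>x. \<bar>X x\<bar> ^ 3 \<partial>M) \<le> K"
    "integrable M X" "integrable M (\<lambda>x. (X x)\<^sup>2)" "\<bar>\<integral>x. X x \<partial>M\<bar> \<le> 1 + K" "(\<integral>x. (X x)\<^sup>2 \<partial>M) \<le> 1 + K"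
proof -
  have "(\<integral>\<^sup>+x. ennreal (\<bar>X x\<bar> ^ 3) \<partial>M) < \<infinity>"
    using K by (simp add: order.strict_trans1[OF _ ennreal_less_top])
  note int = third_moment_integrable[OF assms(1) this]
  then show 3: "integrable M (\<lambda>x. \<bar>X x\<bar> ^ 3)" and "integrable M X" and 2: "integrable M (\<lambda>x. (X x)\<^sup>2)" by auto
  have i: "integrable M (\<lambda>x. 1 + \<bar>X x\<bar> ^ 3)" using 3 by simp
  show K3: "(\<integral>x. \<bar>X x\<bar> ^ 3 \<partial>M) \<le> K"
    using K by (subst integral_eq_nn_integral) (auto intro!: enn2real_leI)
  have "\<bar>\<integral>x. X x \<partial>M\<bar> \<le> (\<integral>x. \<bar>X x\<bar> \<partial>M)" by (rule integral_abs_bound)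
  also have "... \<le> (\<integral>x. 1 + \<bar>X x\<bar> ^ 3 \<partial>M)" by (intro integral_mono i one_add_cube_ge) (simp add: \<open>integrable M X\<close>)
  also have "... \<le> 1 + K" using 3 K3 by (simp add: prob_space)
  finally show "\<bar>\<integral>x. X x \<partial>M\<bar> \<le> 1 + K" .
  have "(\<integral>x. (X x)\<^sup>2 \<partial>M) \<le> (\<integral>x. 1 + \<bar>X x\<bar> ^ 3 \<partial>M)" by (intro integral_mono i one_add_cube_ge 2)
  also have "... \<le> 1 + K" using 3 K3 by (simp add: prob_space)
  finally show "(\<integral>x. (X x)\<^sup>2 \<partial>M) \<le> 1 + K" .
qed

text \<open>\<open>Y\<close> is centred at the mean of \<open>X\<close>, so the first-order term
  consists of truncation bias alone. The three error terms are the bias in the mean, the bias in the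
  variance and the cubic Taylor remainder; an exponential moment is asked of \<open>Y\<close>
  only.\<close>

lemma (in prob_space) mgf_expansion:
  fixes X :: "'a \<Rightarrow> real" and \<theta> t K :: real
  defines "Y \<equiv> \<lambda>x. trunc t (X x)"
  defines "A \<equiv> \<integral>x. X x \<partial>M"
  assumes [measurable]: "X \<in> borel_measurable M"
    and K: "(\<integral>\<^sup>+x. ennreal (\<bar>X x\<bar> ^ 3) \<partial>M) \<le> ennreal K" "K \<ge> 0"
    and KY: "(\<integral>\<^sup>+x. ennreal (\<bar>Y x\<bar> ^ 3 * exp (\<bar>\<theta>\<bar> * \<bar>Y x\<bar>)) \<partial>M) \<le> ennreal K"
    and t: "t > 0" and \<theta>: "\<bar>\<theta>\<bar> \<le> 1"
  shows "integrable M (\<lambda>x. exp (\<theta> * (Y x - A)))"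
    "\<bar>(\<integral>x. exp (\<theta> * (Y x - A)) \<partial>M) - (1 + \<theta>\<^sup>2 / 2 * ((\<integral>x. (X x)\<^sup>2 \<partial>M) - A\<^sup>2))\<bar>
      \<le> \<bar>\<theta>\<bar> * (K / t\<^sup>2) + \<theta>\<^sup>2 / 2 * (K / t + 2 * (1 + K) * (K / t\<^sup>2))
        + \<bar>\<theta>\<bar> ^ 3 * (8 * exp (1 + K) * (K + (1 + K) ^ 3 * (exp 1 + K)))"
proof -
  define m where "m = 1 + K"
  have m: "m \<ge> 0" using K by (simp add: m_def)
  have [measurable]: "Y \<in> borel_measurable M" unfolding Y_def by measurable
  note X = third_moment_bounds[OF \<open>X \<in> borel_measurable M\<close> K]
  have A: "\<bar>A\<bar> \<le> m" using X(5) by (simp add: A_def m_def)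
  define G where "G = (\<lambda>x. \<bar>Y x\<bar> ^ 3 * exp (\<bar>\<theta>\<bar> * \<bar>Y x\<bar>))"
  have [measurable]: "G \<in> borel_measurable M" unfolding G_def by measurable
  have G0: "G x \<ge> 0" for x by (simp add: G_def)
  have Gi: "integrable M G"
  proof (rule integrableI_bounded)
    show "(\<integral>\<^sup>+x. ennreal (norm (G x)) \<partial>M) < \<infinity>"
      using KY G0 by (simp add: G_def order.strict_trans1[OF _ ennreal_less_top])
  qed simp
  have GK: "(\<integral>x. G x \<partial>M) \<le> K"
    using KY K(2) G0 by (subst integral_eq_nn_integral) (auto intro!: enn2real_leI simp: G_def)
  have Ybd: "\<bar>Y x\<bar> \<le> t" for x using t by (simp add: Y_def abs_trunc_le_level)
  have Yi: "integrable M Y" by (rule integrable_const_bound[of _ t]) (use Ybd in auto)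
  have Y2i: "integrable M (\<lambda>x. (Y x)\<^sup>2)"
    by (rule integrable_const_bound[of _ "t\<^sup>2"]) (use Ybd t in \<open>auto simp: abs_le_square_iff[symmetric]\<close>)
  show Ei: "integrable M (\<lambda>x. exp (\<theta> * (Y x - A)))"
  proof (rule integrable_const_bound[of _ "exp (t + m)"])
    have "\<theta> * (Y x - A) \<le> t + m" for x
    proof -
      have "\<theta> * (Y x - A) \<le> \<bar>\<theta>\<bar> * \<bar>Y x - A\<bar>" by (simp add: abs_mult[symmetric])
      also have "... \<le> 1 * (t + m)" using \<theta> Ybd[of x] A by (intro mult_mono) auto
      finally show ?thesis by simp
    qed
    then show "AE x in M. norm (exp (\<theta> * (Y x - A))) \<le> exp (t + m)" by simp
  qed simp
  \<comment> \<open>Origin of the constant: 8 comes from the cube of \<bar>Y\<bar> + m, exp m from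
    moving the centre by at most m = 1 + K, and exp 1 + K from bounding the exponential moment of
    \<open>Y\<close> through \<open>G\<close>.\<close>
  define D where "D = 8 * exp m * (K + m ^ 3 * (exp 1 + K))"
  have pt: "\<bar>exp (\<theta> * (Y x - A)) - (1 + \<theta> * (Y x - A) + \<theta>\<^sup>2 / 2 * (Y x - A)\<^sup>2)\<bar>
      \<le> \<bar>\<theta>\<bar> ^ 3 * (8 * exp m * (G x + m ^ 3 * (exp 1 + G x)))" for x
  proof -
    have "\<bar>exp (\<theta> * (Y x - A)) - (1 + \<theta> * (Y x - A) + \<theta>\<^sup>2 / 2 * (Y x - A)\<^sup>2)\<bar>
        \<le> \<bar>\<theta> * (Y x - A)\<bar> ^ 3 * exp \<bar>\<theta> * (Y x - A)\<bar>"
      using exp_taylor2[of "\<theta> * (Y x - A)"] by (simp add: power_mult_distrib)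
    also have "... = \<bar>\<theta>\<bar> ^ 3 * (\<bar>Y x - A\<bar> ^ 3 * exp (\<bar>\<theta>\<bar> * \<bar>Y x - A\<bar>))"
      by (simp add: abs_mult power_mult_distrib)
    also have "\<bar>Y x - A\<bar> ^ 3 * exp (\<bar>\<theta>\<bar> * \<bar>Y x - A\<bar>) \<le> (8 * (\<bar>Y x\<bar> ^ 3 + m ^ 3)) * (exp m * exp (\<bar>\<theta>\<bar> * \<bar>Y x\<bar>))"
    proof (rule mult_mono)
      have "\<bar>Y x - A\<bar> ^ 3 \<le> (\<bar>Y x\<bar> + m) ^ 3" using A by (intro power_mono) auto
      also have "... \<le> 8 * (\<bar>Y x\<bar> ^ 3 + m ^ 3)" using m by (intro cube_add_le) auto
      finally show "\<bar>Y x - A\<bar> ^ 3 \<le> 8 * (\<bar>Y x\<bar> ^ 3 + m ^ 3)" .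
      have "\<bar>\<theta>\<bar> * \<bar>Y x - A\<bar> \<le> \<bar>\<theta>\<bar> * (\<bar>Y x\<bar> + m)" using A by (intro mult_left_mono) auto
      also have "... \<le> m + \<bar>\<theta>\<bar> * \<bar>Y x\<bar>" using \<theta> m by (simp add: distrib_left mult_left_le_one_le)
      finally show "exp (\<bar>\<theta>\<bar> * \<bar>Y x - A\<bar>) \<le> exp m * exp (\<bar>\<theta>\<bar> * \<bar>Y x\<bar>)"
        by (simp add: exp_add[symmetric])
    qed (use m in auto)
    also have "... = 8 * exp m * (G x + m ^ 3 * exp (\<bar>\<theta>\<bar> * \<bar>Y x\<bar>))"
      by (simp add: G_def algebra_simps)
    also have "... \<le> 8 * exp m * (G x + m ^ 3 * (exp 1 + G x))"
    proof (intro mult_left_mono add_left_mono)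
      \<comment> \<open>\<open>G\<close> carries a cube that vanishes with \<open>Y\<close>, so it
        controls the bare exponential only where \<bar>Y\<bar> > 1.\<close>
      show "exp (\<bar>\<theta>\<bar> * \<bar>Y x\<bar>) \<le> exp 1 + G x"
      proof (cases "\<bar>Y x\<bar> \<le> 1")
        case True
        then have "\<bar>\<theta>\<bar> * \<bar>Y x\<bar> \<le> 1" using \<theta> by (simp add: mult_le_one)
        then have "exp (\<bar>\<theta>\<bar> * \<bar>Y x\<bar>) \<le> exp 1" by simp
        then show ?thesis using G0[of x] by linarith
      next
        case False
        then have "1 \<le> \<bar>Y x\<bar> ^ 3" by simp
        then have "1 * exp (\<bar>\<theta>\<bar> * \<bar>Y x\<bar>) \<le> G x" unfolding G_def by (intro mult_right_mono) auto
        then show ?thesis using exp_gt_zero[of "1::real"] by linarith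
      qed
    qed (use m in auto)
    finally show ?thesis by (simp add: mult_left_mono)
  qed
  have YAi: "integrable M (\<lambda>x. (Y x - A)\<^sup>2)"
    using Yi Y2i by (simp add: power2_diff)
  have 1: "(\<integral>x. (1 + \<theta> * (Y x - A) + \<theta>\<^sup>2 / 2 * (Y x - A)\<^sup>2) \<partial>M) =
      1 + \<theta> * ((\<integral>x. Y x \<partial>M) - A) + \<theta>\<^sup>2 / 2 * (\<integral>x. (Y x - A)\<^sup>2 \<partial>M)"
    using Yi YAi by (simp add: prob_space)
  have 2: "\<bar>(\<integral>x. exp (\<theta> * (Y x - A)) \<partial>M) - (\<integral>x. (1 + \<theta> * (Y x - A) + \<theta>\<^sup>2 / 2 * (Y x - A)\<^sup>2) \<partial>M)\<bar> \<le> \<bar>\<theta>\<bar> ^ 3 * D"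
  proof -
    have "\<bar>(\<integral>x. exp (\<theta> * (Y x - A)) \<partial>M) - (\<integral>x. (1 + \<theta> * (Y x - A) + \<theta>\<^sup>2 / 2 * (Y x - A)\<^sup>2) \<partial>M)\<bar>
      = \<bar>\<integral>x. exp (\<theta> * (Y x - A)) - (1 + \<theta> * (Y x - A) + \<theta>\<^sup>2 / 2 * (Y x - A)\<^sup>2) \<partial>M\<bar>"
      using Ei Yi YAi by (subst Bochner_Integration.integral_diff) auto
    also have "... \<le> (\<integral>x. \<bar>exp (\<theta> * (Y x - A)) - (1 + \<theta> * (Y x - A) + \<theta>\<^sup>2 / 2 * (Y x - A)\<^sup>2)\<bar> \<partial>M)"
      by (rule integral_abs_bound)
    also have "... \<le> (\<integral>x. \<bar>\<theta>\<bar> ^ 3 * (8 * exp m * (G x + m ^ 3 * (exp 1 + G x))) \<partial>M)"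
      using Ei Yi YAi Gi pt by (intro integral_mono) auto
    also have "... = \<bar>\<theta>\<bar> ^ 3 * (8 * exp m * ((\<integral>x. G x \<partial>M) + m ^ 3 * (exp 1 + (\<integral>x. G x \<partial>M))))"
      using Gi by (simp add: prob_space)
    also have "... \<le> \<bar>\<theta>\<bar> ^ 3 * D"
      unfolding D_def using GK m by (intro mult_left_mono add_mono) auto
    finally show ?thesis .
  qed
  have XY: "\<bar>(\<integral>x. X x \<partial>M) - (\<integral>x. Y x \<partial>M)\<bar> \<le> K / t\<^sup>2"
  proof -
    have "\<bar>(\<integral>x. X x \<partial>M) - (\<integral>x. Y x \<partial>M)\<bar> = \<bar>\<integral>x. X x - Y x \<partial>M\<bar>" using X Yi by simp
    also have "... \<le> (\<integral>x. \<bar>X x - Y x\<bar> \<partial>M)" by (rule integral_abs_bound)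
    also have "... \<le> (\<integral>x. \<bar>X x\<bar> ^ 3 / t\<^sup>2 \<partial>M)"
      using X Yi abs_diff_trunc_le[OF t] by (intro integral_mono) (auto simp: Y_def)
    also have "... \<le> K / t\<^sup>2" using X(2) by (simp add: divide_right_mono)
    finally show ?thesis .
  qed
  have XY2: "\<bar>(\<integral>x. (X x)\<^sup>2 \<partial>M) - (\<integral>x. (Y x)\<^sup>2 \<partial>M)\<bar> \<le> K / t"
  proof -
    have "\<bar>(\<integral>x. (X x)\<^sup>2 \<partial>M) - (\<integral>x. (Y x)\<^sup>2 \<partial>M)\<bar> = \<bar>\<integral>x. (X x)\<^sup>2 - (Y x)\<^sup>2 \<partial>M\<bar>" using X Y2i by simp
    also have "... \<le> (\<integral>x. \<bar>(X x)\<^sup>2 - (Y x)\<^sup>2\<bar> \<partial>M)" by (rule integral_abs_bound)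
    also have "... \<le> (\<integral>x. \<bar>X x\<bar> ^ 3 / t \<partial>M)"
      using X Y2i abs_diff_trunc_sq_le[OF t] by (intro integral_mono) (auto simp: Y_def)
    also have "... \<le> K / t" using X(2) t by (simp add: divide_right_mono)
    finally show ?thesis .
  qed
  have 3: "\<bar>(\<integral>x. (Y x - A)\<^sup>2 \<partial>M) - ((\<integral>x. (X x)\<^sup>2 \<partial>M) - A\<^sup>2)\<bar> \<le> K / t + 2 * m * (K / t\<^sup>2)"
  proof -
    have "(\<integral>x. (Y x - A)\<^sup>2 \<partial>M) = (\<integral>x. (Y x)\<^sup>2 \<partial>M) + A\<^sup>2 - 2 * A * (\<integral>x. Y x \<partial>M)"
      using Yi Y2i by (simp add: power2_diff prob_space mult.commute mult.assoc)
    then have "(\<integral>x. (Y x - A)\<^sup>2 \<partial>M) - ((\<integral>x. (X x)\<^sup>2 \<partial>M) - A\<^sup>2)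
      = - ((\<integral>x. (X x)\<^sup>2 \<partial>M) - (\<integral>x. (Y x)\<^sup>2 \<partial>M)) + 2 * A * ((\<integral>x. X x \<partial>M) - (\<integral>x. Y x \<partial>M))"
      by (simp add: A_def[symmetric] power2_eq_square algebra_simps)
    also have "\<bar>...\<bar> \<le> \<bar>(\<integral>x. (X x)\<^sup>2 \<partial>M) - (\<integral>x. (Y x)\<^sup>2 \<partial>M)\<bar> + 2 * \<bar>A\<bar> * \<bar>(\<integral>x. X x \<partial>M) - (\<integral>x. Y x \<partial>M)\<bar>"
      by (rule order.trans[OF abs_triangle_ineq]) (simp add: abs_mult)
    also have "... \<le> K / t + 2 * m * (K / t\<^sup>2)"
      using A m by (intro add_mono XY2 mult_mono XY) auto
    finally show ?thesis .
  qed
  have 4: "\<bar>\<theta> * ((\<integral>x. Y x \<partial>M) - A)\<bar> \<le> \<bar>\<theta>\<bar> * (K / t\<^sup>2)"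
    using XY by (simp only: abs_mult A_def) (intro mult_left_mono, auto simp: abs_minus_commute)
  have 5: "\<bar>\<theta>\<^sup>2 / 2 * ((\<integral>x. (Y x - A)\<^sup>2 \<partial>M) - ((\<integral>x. (X x)\<^sup>2 \<partial>M) - A\<^sup>2))\<bar> \<le> \<theta>\<^sup>2 / 2 * (K / t + 2 * m * (K / t\<^sup>2))"
    using 3 by (simp only: abs_mult) (intro mult_mono, auto)
  show "\<bar>(\<integral>x. exp (\<theta> * (Y x - A)) \<partial>M) - (1 + \<theta>\<^sup>2 / 2 * ((\<integral>x. (X x)\<^sup>2 \<partial>M) - A\<^sup>2))\<bar>
      \<le> \<bar>\<theta>\<bar> * (K / t\<^sup>2) + \<theta>\<^sup>2 / 2 * (K / t + 2 * (1 + K) * (K / t\<^sup>2))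
        + \<bar>\<theta>\<bar> ^ 3 * (8 * exp (1 + K) * (K + (1 + K) ^ 3 * (exp 1 + K)))"
    using 2[unfolded 1] 4 5 unfolding D_def[symmetric] m_def[symmetric] right_diff_distrib[of "\<theta>\<^sup>2 / 2"]
    by linarith
qed

text \<open>The expansion is uniform over all laws \<open>p\<close> with the given moment bounds, so it can be
  applied conditionally on the previous generation.\<close>
lemma one_step_rate:
  fixes e t :: "nat \<Rightarrow> real" and X :: "'a::topological_space \<Rightarrow> real" and K l m :: real
  assumes e0: "\<forall>\<^sub>F N in sequentially. e N > 0" and e: "e \<longlonglongrightarrow> 0"
    and t: "filterlim t at_top sequentially" and et: "filterlim (\<lambda>N. e N * (t N)\<^sup>2) at_top sequentially"
    and [measurable]: "X \<in> borel_measurable borel" and K: "K \<ge> 0" and \<eta>: "\<eta> > 0"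
  shows "\<forall>\<^sub>F N in sequentially. \<forall>p. prob_space p \<longrightarrow> sets p = sets borel \<longrightarrow>
     (\<integral>\<^sup>+x. ennreal (\<bar>X x\<bar> ^ 3) \<partial>p) \<le> ennreal K \<longrightarrow>
     (\<integral>\<^sup>+x. ennreal (\<bar>trunc (t N) (X x)\<bar> ^ 3 * exp (\<bar>l * e N\<bar> * \<bar>trunc (t N) (X x)\<bar>)) \<partial>p) \<le> ennreal K \<longrightarrow>
     (let u = l * ((\<integral>x. X x \<partial>p) - m) / e N + l\<^sup>2 / 2 * ((\<integral>x. (X x)\<^sup>2 \<partial>p) - (\<integral>x. X x \<partial>p)\<^sup>2);
          q = (\<integral>\<^sup>+x. eexp (l * e N * (trunc (t N) (X x) - m)) \<partial>p)
      in eexp ((e N)\<^sup>2 * (u - \<eta>)) \<le> q \<and> q \<le> eexp ((e N)\<^sup>2 * (u + \<eta>)))"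
proof -
  define D where "D = 8 * exp (1 + K) * (K + (1 + K) ^ 3 * (exp 1 + K))"
  \<comment> \<open>\<open>E N\<close> is the error of \<open>mgf_expansion\<close> at \<theta> = l
    * e N divided by \<open>(e N)\<^sup>2\<close>. The bias in the mean is divided by one power of
    \<open>e N\<close> too many, which is why \<open>e N * (t N)\<^sup>2\<close> has to
    diverge.\<close>
  define E where "E = (\<lambda>N. \<bar>l\<bar> * K * inverse (e N * (t N)\<^sup>2)
    + l\<^sup>2 / 2 * (K * inverse (t N) + 2 * (1 + K) * K * (inverse (t N))\<^sup>2) + \<bar>l\<bar> ^ 3 * D * e N)"
  define B where "B = l\<^sup>2 / 2 * (1 + K) + \<eta>"
  have it: "(\<lambda>N. inverse (t N)) \<longlonglongrightarrow> 0" "(\<lambda>N. inverse (e N * (t N)\<^sup>2)) \<longlonglongrightarrow> 0"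
    by (intro tendsto_inverse_0_at_top t et)+
  have "E \<longlonglongrightarrow> \<bar>l\<bar> * K * 0 + l\<^sup>2 / 2 * (K * 0 + 2 * (1 + K) * K * 0\<^sup>2) + \<bar>l\<bar> ^ 3 * D * 0"
    unfolding E_def by (intro tendsto_intros it e)
  then have "E \<longlonglongrightarrow> 0" by simp
  then have E: "\<forall>\<^sub>F N in sequentially. E N < \<eta> / 2" by (rule order_tendstoD) (use \<eta> in simp)
  have "(\<lambda>N. (e N)\<^sup>2 * B\<^sup>2) \<longlonglongrightarrow> 0\<^sup>2 * B\<^sup>2" by (intro tendsto_intros e)
  then have eB: "\<forall>\<^sub>F N in sequentially. (e N)\<^sup>2 * B\<^sup>2 < \<eta> / 2" using \<eta> by (intro order_tendstoD(2)) auto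
  have "(\<lambda>N. (e N)\<^sup>2 * B) \<longlonglongrightarrow> 0\<^sup>2 * B" by (intro tendsto_intros e)
  then have eB1: "\<forall>\<^sub>F N in sequentially. (e N)\<^sup>2 * B < 1" by (intro order_tendstoD(2)) auto
  have "(\<lambda>N. \<bar>l * e N\<bar>) \<longlonglongrightarrow> \<bar>l * 0\<bar>" by (intro tendsto_intros e)
  then have le: "\<forall>\<^sub>F N in sequentially. \<bar>l * e N\<bar> < 1" by (intro order_tendstoD(2)) auto
  have t0: "\<forall>\<^sub>F N in sequentially. t N > 0" using t by (simp add: filterlim_at_top_dense)
  from e0 E eB eB1 le t0 show ?thesis
  proof eventually_elim
    case (elim N)
    show ?case
    proof (intro allI impI)
      fix p :: "'a measure"
      assume p: "prob_space p" and sp[measurable_cong]: "sets p = sets borel"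
        and K1: "(\<integral>\<^sup>+x. ennreal (\<bar>X x\<bar> ^ 3) \<partial>p) \<le> ennreal K"
        and K2: "(\<integral>\<^sup>+x. ennreal (\<bar>trunc (t N) (X x)\<bar> ^ 3 * exp (\<bar>l * e N\<bar> * \<bar>trunc (t N) (X x)\<bar>)) \<partial>p) \<le> ennreal K"
      interpret prob_space p by fact
      have [measurable]: "X \<in> borel_measurable p" by measurable
      define A where "A = (\<integral>x. X x \<partial>p)"
      define S where "S = (\<integral>x. (X x)\<^sup>2 \<partial>p) - A\<^sup>2"
      define r where "r = (\<integral>x. exp (l * e N * (trunc (t N) (X x) - A)) \<partial>p)"
      note X = third_moment_bounds[OF \<open>X \<in> borel_measurable p\<close> K1 K]
      note ex = mgf_expansion[OF \<open>X \<in> borel_measurable p\<close> K1 K K2 elim(6) less_imp_le[OF elim(5)], folded A_def]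
      have S: "0 \<le> S" "S \<le> 1 + K"
      proof -
        have "S = variance X" using variance_eq[OF X(3,4)] by (simp add: S_def A_def)
        then show "0 \<le> S" by simp
        show "S \<le> 1 + K" using X(6) by (simp add: S_def add_increasing2 diff_le_eq)
      qed
      define w where "w = l\<^sup>2 / 2 * S"
      have w: "0 \<le> w" "w \<le> l\<^sup>2 / 2 * (1 + K)" unfolding w_def using S by (auto intro: mult_left_mono)
      have err: "\<bar>l * e N\<bar> * (K / (t N)\<^sup>2) + (l * e N)\<^sup>2 / 2 * (K / t N + 2 * (1 + K) * (K / (t N)\<^sup>2))
          + \<bar>l * e N\<bar> ^ 3 * D = (e N)\<^sup>2 * E N"
        using elim(1) elim(6) unfolding E_def
        by (simp add: abs_mult power_mult_distrib power2_eq_square power3_eq_cube field_simps)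
      have "\<bar>r - (1 + (l * e N)\<^sup>2 / 2 * S)\<bar> \<le> (e N)\<^sup>2 * E N"
        using ex(2) unfolding r_def S_def D_def[symmetric] err .
      also have "... \<le> (e N)\<^sup>2 * (\<eta> / 2)" using elim(2) by (intro mult_left_mono) auto
      also have "(l * e N)\<^sup>2 / 2 * S = (e N)\<^sup>2 * w" by (simp add: w_def power_mult_distrib)
      finally have r: "\<bar>r - (1 + (e N)\<^sup>2 * w)\<bar> \<le> (e N)\<^sup>2 * (\<eta> / 2)" .
      have up: "r \<le> exp ((e N)\<^sup>2 * (w + \<eta>))"
      proof -
        have "r \<le> 1 + (e N)\<^sup>2 * (w + \<eta> / 2)" using r unfolding distrib_left by linarith
        also have "... \<le> exp ((e N)\<^sup>2 * (w + \<eta> / 2))" by (rule exp_ge_add_one_self)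
        also have "... \<le> exp ((e N)\<^sup>2 * (w + \<eta>))" using \<eta> by (subst exp_le_cancel_iff) (intro mult_left_mono, auto)
        finally show ?thesis .
      qed
      have low: "exp ((e N)\<^sup>2 * (w - \<eta>)) \<le> r"
      proof -
        have wB: "\<bar>w - \<eta>\<bar> \<le> B" using w \<eta> unfolding B_def by linarith
        then have "(w - \<eta>) \<le> B" by simp
        then have "(e N)\<^sup>2 * (w - \<eta>) \<le> (e N)\<^sup>2 * B" by (rule mult_left_mono) simp
        \<comment> \<open>For the lower bound the exponential is estimated from above; its quadratic
          term has order \<open>e N\<close> to the fourth power and fits into half of
          \<eta>.\<close>
        then have "exp ((e N)\<^sup>2 * (w - \<eta>)) \<le> 1 + (e N)\<^sup>2 * (w - \<eta>) + ((e N)\<^sup>2 * (w - \<eta>))\<^sup>2"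
          using elim(4) by (intro exp_le_quadratic) simp
        also have "((e N)\<^sup>2 * (w - \<eta>))\<^sup>2 = (e N)\<^sup>2 * ((e N)\<^sup>2 * \<bar>w - \<eta>\<bar>\<^sup>2)"
          by (simp add: power_mult_distrib power2_eq_square)
        also have "... \<le> (e N)\<^sup>2 * ((e N)\<^sup>2 * B\<^sup>2)"
          using wB by (intro mult_left_mono power_mono) auto
        also have "... \<le> (e N)\<^sup>2 * (\<eta> / 2)" using elim(3) by (intro mult_left_mono) auto
        also have "1 + (e N)\<^sup>2 * (w - \<eta>) + (e N)\<^sup>2 * (\<eta> / 2) \<le> r"
          using r unfolding right_diff_distrib distrib_left by linarith
        finally show ?thesis by simp
      qed
      define q where "q = (\<integral>\<^sup>+x. eexp (l * e N * (trunc (t N) (X x) - m)) \<partial>p)"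
      define u where "u = l * (A - m) / e N + w"
      \<comment> \<open>Recentring from \<open>m\<close> to the true mean \<open>A\<close> gives an
        exact deterministic factor. It is the drift part of \<open>u\<close>, and only the variance
        part is approximated.\<close>
      have "q = (\<integral>\<^sup>+x. eexp (l * e N * (A - m)) * eexp (l * e N * (trunc (t N) (X x) - A)) \<partial>p)"
        unfolding q_def by (intro nn_integral_cong) (simp add: ennreal_mult[symmetric] exp_add[symmetric] algebra_simps)
      also have "... = eexp (l * e N * (A - m)) * (\<integral>\<^sup>+x. eexp (l * e N * (trunc (t N) (X x) - A)) \<partial>p)"
        by (rule nn_integral_cmult) measurable
      also have "(\<integral>\<^sup>+x. eexp (l * e N * (trunc (t N) (X x) - A)) \<partial>p) = ennreal r"
        unfolding r_def by (rule nn_integral_eq_integral[OF ex(1)]) simp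
      finally have q: "q = ennreal (exp (l * e N * (A - m)) * r)"
        by (simp add: ennreal_mult')
      have uu: "exp ((e N)\<^sup>2 * (u + x)) = exp (l * e N * (A - m)) * exp ((e N)\<^sup>2 * (w + x))" for x
        using elim(1) by (simp add: u_def exp_add[symmetric] power2_eq_square field_simps)
      have "eexp ((e N)\<^sup>2 * (u - \<eta>)) \<le> q \<and> q \<le> eexp ((e N)\<^sup>2 * (u + \<eta>))"
        unfolding q using uu[of \<eta>] uu[of "- \<eta>"] up low
        by (auto intro!: ennreal_leI mult_left_mono)
      then show "(let u = l * ((\<integral>x. X x \<partial>p) - m) / e N + l\<^sup>2 / 2 * ((\<integral>x. (X x)\<^sup>2 \<partial>p) - (\<integral>x. X x \<partial>p)\<^sup>2);
          q = (\<integral>\<^sup>+x. eexp (l * e N * (trunc (t N) (X x) - m)) \<partial>p)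
        in eexp ((e N)\<^sup>2 * (u - \<eta>)) \<le> q \<and> q \<le> eexp ((e N)\<^sup>2 * (u + \<eta>)))"
        unfolding Let_def q_def[symmetric] A_def[symmetric] S_def[symmetric] w_def[symmetric] u_def[symmetric] .
    qed
  qed
qed

section \<open>Quadratic Laplace limits and deviation principles\<close>

lemma elog_div_le:
  assumes "0 \<le> p" "p \<le> exp (s * c)" "s > 0"
  shows "elog p / ereal s \<le> ereal c"
proof (cases "p = 0")
  case True
  then show ?thesis using assms(3) by (simp add: elog_def)
next
  case False
  then have "p > 0" using assms by simp
  then have "ln p \<le> s * c" using assms(2) by (metis ln_exp ln_le_cancel_iff exp_gt_zero)
  then show ?thesis using False assms(3) by (simp add: elog_def field_simps)
qed

lemma elog_div_ge:
  assumes "exp (s * c) \<le> p" "s > 0"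
  shows "ereal c \<le> elog p / ereal s"
proof -
  have p: "p > 0" using assms(1) exp_gt_zero[of "s * c"] by linarith
  then have "s * c \<le> ln p" using assms by (simp add: ln_ge_iff)
  then show ?thesis using p assms(2) by (simp add: elog_def field_simps)
qed

text \<open>Exponential moments are required of \<open>Y\<close> alone; \<open>Z\<close> inherits
  the principle because the two differ only with superexponentially small probability. On the line,
  the point of the closure nearest to 0 decides the upper bound, and tilting by slopes
  \<open>l\<close> reaches the points \<open>l * v\<close> for the lower bound.\<close>

lemma gaertner_ellis_quadratic:
  fixes P :: "nat \<Rightarrow> 'w measure" and b :: "nat \<Rightarrow> real" and Z Y :: "nat \<Rightarrow> 'w \<Rightarrow> real"
  assumes b: "filterlim b at_top sequentially"
    and P: "\<forall>\<^sub>F N in sequentially. prob_space (P N)"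
    and Y: "\<And>l. exp_rate P (\<lambda>N. (b N)\<^sup>2) (\<lambda>N w. l * Y N w) (l\<^sup>2 * v / 2)"
    and meas: "\<forall>\<^sub>F N in sequentially. Z N \<in> borel_measurable (P N) \<and> Y N \<in> borel_measurable (P N)"
    and ZY: "\<And>R. \<forall>\<^sub>F N in sequentially. measure (P N) {w\<in>space (P N). Z N w \<noteq> Y N w} \<le> exp ((b N)\<^sup>2 * R)"
    and v: "v \<ge> 0"
  shows "dev_principle P Z b (\<lambda>x. SUP l. ereal (l * x - l\<^sup>2 * v / 2))"
proof -
  define I where "I = (\<lambda>x. SUP l. ereal (l * x - l\<^sup>2 * v / 2))"
  define s where "s = (\<lambda>N. (b N)\<^sup>2)"
  have s: "filterlim s at_top sequentially"
    unfolding s_def by (intro filterlim_pow_at_top b) simp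
  have s0: "\<forall>\<^sub>F N in sequentially. s N > 0" using s by (simp add: filterlim_at_top_dense)
  have Ym: "\<forall>\<^sub>F N in sequentially. Y N \<in> borel_measurable (P N)" using meas by eventually_elim simp
  note Y = Y[folded s_def] and ZY = ZY[folded s_def[THEN fun_cong]]
  show ?thesis
    unfolding dev_principle_def I_def[symmetric]
  proof (intro ballI)
    fix \<Gamma> :: "real set" assume \<Gamma>[measurable]: "\<Gamma> \<in> sets borel"
    define p where "p = (\<lambda>N. measure (P N) {w \<in> space (P N). Z N w \<in> \<Gamma>})"
    define q where "q = (\<lambda>N. elog (p N) / ereal (s N))"
    have upper: "limsup q \<le> ereal c" if c: "- (INF x\<in>closure \<Gamma>. I x) < ereal c" for c
    proof -
      obtain c' where c': "- (INF x\<in>closure \<Gamma>. I x) < ereal c'" "c' < c"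
        using ereal_dense2[OF c] by (metis less_ereal.simps(1))
      then have cI: "ereal (- c') < (INF x\<in>closure \<Gamma>. I x)"
        by (simp add: ereal_uminus_less_reorder)
      have "\<forall>\<^sub>F N in sequentially. p N \<le> exp (s N * c)"
      proof (cases "\<Gamma> = {}")
        case True
        then show ?thesis by (simp add: p_def)
      next
        case False
        then have "closure \<Gamma> \<noteq> {}" by simp
        \<comment> \<open>Every value in \<open>\<Gamma>\<close> has modulus at least
          \<open>\<bar>x0\<bar>\<close>, so one two-sided tail bound covers the whole set and no
          covering argument is needed.\<close>
        then obtain x0 where x0: "x0 \<in> closure \<Gamma>" "\<And>x. x \<in> closure \<Gamma> \<Longrightarrow> dist 0 x0 \<le> dist 0 x"
          using distance_attains_inf[of "closure \<Gamma>" 0] by auto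
        have "ereal (- c') < I x0" using cI x0(1) by (rule less_INF_D)
        then obtain l where l: "- c' < l * x0 - l\<^sup>2 * v / 2"
          unfolding I_def less_SUP_iff by auto
        \<comment> \<open>\<open>u\<close> exceeds \<open>l\<^sup>2 * v / 2\<close>, as the tail
          estimate demands, and stays below \<open>c' + l * x0\<close>, which yields u -
          \<bar>l\<bar> * \<bar>x0\<bar> \<le> c'.\<close>
        define u where "u = (l\<^sup>2 * v / 2 + (c' + l * x0)) / 2"
        have u: "\<bar>l\<bar>\<^sup>2 * v / 2 < u" "u < c' + l * x0" using l by (auto simp: u_def)
        have lx: "l * x0 \<le> \<bar>l\<bar> * \<bar>x0\<bar>" by (simp add: abs_mult[symmetric])
        have t: "\<forall>\<^sub>F N in sequentially. \<forall>d. emeasure (P N) {w\<in>space (P N). d \<le> \<bar>Y N w\<bar>} \<le> ennreal (2 * exp (s N * (u - \<bar>l\<bar> * d)))"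
          by (rule exp_rate_tail[OF s Y Ym abs_ge_zero u(1)])
        have e3: "\<forall>\<^sub>F N in sequentially. 3 * exp (s N * c') \<le> exp (s N * c)"
          by (rule eventually_const_exp_le[OF s c'(2)])
        from P meas s0 t ZY[of c'] e3 show ?thesis
        proof eventually_elim
          case (elim N)
          interpret prob_space "P N" by fact
          note [measurable] = conjunct1[OF elim(2)] conjunct2[OF elim(2)]
          have "p N \<le> prob ({w\<in>space (P N). \<bar>x0\<bar> \<le> \<bar>Y N w\<bar>} \<union> {w\<in>space (P N). Z N w \<noteq> Y N w})"
            unfolding p_def
          proof (rule finite_measure_mono)
            show "{w \<in> space (P N). Z N w \<in> \<Gamma>} \<subseteq> {w\<in>space (P N). \<bar>x0\<bar> \<le> \<bar>Y N w\<bar>} \<union> {w\<in>space (P N). Z N w \<noteq> Y N w}"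
            proof
              fix w assume "w \<in> {w \<in> space (P N). Z N w \<in> \<Gamma>}"
              then show "w \<in> {w\<in>space (P N). \<bar>x0\<bar> \<le> \<bar>Y N w\<bar>} \<union> {w\<in>space (P N). Z N w \<noteq> Y N w}"
                using x0(2)[of "Z N w"] closure_subset[of \<Gamma>] by (cases "Z N w = Y N w") (auto simp: dist_norm)
            qed
          qed measurable
          also have "... \<le> prob {w\<in>space (P N). \<bar>x0\<bar> \<le> \<bar>Y N w\<bar>} + prob {w\<in>space (P N). Z N w \<noteq> Y N w}"
            by (rule measure_Un_le) measurable
          also have "... \<le> 2 * exp (s N * c') + exp (s N * c')"
          proof (rule add_mono)
            have "ennreal (prob {w\<in>space (P N). \<bar>x0\<bar> \<le> \<bar>Y N w\<bar>}) \<le> ennreal (2 * exp (s N * (u - \<bar>l\<bar> * \<bar>x0\<bar>)))"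
              using elim(4) unfolding emeasure_eq_measure by blast
            then have "prob {w\<in>space (P N). \<bar>x0\<bar> \<le> \<bar>Y N w\<bar>} \<le> 2 * exp (s N * (u - \<bar>l\<bar> * \<bar>x0\<bar>))"
              by (subst (asm) ennreal_le_iff) auto
            also have "... \<le> 2 * exp (s N * c')" using u lx elim(3) by (simp add: mult_left_mono)
            finally show "prob {w\<in>space (P N). \<bar>x0\<bar> \<le> \<bar>Y N w\<bar>} \<le> 2 * exp (s N * c')" .
          qed (rule elim(5))
          also have "... \<le> exp (s N * c)" using elim(6) by simp
          finally show ?case .
        qed
      qed
      with s0 have "\<forall>\<^sub>F N in sequentially. q N \<le> ereal c"
        by eventually_elim (auto simp: q_def p_def intro!: elog_div_le)
      then show ?thesis by (rule Limsup_bounded)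
    qed
    \<comment> \<open>The slope \<open>l\<close> attains the supremum in \<open>I x\<close> exactly
      when x = l * v, so the exponent obtained by tilting is the optimal one.\<close>
    have lower: "ereal (- (l * x - l\<^sup>2 * v / 2)) \<le> liminf q" if x: "x \<in> interior \<Gamma>" "x = l * v" for x l
    proof (rule ereal_le_epsilon2)
      fix \<eta> :: real assume \<eta>: "\<eta> > 0"
      obtain \<delta>0 where \<delta>0: "\<delta>0 > 0" "ball x \<delta>0 \<subseteq> \<Gamma>" using x(1) by (auto simp: mem_interior)
      define \<delta> where "\<delta> = min \<delta>0 (\<eta> / (4 * (\<bar>l\<bar> + 1)))"
      have \<delta>: "\<delta> > 0" using \<delta>0(1) \<eta> by (simp add: \<delta>_def)
      have "\<bar>l\<bar> * \<delta> \<le> (\<bar>l\<bar> + 1) * (\<eta> / (4 * (\<bar>l\<bar> + 1)))" unfolding \<delta>_def using \<eta> \<delta>0(1) by (intro mult_mono) auto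
      also have "... = \<eta> / 4" by (simp add: field_simps)
      finally have l\<delta>: "\<bar>l\<bar> * \<delta> \<le> \<eta> / 4" .
      \<comment> \<open>The gap \<eta>/2 between \<open>c\<close> and \<open>c'\<close> leaves a
        full exp(s N * c) after subtracting the probability that \<open>Z\<close> and
        \<open>Y\<close> differ.\<close>
      define c where "c = - l\<^sup>2 * v / 2 - \<eta>"
      define c' where "c' = - l\<^sup>2 * v / 2 - \<eta> / 2"
      have low: "\<forall>\<^sub>F N in sequentially. exp (s N * (- l\<^sup>2 * v / 2 - \<bar>l\<bar> * \<delta> - \<eta> / 4)) \<le> measure (P N) {w\<in>space (P N). \<bar>Y N w - l * v\<bar> < \<delta>}"
        by (rule exp_rate_ball_lower[OF s P Y Ym v \<delta>]) (use \<eta> in simp)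
      have e3: "\<forall>\<^sub>F N in sequentially. 2 * exp (s N * c) \<le> exp (s N * c')"
        by (rule eventually_const_exp_le[OF s]) (use \<eta> in \<open>simp add: c_def c'_def\<close>)
      from P meas s0 low e3 ZY[of c] have "\<forall>\<^sub>F N in sequentially. ereal c \<le> q N"
      proof eventually_elim
        case (elim N)
        interpret prob_space "P N" by fact
        note [measurable] = conjunct1[OF elim(2)] conjunct2[OF elim(2)]
        have "exp (s N * c') \<le> exp (s N * (- l\<^sup>2 * v / 2 - \<bar>l\<bar> * \<delta> - \<eta> / 4))"
          using l\<delta> elim(3) by (simp add: c'_def)
        also have "... \<le> prob {w\<in>space (P N). \<bar>Y N w - l * v\<bar> < \<delta>}" by fact
        also have "... \<le> prob ({w \<in> space (P N). Z N w \<in> \<Gamma>} \<union> {w\<in>space (P N). Z N w \<noteq> Y N w})"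
        proof (rule finite_measure_mono)
          show "{w\<in>space (P N). \<bar>Y N w - l * v\<bar> < \<delta>} \<subseteq> {w \<in> space (P N). Z N w \<in> \<Gamma>} \<union> {w\<in>space (P N). Z N w \<noteq> Y N w}"
          proof
            fix w assume w: "w \<in> {w\<in>space (P N). \<bar>Y N w - l * v\<bar> < \<delta>}"
            then have "Y N w \<in> ball x \<delta>0" unfolding \<delta>_def x(2) by (auto simp: dist_norm abs_minus_commute)
            then show "w \<in> {w \<in> space (P N). Z N w \<in> \<Gamma>} \<union> {w\<in>space (P N). Z N w \<noteq> Y N w}"
              using \<delta>0 w by (cases "Z N w = Y N w") auto
          qed
        qed measurable
        also have "... \<le> p N + prob {w\<in>space (P N). Z N w \<noteq> Y N w}"
          unfolding p_def by (rule measure_Un_le) measurable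
        finally have "exp (s N * c) \<le> p N" using elim(5,6) by linarith
        then show ?case unfolding q_def using elim(3) by (rule elog_div_ge)
      qed
      then have "ereal c \<le> liminf q" by (rule Liminf_bounded)
      moreover have "- (l * x - l\<^sup>2 * v / 2) = c + \<eta>" by (simp add: x(2) c_def power2_eq_square)
      ultimately show "ereal (- (l * x - l\<^sup>2 * v / 2)) \<le> liminf q + ereal \<eta>"
        by (metis add_right_mono plus_ereal.simps(1))
    qed
    have "- (INF x\<in>interior \<Gamma>. I x) \<le> liminf q"
    proof -
      have "- liminf q \<le> I x" if x: "x \<in> interior \<Gamma>" for x
      proof (cases "\<exists>l. x = l * v")
        case True
        then obtain l where l: "x = l * v" by blast
        have "- liminf q \<le> ereal (l * x - l\<^sup>2 * v / 2)"
          using lower[OF x l] by (metis ereal_minus_le_minus ereal_uminus_uminus uminus_ereal.simps(1))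
        also have "... \<le> I x" unfolding I_def by (rule SUP_upper) simp
        finally show ?thesis .
      next
        \<comment> \<open>Only a vanishing variance leaves points that no tilt reaches; at these the
          rate is infinite and the bound is trivial.\<close>
        case False
        then have v0: "v = 0" and x0: "x \<noteq> 0"
          by (metis nonzero_eq_divide_eq, metis mult_zero_left)
        have "I x = \<infinity>"
        proof (rule ereal_top)
          fix B :: real
          have "ereal B = ereal ((B / x) * x - (B / x)\<^sup>2 * v / 2)" using v0 x0 by simp
          also have "... \<le> I x" unfolding I_def by (rule SUP_upper) simp
          finally show "ereal B \<le> I x" .
        qed
        then show ?thesis by simp
      qed
      then have "- liminf q \<le> (INF x\<in>interior \<Gamma>. I x)" by (rule INF_greatest)
      then show ?thesis by (simp add: ereal_uminus_le_reorder)
    qed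
    moreover have "limsup q \<le> - (INF x\<in>closure \<Gamma>. I x)"
    proof (rule dense_ge)
      fix y assume "- (INF x\<in>closure \<Gamma>. I x) < y"
      then obtain c where "- (INF x\<in>closure \<Gamma>. I x) < ereal c" "ereal c < y" using ereal_dense2 by blast
      then show "limsup q \<le> y" using upper[of c] by auto
    qed
    moreover have "liminf q \<le> limsup q" by (rule Liminf_le_Limsup) simp
    ultimately show "let q = \<lambda>N. elog (measure (P N) {w \<in> space (P N). Z N w \<in> \<Gamma>}) / ereal ((b N)\<^sup>2)
        in - (INF x\<in>interior \<Gamma>. I x) \<le> liminf q \<and> liminf q \<le> limsup q \<and> limsup q \<le> - (INF x\<in>closure \<Gamma>. I x)"
      by (simp add: Let_def q_def p_def s_def)
  qed
qed

text \<open>A level set is an intersection of closed sets indexed by the slope, and the slopes 1 and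
  -1 alone already bound it. No closed formula is used, so a degenerate variance is no special
  case.\<close>

lemma good_rate_function_quadratic:
  fixes v :: real
  shows "good_rate_function (\<lambda>x. SUP l. ereal (l * x - l\<^sup>2 * v / 2))"
  unfolding good_rate_function_def
proof (intro conjI allI)
  fix x :: real
  have "ereal 0 = ereal (0 * x - 0\<^sup>2 * v / 2)" by simp
  also have "... \<le> (SUP l. ereal (l * x - l\<^sup>2 * v / 2))" by (rule SUP_upper) simp
  finally show "0 \<le> (SUP l. ereal (l * x - l\<^sup>2 * v / 2))" by (simp add: zero_ereal_def)
next
  fix c :: real
  have eq: "{x. (SUP l. ereal (l * x - l\<^sup>2 * v / 2)) \<le> ereal c} = (\<Inter>l. {x. l * x - l\<^sup>2 * v / 2 \<le> c})"
    by (auto simp: SUP_le_iff)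
  show "compact {x. (SUP l. ereal (l * x - l\<^sup>2 * v / 2)) \<le> ereal c}"
    unfolding eq
  proof (rule compact_Int_closed[of "{- (c + v/2)..c + v/2}" "(\<Inter>l. {x. l * x - l\<^sup>2 * v / 2 \<le> c})", THEN back_subst[of compact]])
    show "closed (\<Inter>l. {x. l * x - l\<^sup>2 * v / 2 \<le> c})"
      by (intro closed_INT ballI closed_Collect_le continuous_intros)
    have "x \<le> c + v/2 \<and> - (c + v/2) \<le> x" if "\<forall>l. l * x - l\<^sup>2 * v / 2 \<le> c" for x
      using that[rule_format, of 1] that[rule_format, of "-1"] by auto
    then show "{- (c + v/2)..c + v/2} \<inter> (\<Inter>l. {x. l * x - l\<^sup>2 * v / 2 \<le> c}) = (\<Inter>l. {x. l * x - l\<^sup>2 * v / 2 \<le> c})"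
      by auto
  qed auto
qed

section \<open>The filter and its particle approximation\<close>

locale hmm_filter =
  fixes mu :: "'a::euclidean_space measure"
    and a0 :: "'a \<Rightarrow> real" and a :: "nat \<Rightarrow> 'a \<Rightarrow> 'a \<Rightarrow> real" and bt :: "nat \<Rightarrow> 'a \<Rightarrow> real"
    and Ca :: real and hp hm :: "nat \<Rightarrow> 'a \<Rightarrow> real"
  assumes sets_mu[measurable_cong]: "sets mu = sets borel" and sigma_finite_mu: "sigma_finite_measure mu"
    and a0_measurable[measurable]: "a0 \<in> borel_measurable borel"
    and a0_nonneg: "\<And>x. 0 \<le> a0 x" and a0_integral: "(\<integral>\<^sup>+x. ennreal (a0 x) \<partial>mu) = 1"
    and a_borel: "\<And>t. case_prod (a (Suc t)) \<in> borel_measurable borel"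
    and a_nonneg: "\<And>t x x'. 0 \<le> a (Suc t) x x'"
    and bt_measurable[measurable]: "\<And>t. bt (Suc t) \<in> borel_measurable borel"
    and bt_nonneg: "\<And>t x. 0 \<le> bt (Suc t) x"
    and Ca_pos: "Ca > 0"
    and h_measurable[measurable]: "\<And>t. hp (Suc t) \<in> borel_measurable borel" "\<And>t. hm (Suc t) \<in> borel_measurable borel"
    and h_nonneg: "\<And>t x. 0 \<le> hp (Suc t) x" "\<And>t x. 0 \<le> hm (Suc t) x"
    and a_lower: "\<And>t x x'. hm (Suc t) x' / Ca \<le> a (Suc t) x x'"
    and a_upper: "\<And>t x x'. a (Suc t) x x' \<le> Ca * hp (Suc t) x'"
    and hm_integral_pos: "\<And>t. 0 < (\<integral>\<^sup>+x. ennreal (hm (Suc t) x * bt (Suc t) x) \<partial>mu)"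
    and hp_integral_finite: "\<And>t. (\<integral>\<^sup>+x. ennreal (hp (Suc t) x * bt (Suc t) x) \<partial>mu) < \<infinity>"
begin

sublocale sigma_finite_measure mu by (rule sigma_finite_mu)

lemma space_mu[simp]: "space mu = UNIV"
  using sets_eq_imp_space_eq[OF sets_mu] by simp

lemma a_measurable [measurable]:
  assumes [measurable]: "f \<in> M \<rightarrow>\<^sub>M borel" "g \<in> M \<rightarrow>\<^sub>M borel"
  shows "(\<lambda>x. a (Suc t) (f x) (g x)) \<in> borel_measurable M"
proof -
  have "(\<lambda>x. (f x, g x)) \<in> M \<rightarrow>\<^sub>M borel"
    by (rule borel_measurable_Pair) measurable
  from measurable_compose[OF this a_borel[of t]] show ?thesis by simp
qed

abbreviation hb :: "nat \<Rightarrow> 'a \<Rightarrow> real" where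
  "hb t x \<equiv> hp (Suc t) x * bt (Suc t) x"

text \<open>The dominating measure of generation \<open>Suc t\<close> (note the shift). The classes
  of test functions in the theorem are exponential moment conditions under it.\<close>

definition rho :: "nat \<Rightarrow> 'a measure" where
  "rho t = density mu (\<lambda>x. ennreal (hb t x))"

abbreviation L :: "nat \<Rightarrow> ('a \<Rightarrow> real) \<Rightarrow> 'a \<Rightarrow> real" where
  "L t \<equiv> Lop mu a bt (Suc t)"

abbreviation m :: "nat \<Rightarrow> ('a \<Rightarrow> real) \<Rightarrow> real" where
  "m \<equiv> mfilt mu a0 a bt"

abbreviation F :: "nat \<Rightarrow> 'a \<Rightarrow> real" where
  "F \<equiv> filt mu a0 a bt"

text \<open>The lower half of A-1 bounds \<open>L t 1\<close> below by this positive number, hence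
  every normalising constant, random or not, is bounded away from 0.\<close>

definition low :: "nat \<Rightarrow> real" where
  "low t = (\<integral>x. hm (Suc t) x * bt (Suc t) x \<partial>mu) / Ca"

lemma sets_rho [measurable_cong]: "sets (rho t) = sets borel"
  by (simp add: rho_def sets_mu)

lemma nn_integral_rho:
  assumes [measurable]: "g \<in> borel_measurable borel"
  shows "(\<integral>\<^sup>+x. g x \<partial>rho t) = (\<integral>\<^sup>+x. ennreal (hb t x) * g x \<partial>mu)"
  unfolding rho_def by (rule nn_integral_density) measurable

lemma finite_rho: "finite_measure (rho t)"
proof
  have "emeasure (rho t) (space (rho t)) = (\<integral>\<^sup>+x. 1 \<partial>rho t)" by simp
  also have "... = (\<integral>\<^sup>+x. ennreal (hb t x) \<partial>mu)" by (subst nn_integral_rho) simp_all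
  finally show "emeasure (rho t) (space (rho t)) \<noteq> \<infinity>" using hp_integral_finite[of t] by simp
qed

lemma integrable_rho_iff:
  assumes [measurable]: "g \<in> borel_measurable borel"
  shows "integrable (rho t) g \<longleftrightarrow> integrable mu (\<lambda>x. hb t x * g x)"
  unfolding rho_def by (subst integrable_density) (auto simp: h_nonneg bt_nonneg)

lemma integral_rho:
  assumes [measurable]: "g \<in> borel_measurable borel"
  shows "(\<integral>x. g x \<partial>rho t) = (\<integral>x. hb t x * g x \<partial>mu)"
  unfolding rho_def by (subst integral_density) (auto simp: h_nonneg bt_nonneg)

lemma integrable_rho_const [simp]: "integrable (rho t) (\<lambda>_. c :: real)"
proof -
  interpret finite_measure "rho t" by (rule finite_rho)
  show ?thesis by simp
qed

lemma integrable_Lop: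
  assumes g: "integrable (rho t) g"
  shows "integrable mu (\<lambda>u. a (Suc t) x u * bt (Suc t) u * g u)"
    "(\<integral>u. \<bar>a (Suc t) x u * bt (Suc t) u * g u\<bar> \<partial>mu) \<le> Ca * (\<integral>u. \<bar>g u\<bar> \<partial>rho t)"
proof -
  have [measurable]: "g \<in> borel_measurable borel"
    using borel_measurable_integrable[OF g] by (simp add: measurable_cong_sets[OF sets_rho refl])
  have i: "integrable mu (\<lambda>u. Ca * (hp (Suc t) u * bt (Suc t) u * \<bar>g u\<bar>))"
    using integrable_abs[OF g] by (simp add: integrable_rho_iff)
  have b: "\<bar>a (Suc t) x u * bt (Suc t) u * g u\<bar> \<le> Ca * (hp (Suc t) u * bt (Suc t) u * \<bar>g u\<bar>)" for u
  proof -
    have "\<bar>a (Suc t) x u * bt (Suc t) u * g u\<bar> = a (Suc t) x u * (bt (Suc t) u * \<bar>g u\<bar>)"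
      by (simp add: abs_mult a_nonneg bt_nonneg)
    also have "... \<le> (Ca * hp (Suc t) u) * (bt (Suc t) u * \<bar>g u\<bar>)"
      by (intro mult_right_mono a_upper) (simp add: bt_nonneg)
    finally show ?thesis by (simp add: mult_ac)
  qed
  show 1: "integrable mu (\<lambda>u. a (Suc t) x u * bt (Suc t) u * g u)"
  proof (rule Bochner_Integration.integrable_bound[OF i])
    show "AE u in mu. norm (a (Suc t) x u * bt (Suc t) u * g u) \<le> norm (Ca * (hp (Suc t) u * bt (Suc t) u * \<bar>g u\<bar>))"
      using order.trans[OF b abs_ge_self] by (intro AE_I2) (simp only: real_norm_def)
  qed measurable
  have "(\<integral>u. \<bar>a (Suc t) x u * bt (Suc t) u * g u\<bar> \<partial>mu) \<le> (\<integral>u. Ca * (hp (Suc t) u * bt (Suc t) u * \<bar>g u\<bar>) \<partial>mu)"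
    using b 1 i by (intro integral_mono) auto
  then show "(\<integral>u. \<bar>a (Suc t) x u * bt (Suc t) u * g u\<bar> \<partial>mu) \<le> Ca * (\<integral>u. \<bar>g u\<bar> \<partial>rho t)"
    by (simp add: integral_rho)
qed

lemma integrable_rho_measurable: "integrable (rho t) g \<Longrightarrow> g \<in> borel_measurable borel"
  using borel_measurable_integrable[of "rho t" g] by (simp add: measurable_cong_sets[OF sets_rho refl])

text \<open>The smoothing effect of the upper half of A-1: mere integrability of \<open>g\<close>
  under \<open>rho t\<close> gives a bounded function one generation earlier.\<close>

lemma Lop_abs_le: "integrable (rho t) g \<Longrightarrow> \<bar>L t g x\<bar> \<le> Ca * (\<integral>u. \<bar>g u\<bar> \<partial>rho t)"
  unfolding Lop_def by (rule order.trans[OF integral_abs_bound]) (rule integrable_Lop)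

lemma Lop_measurable [measurable (raw)]:
  assumes [measurable]: "g \<in> borel_measurable borel"
  shows "L t g \<in> borel_measurable borel"
  unfolding Lop_def by measurable

lemma integrable_hm: "integrable mu (\<lambda>x. hm (Suc t) x * bt (Suc t) x)"
proof -
  have "integrable mu (\<lambda>x. Ca\<^sup>2 * (hb t x * 1))"
    using integrable_rho_const[of t 1] by (subst (asm) integrable_rho_iff) auto
  then show ?thesis
  proof (rule Bochner_Integration.integrable_bound)
    show "AE x in mu. norm (hm (Suc t) x * bt (Suc t) x) \<le> norm (Ca\<^sup>2 * (hb t x * 1))"
    proof (rule AE_I2)
      fix x
      have "hm (Suc t) x / Ca \<le> Ca * hp (Suc t) x" using a_lower a_upper by (rule order.trans)
      then have "hm (Suc t) x \<le> Ca\<^sup>2 * hp (Suc t) x" using Ca_pos by (simp add: field_simps power2_eq_square)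
      from mult_right_mono[OF this bt_nonneg[of t x]]
      show "norm (hm (Suc t) x * bt (Suc t) x) \<le> norm (Ca\<^sup>2 * (hb t x * 1))"
        by (simp add: abs_mult h_nonneg bt_nonneg mult_ac)
    qed
  qed measurable
qed

lemma low_pos: "low t > 0"
proof -
  have "ennreal (\<integral>x. hm (Suc t) x * bt (Suc t) x \<partial>mu) = (\<integral>\<^sup>+x. ennreal (hm (Suc t) x * bt (Suc t) x) \<partial>mu)"
    by (rule nn_integral_eq_integral[symmetric, OF integrable_hm]) (simp add: h_nonneg bt_nonneg)
  with hm_integral_pos[of t] have "0 < ennreal (\<integral>x. hm (Suc t) x * bt (Suc t) x \<partial>mu)" by (simp only:)
  then have "0 < (\<integral>x. hm (Suc t) x * bt (Suc t) x \<partial>mu)" by (simp only: ennreal_less_zero_iff)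
  then show ?thesis using Ca_pos by (simp add: low_def)
qed

lemma low_le_Lop_one: "low t \<le> L t (\<lambda>_. 1) x"
proof -
  have "low t = (\<integral>u. hm (Suc t) u * bt (Suc t) u / Ca \<partial>mu)" by (simp add: low_def)
  also have "... \<le> L t (\<lambda>_. 1) x"
    unfolding Lop_def
  proof (intro integral_mono)
    show "hm (Suc t) u * bt (Suc t) u / Ca \<le> a (Suc t) x u * bt (Suc t) u * 1" for u
      using mult_right_mono[OF a_lower[of t u x] bt_nonneg[of t u]] by simp
  qed (use integrable_hm integrable_Lop[of t "\<lambda>_. 1"] in auto)
  finally show ?thesis .
qed

lemma kappa_Suc: "kappa mu a0 a bt (Suc t) = m t (L t (\<lambda>_. 1))"
  by (simp add: kappa_def mfilt_def)

definition unnorm :: "nat \<Rightarrow> 'a \<Rightarrow> real" where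
  "unnorm t x = bt (Suc t) x * (\<integral>u. F t u * a (Suc t) u x \<partial>mu)"

lemma filt_Suc: "F (Suc t) = (\<lambda>x. unnorm t x / (\<integral>z. unnorm t z \<partial>mu))"
  by (simp add: unnorm_def)

declare filt.simps(2) [simp del]

text \<open>Duality between the filter recursion and \<open>L t\<close>. The facts about
  \<open>F t\<close> are explicit hypotheses because the lemma is applied inside the induction that
  establishes them.\<close>

lemma Fubini_unnorm:
  assumes F [measurable]: "F t \<in> borel_measurable borel" and Fi: "integrable mu (F t)"
    and g: "integrable (rho t) g"
  shows "integrable mu (\<lambda>x. g x * unnorm t x)" "(\<integral>x. g x * unnorm t x \<partial>mu) = m t (L t g)"
proof -
  interpret pair_sigma_finite mu mu by unfold_locales
  note [measurable] = integrable_rho_measurable[OF g]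
  define f where "f = (\<lambda>u x. F t u * (a (Suc t) u x * bt (Suc t) x * g x))"
  have [measurable]: "case_prod f \<in> borel_measurable (mu \<Otimes>\<^sub>M mu)" unfolding f_def by measurable
  have int: "integrable (mu \<Otimes>\<^sub>M mu) (case_prod f)"
  proof (rule Fubini_integrable)
    have "integrable mu (\<lambda>u. (Ca * (\<integral>u. \<bar>g u\<bar> \<partial>rho t)) * F t u)" using Fi by simp
    then show "integrable mu (\<lambda>u. \<integral>x. norm (case_prod f (u, x)) \<partial>mu)"
    proof (rule Bochner_Integration.integrable_bound)
      show "AE u in mu. norm (\<integral>x. norm (case_prod f (u, x)) \<partial>mu) \<le> norm (Ca * (\<integral>u. \<bar>g u\<bar> \<partial>rho t) * F t u)"
      proof (rule AE_I2)
        fix u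
        have "(\<integral>x. norm (case_prod f (u, x)) \<partial>mu) = \<bar>F t u\<bar> * (\<integral>x. \<bar>a (Suc t) u x * bt (Suc t) x * g x\<bar> \<partial>mu)"
          by (simp add: f_def abs_mult[of "F t u"])
        also have "... \<le> \<bar>F t u\<bar> * (Ca * (\<integral>u. \<bar>g u\<bar> \<partial>rho t))" by (intro mult_left_mono integrable_Lop(2)[OF g]) simp
        finally have *: "(\<integral>x. norm (case_prod f (u, x)) \<partial>mu) \<le> \<bar>F t u\<bar> * (Ca * (\<integral>u. \<bar>g u\<bar> \<partial>rho t))" .
        have "0 \<le> (\<integral>x. norm (case_prod f (u, x)) \<partial>mu)" by simp
        with * show "norm (\<integral>x. norm (case_prod f (u, x)) \<partial>mu) \<le> norm (Ca * (\<integral>u. \<bar>g u\<bar> \<partial>rho t) * F t u)"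
          using Ca_pos by (simp add: abs_mult mult_ac)
      qed
    qed (unfold f_def, measurable)
    show "AE u in mu. integrable mu (\<lambda>x. case_prod f (u, x))"
      using integrable_Lop(1)[OF g] by (simp add: f_def)
  qed measurable
  have eq: "(\<integral>u. f u x \<partial>mu) = g x * unnorm t x" for x
  proof -
    have "(\<integral>u. f u x \<partial>mu) = (\<integral>u. (F t u * a (Suc t) u x) * (bt (Suc t) x * g x) \<partial>mu)"
      by (simp add: f_def mult_ac)
    also have "... = (\<integral>u. F t u * a (Suc t) u x \<partial>mu) * (bt (Suc t) x * g x)"
      by (rule integral_mult_left_zero)
    finally show ?thesis by (simp add: unnorm_def mult_ac)
  qed
  show "integrable mu (\<lambda>x. g x * unnorm t x)" using integrable_snd[OF int] unfolding eq .
  have "(\<integral>x. g x * unnorm t x \<partial>mu) = (\<integral>x. (\<integral>u. f u x \<partial>mu) \<partial>mu)" unfolding eq ..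
  also have "... = (\<integral>u. (\<integral>x. f u x \<partial>mu) \<partial>mu)" by (rule Fubini_integral[OF int])
  also have "... = m t (L t g)"
    unfolding mfilt_def
  proof (intro Bochner_Integration.integral_cong refl)
    fix u
    have "(\<integral>x. f u x \<partial>mu) = F t u * L t g u" unfolding f_def Lop_def by (rule integral_mult_right_zero)
    then show "(\<integral>x. f u x \<partial>mu) = L t g u * F t u" by (simp add: mult.commute)
  qed
  finally show "(\<integral>x. g x * unnorm t x \<partial>mu) = m t (L t g)" .
qed

lemma integrable_bounded_times:
  assumes "integrable mu f" and [measurable]: "g \<in> borel_measurable borel" and "\<And>x. \<bar>g x\<bar> \<le> B"
  shows "integrable mu (\<lambda>x. g x * f x :: real)"
proof (rule Bochner_Integration.integrable_bound[of mu "\<lambda>x. B * f x"])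
  have [measurable]: "f \<in> borel_measurable borel"
    using borel_measurable_integrable[OF assms(1)] by (simp add: measurable_cong_sets[OF sets_mu refl])
  show "(\<lambda>x. g x * f x) \<in> borel_measurable mu" by measurable
  have "0 \<le> B" using assms(3)[of undefined] by linarith
  then show "AE x in mu. norm (g x * f x) \<le> norm (B * f x)"
    using assms(3) by (intro AE_I2) (simp add: abs_mult mult_right_mono)
qed (use assms in simp)

text \<open>The four properties have to be proved together: that the next normalising constant is
  positive follows from \<open>low t\<close> being integrated against a density of total mass
  1.\<close>

lemma filt_density:
  "F t \<in> borel_measurable borel \<and> (\<forall>x. 0 \<le> F t x) \<and> integrable mu (F t) \<and> (\<integral>x. F t x \<partial>mu) = 1"
proof (induction t)
  case 0
  have "integrable mu a0" by (rule integrableI_nonneg) (auto simp: a0_nonneg a0_integral)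
  moreover have "(\<integral>x. a0 x \<partial>mu) = 1" by (subst integral_eq_nn_integral) (auto simp: a0_nonneg a0_integral)
  ultimately show ?case by (simp add: a0_nonneg)
next
  case (Suc t)
  then have [measurable]: "F t \<in> borel_measurable borel" and Fn: "\<And>x. 0 \<le> F t x" and Fi: "integrable mu (F t)" and F1: "(\<integral>x. F t x \<partial>mu) = 1"
    by auto
  have [measurable]: "unnorm t \<in> borel_measurable borel" unfolding unnorm_def by measurable
  have un: "0 \<le> unnorm t x" for x unfolding unnorm_def by (simp add: bt_nonneg Fn a_nonneg)
  have i: "integrable mu (unnorm t)" using Fubini_unnorm(1)[of t "\<lambda>_. 1", OF _ Fi] by simp
  have I: "(\<integral>x. unnorm t x \<partial>mu) = m t (L t (\<lambda>_. 1))" using Fubini_unnorm(2)[of t "\<lambda>_. 1", OF _ Fi] by simp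
  have "low t = (\<integral>x. low t * F t x \<partial>mu)" by (simp add: F1)
  also have "... \<le> m t (L t (\<lambda>_. 1))" unfolding mfilt_def
    using Fi Fn low_le_Lop_one by (intro integral_mono integrable_bounded_times[OF Fi _ Lop_abs_le] mult_right_mono) auto
  finally have pos: "0 < (\<integral>x. unnorm t x \<partial>mu)" unfolding I using low_pos[of t] by linarith
  show ?case
    unfolding filt_Suc using pos un i by auto
qed

lemma filt_measurable [measurable]: "F t \<in> borel_measurable borel"
  and filt_nonneg: "0 \<le> F t x" and integrable_filt: "integrable mu (F t)" and integral_filt: "(\<integral>x. F t x \<partial>mu) = 1"
  using filt_density[of t] by auto

lemma kappa_pos: "0 < m t (L t (\<lambda>_. 1))"
proof -
  have "low t = (\<integral>x. low t * F t x \<partial>mu)" by (simp add: integral_filt)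
  also have "... \<le> m t (L t (\<lambda>_. 1))" unfolding mfilt_def
    using low_le_Lop_one filt_nonneg by (intro integral_mono integrable_bounded_times[OF integrable_filt _ Lop_abs_le] mult_right_mono) (auto simp: integrable_filt)
  finally show ?thesis using low_pos[of t] by linarith
qed

lemma filt_Suc': "F (Suc t) x = unnorm t x / m t (L t (\<lambda>_. 1))"
  using Fubini_unnorm(2)[of t "\<lambda>_. 1"] integrable_filt by (simp add: filt_Suc)

lemma mfilt_Suc:
  assumes "integrable (rho t) g"
  shows "integrable mu (\<lambda>x. g x * F (Suc t) x)" "m (Suc t) g = m t (L t g) / m t (L t (\<lambda>_. 1))"
proof -
  note f = Fubini_unnorm[OF filt_measurable integrable_filt assms]
  show "integrable mu (\<lambda>x. g x * F (Suc t) x)" using f(1) by (simp add: filt_Suc')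
  show "m (Suc t) g = m t (L t g) / m t (L t (\<lambda>_. 1))"
    using f(2) unfolding mfilt_def[of _ _ _ _ "Suc t"] by (simp add: filt_Suc')
qed

lemma sigma2_eq:
  assumes [measurable]: "g \<in> borel_measurable borel" and i: "integrable mu (\<lambda>x. g x * F t x)" "integrable mu (\<lambda>x. (g x)\<^sup>2 * F t x)"
  shows "sigma2 mu a0 a bt t g = ennreal (m t (\<lambda>x. (g x)\<^sup>2) - (m t g)\<^sup>2)" "0 \<le> m t (\<lambda>x. (g x)\<^sup>2) - (m t g)\<^sup>2"
proof -
  have eq: "(g x - m t g)\<^sup>2 * F t x = (g x)\<^sup>2 * F t x - 2 * m t g * (g x * F t x) + (m t g)\<^sup>2 * F t x" for x
    by (simp add: power2_eq_square algebra_simps)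
  have int: "integrable mu (\<lambda>x. (g x - m t g)\<^sup>2 * F t x)"
    unfolding eq using i integrable_filt by simp
  have I: "(\<integral>x. (g x - m t g)\<^sup>2 * F t x \<partial>mu) = m t (\<lambda>x. (g x)\<^sup>2) - (m t g)\<^sup>2"
    unfolding eq using i integrable_filt by (simp add: integral_filt mfilt_def power2_eq_square)
  show "0 \<le> m t (\<lambda>x. (g x)\<^sup>2) - (m t g)\<^sup>2"
    unfolding I[symmetric] by (simp add: filt_nonneg)
  show "sigma2 mu a0 a bt t g = ennreal (m t (\<lambda>x. (g x)\<^sup>2) - (m t g)\<^sup>2)"
    unfolding sigma2_def I[symmetric] by (rule nn_integral_eq_integral[OF int]) (simp add: filt_nonneg)
qed

end

section \<open>Kernels of i.i.d. samples and empirical means\<close>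

lemma PiM_kernel_measurable:
  assumes "finite I" and prob: "\<And>w. w \<in> space M \<Longrightarrow> prob_space (k w)" and sets: "\<And>w. w \<in> space M \<Longrightarrow> sets (k w) = sets N"
    and em: "\<And>A. A \<in> sets N \<Longrightarrow> (\<lambda>w. emeasure (k w) A) \<in> borel_measurable M"
  shows "(\<lambda>w. PiM I (\<lambda>_. k w)) \<in> M \<rightarrow>\<^sub>M prob_algebra (PiM I (\<lambda>_. N))"
proof (rule measurable_prob_algebra_generated)
  \<comment> \<open>Measurability is checked on finite rectangles, an intersection-stable generator
    on which the product measure is a finite product of measurable functions of
    \<open>w\<close>.\<close>
  show "sets (PiM I (\<lambda>_. N)) = sigma_sets (\<Pi>\<^sub>E i\<in>I. space N) {Pi\<^sub>E I E | E. \<forall>i\<in>I. E i \<in> sets N}"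
    using prod_algebra_eq_finite[OF \<open>finite I\<close>, of "\<lambda>_. N"] unfolding sets_PiM
    by (intro arg_cong[where f = "sigma_sets _"]) auto
  show "Int_stable {Pi\<^sub>E I E | E. \<forall>i\<in>I. E i \<in> sets N}" by (rule Int_stable_PiE)
  show "{Pi\<^sub>E I E | E. \<forall>i\<in>I. E i \<in> sets N} \<subseteq> Pow (\<Pi>\<^sub>E i\<in>I. space N)"
    using sets.sets_into_space by (auto simp: PiE_def Pi_def) blast
  show "prob_space (PiM I (\<lambda>_. k w))" if "w \<in> space M" for w
    by (intro prob_space_PiM prob that)
  show "sets (PiM I (\<lambda>_. k w)) = sets (PiM I (\<lambda>_. N))" if "w \<in> space M" for w
    by (intro sets_PiM_cong refl sets that)
  fix A assume "A \<in> {Pi\<^sub>E I E | E. \<forall>i\<in>I. E i \<in> sets N}"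
  then obtain E where A: "A = Pi\<^sub>E I E" and E: "\<And>i. i \<in> I \<Longrightarrow> E i \<in> sets N" by auto
  have eq: "emeasure (PiM I (\<lambda>_. k w)) A = (\<Prod>i\<in>I. emeasure (k w) (E i))" if w: "w \<in> space M" for w
  proof -
    interpret product_prob_space "\<lambda>_. k w" I
      using prob[OF w] by (intro product_prob_spaceI)
    show ?thesis unfolding A by (rule emeasure_PiM) (use assms(1) sets[OF w] E in auto)
  qed
  have "(\<lambda>w. \<Prod>i\<in>I. emeasure (k w) (E i)) \<in> borel_measurable M"
    by (intro borel_measurable_prod_ennreal em E)
  then show "(\<lambda>w. emeasure (PiM I (\<lambda>_. k w)) A) \<in> borel_measurable M"
    by (subst measurable_cong[OF eq])
qed

lemma nn_integral_iid_exp_sum: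
  assumes "prob_space q" and [measurable]: "g \<in> borel_measurable q"
  shows "(\<integral>\<^sup>+p. eexp (\<Sum>i<N. g (p i)) \<partial>PiM {..<N} (\<lambda>_. q)) = (\<integral>\<^sup>+x. eexp (g x) \<partial>q) ^ N"
proof -
  interpret product_prob_space "\<lambda>_. q" "{..<N}"
    using assms(1) by (intro product_prob_spaceI)
  have "(\<integral>\<^sup>+p. eexp (\<Sum>i<N. g (p i)) \<partial>PiM {..<N} (\<lambda>_. q)) = (\<integral>\<^sup>+p. (\<Prod>i<N. eexp (g (p i))) \<partial>PiM {..<N} (\<lambda>_. q))"
    by (simp add: exp_sum prod_ennreal)
  also have "... = (\<Prod>i<N. \<integral>\<^sup>+x. eexp (g x) \<partial>q)"
    by (rule product_nn_integral_prod) auto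
  finally show ?thesis by simp
qed

definition emp :: "nat \<Rightarrow> ('a \<Rightarrow> real) \<Rightarrow> (nat \<Rightarrow> 'a) \<Rightarrow> real" where
  "emp N g w = (\<Sum>i<N. g (w i)) / real N"

lemma emp_measurable [measurable]:
  assumes [measurable]: "g \<in> borel_measurable M"
  shows "emp N g \<in> borel_measurable (PiM {..<N} (\<lambda>_. M))"
  unfolding emp_def by measurable

lemma emp_ge:
  assumes "N \<ge> 1" "\<And>x. c \<le> g x"
  shows "c \<le> emp N g w"
proof -
  have "real N * c \<le> (\<Sum>i<N. g (w i))" using sum_bounded_below[of "{..<N}" c "\<lambda>i. g (w i)"] assms by simp
  then show ?thesis using assms(1) by (simp add: emp_def field_simps)
qed

lemma abs_emp_le:
  assumes "N \<ge> 1" "\<And>x. \<bar>g x\<bar> \<le> B"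
  shows "\<bar>emp N g w\<bar> \<le> B"
proof -
  have "\<bar>\<Sum>i<N. g (w i)\<bar> \<le> (\<Sum>i<N. \<bar>g (w i)\<bar>)" by (rule sum_abs)
  also have "... \<le> real N * B" using sum_bounded_above[of "{..<N}" "\<lambda>i. \<bar>g (w i)\<bar>" B] assms by simp
  finally show ?thesis using assms(1) by (simp add: emp_def field_simps)
qed

abbreviation borel_pow :: "nat \<Rightarrow> (nat \<Rightarrow> 'a::topological_space) measure" where
  "borel_pow N \<equiv> PiM {..<N} (\<lambda>_. borel)"

section \<open>Conditional law of a generation given the previous one\<close>

context hmm_filter
begin

definition unnormN :: "nat \<Rightarrow> nat \<Rightarrow> (nat \<Rightarrow> 'a) \<Rightarrow> 'a \<Rightarrow> real" where
  "unnormN N t w x = bt (Suc t) x * ((\<Sum>i<N. a (Suc t) (w i) x) / real N)"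

definition law :: "nat \<Rightarrow> nat \<Rightarrow> (nat \<Rightarrow> 'a) \<Rightarrow> 'a measure" where
  "law N t w = density mu (\<lambda>x. ennreal (fN mu a bt N (Suc t) w x))"

abbreviation pg :: "nat \<Rightarrow> nat \<Rightarrow> (nat \<Rightarrow> 'a) measure" where
  "pg N t \<equiv> particle_gen mu a0 a bt N t"

lemma unnormN_integral:
  assumes g: "integrable (rho t) g"
  shows "integrable mu (\<lambda>x. g x * unnormN N t w x)" "(\<integral>x. g x * unnormN N t w x \<partial>mu) = emp N (L t g) w"
proof -
  have eq: "g x * unnormN N t w x = (\<Sum>i<N. a (Suc t) (w i) x * bt (Suc t) x * g x) / real N" for x
    unfolding unnormN_def by (simp add: sum_distrib_left sum_divide_distrib mult_ac)
  show "integrable mu (\<lambda>x. g x * unnormN N t w x)"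
    unfolding eq using integrable_Lop(1)[OF g] by simp
  show "(\<integral>x. g x * unnormN N t w x \<partial>mu) = emp N (L t g) w"
    unfolding eq emp_def Lop_def using integrable_Lop(1)[OF g] by (simp add: Bochner_Integration.integral_sum)
qed

lemma fN_eq: "fN mu a bt N (Suc t) w x = unnormN N t w x / emp N (L t (\<lambda>_. 1)) w"
  using unnormN_integral(2)[of t "\<lambda>_. 1" N w] by (simp add: fN_def unnormN_def)

lemma unnormN_nonneg: "0 \<le> unnormN N t w x"
  unfolding unnormN_def by (intro mult_nonneg_nonneg divide_nonneg_nonneg sum_nonneg bt_nonneg a_nonneg) auto

lemma emp_Lop_one_ge: "N \<ge> 1 \<Longrightarrow> low t \<le> emp N (L t (\<lambda>_. 1)) w"
  by (intro emp_ge low_le_Lop_one)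

lemma fN_nonneg: "N \<ge> 1 \<Longrightarrow> 0 \<le> fN mu a bt N (Suc t) w x"
  unfolding fN_eq using emp_Lop_one_ge[of N t w] low_pos[of t] unnormN_nonneg[of N t w x] by simp

lemma fN_le:
  assumes "N \<ge> 1"
  shows "fN mu a bt N (Suc t) w x \<le> Ca / low t * (hb t x)"
proof -
  have "(\<Sum>i<N. a (Suc t) (w i) x) \<le> real N * (Ca * hp (Suc t) x)"
    using sum_bounded_above[of "{..<N}" "\<lambda>i. a (Suc t) (w i) x" "Ca * hp (Suc t) x"] a_upper by simp
  then have "(\<Sum>i<N. a (Suc t) (w i) x) / real N \<le> Ca * hp (Suc t) x" using assms by (simp add: field_simps)
  from mult_left_mono[OF this bt_nonneg[of t x]]
  have "unnormN N t w x \<le> Ca * (hb t x)" unfolding unnormN_def by (simp add: mult_ac)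
  then have "unnormN N t w x / emp N (L t (\<lambda>_. 1)) w \<le> Ca * (hb t x) / low t"
    using emp_Lop_one_ge[OF assms, of t w] low_pos[of t] unnormN_nonneg[of N t w x] Ca_pos
    by (intro frac_le) (auto simp: h_nonneg bt_nonneg)
  then show ?thesis by (simp add: fN_eq)
qed

lemma unnormN_measurable [measurable]:
  "(\<lambda>p. unnormN N t (fst p) (snd p)) \<in> borel_measurable (borel_pow N \<Otimes>\<^sub>M borel)"
  unfolding unnormN_def by measurable

lemma fN_measurable: "(\<lambda>(w, x). fN mu a bt N (Suc t) w x) \<in> borel_measurable (borel_pow N \<Otimes>\<^sub>M borel)"
  unfolding fN_eq split_beta by measurable

lemma fN_measurable1 [measurable]: "fN mu a bt N (Suc t) w \<in> borel_measurable borel"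
  unfolding fN_eq[abs_def] unnormN_def by measurable

lemma sets_law [measurable_cong]: "sets (law N t w) = sets borel"
  by (simp add: law_def sets_mu)

text \<open>Integrating the mixture density moves the transition onto the test function, and the
  normalising constant is the case g = 1. This is the origin of the random denominator.\<close>

lemma law_integral:
  assumes N: "N \<ge> 1" and g: "integrable (rho t) g"
  shows "(\<integral>x. g x \<partial>law N t w) = emp N (L t g) w / emp N (L t (\<lambda>_. 1)) w"
proof -
  note [measurable] = integrable_rho_measurable[OF g]
  have "(\<integral>x. g x \<partial>law N t w) = (\<integral>x. g x * unnormN N t w x / emp N (L t (\<lambda>_. 1)) w \<partial>mu)"
    unfolding law_def using fN_nonneg[OF N] by (subst integral_density) (auto simp: fN_eq mult_ac)
  also have "... = emp N (L t g) w / emp N (L t (\<lambda>_. 1)) w" using unnormN_integral(2)[OF g, of N w] by simp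
  finally show ?thesis .
qed

lemma prob_space_law:
  assumes N: "N \<ge> 1"
  shows "prob_space (law N t w)"
proof
  have i: "integrable mu (fN mu a bt N (Suc t) w)"
    using unnormN_integral(1)[of t "\<lambda>_. 1" N w] by (simp add: fN_eq[abs_def])
  have "(\<integral>x. fN mu a bt N (Suc t) w x \<partial>mu) = 1"
    using unnormN_integral(2)[of t "\<lambda>_. 1" N w] emp_Lop_one_ge[OF N, of t w] low_pos[of t] by (simp add: fN_eq)
  then have "(\<integral>\<^sup>+x. ennreal (fN mu a bt N (Suc t) w x) \<partial>mu) = 1"
    by (subst nn_integral_eq_integral[OF i]) (auto simp: fN_nonneg[OF N])
  then show "emeasure (law N t w) (space (law N t w)) = 1"
    unfolding law_def by (subst emeasure_density) auto
qed

text \<open>The constant depends neither on \<open>N\<close> nor on the previous generation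
  \<open>w\<close>, so moment bounds under \<open>rho t\<close> become uniform bounds for all
  conditional laws.\<close>

lemma nn_integral_law_le:
  assumes N: "N \<ge> 1" and [measurable]: "g \<in> borel_measurable borel"
  shows "(\<integral>\<^sup>+x. g x \<partial>law N t w) \<le> ennreal (Ca / low t) * (\<integral>\<^sup>+x. g x \<partial>rho t)"
proof -
  have "(\<integral>\<^sup>+x. g x \<partial>law N t w) = (\<integral>\<^sup>+x. ennreal (fN mu a bt N (Suc t) w x) * g x \<partial>mu)"
    unfolding law_def by (rule nn_integral_density) measurable
  also have "... \<le> (\<integral>\<^sup>+x. ennreal (Ca / low t) * (ennreal (hb t x) * g x) \<partial>mu)"
  proof (intro nn_integral_mono)
    fix x
    have "ennreal (fN mu a bt N (Suc t) w x) \<le> ennreal (Ca / low t) * ennreal (hb t x)"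
      using fN_le[OF N, of t w x] Ca_pos low_pos[of t] h_nonneg bt_nonneg
      by (subst ennreal_mult[symmetric]) (auto intro!: ennreal_leI)
    from mult_right_mono[OF this, of "g x"]
    show "ennreal (fN mu a bt N (Suc t) w x) * g x \<le> ennreal (Ca / low t) * (ennreal (hb t x) * g x)"
      by (simp add: mult.assoc)
  qed
  also have "... = ennreal (Ca / low t) * (\<integral>\<^sup>+x. g x \<partial>rho t)"
    by (subst nn_integral_rho) (auto simp: nn_integral_cmult)
  finally show ?thesis .
qed

lemma kernel_measurable:
  assumes N: "N \<ge> 1"
  shows "(\<lambda>w. PiM {..<N} (\<lambda>_. law N t w)) \<in> borel_pow N \<rightarrow>\<^sub>M prob_algebra (borel_pow N)"
proof (rule PiM_kernel_measurable)
  fix A :: "'a set" assume [measurable]: "A \<in> sets borel"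
  note [measurable] = fN_measurable[of N t]
  have "(\<lambda>w. \<integral>\<^sup>+x. ennreal (fN mu a bt N (Suc t) w x) * indicator A x \<partial>mu) \<in> borel_measurable (borel_pow N)"
    by measurable
  then show "(\<lambda>w. emeasure (law N t w) A) \<in> borel_measurable (borel_pow N)"
    unfolding law_def by (subst emeasure_density) (auto simp: sets_mu)
qed (use prob_space_law[OF N] sets_law in auto)

lemma prob_space_init: "prob_space (density mu (\<lambda>x. ennreal (a0 x)))"
  by (rule prob_spaceI) (subst emeasure_density, auto simp: a0_integral)

lemma pg_Suc: "pg N (Suc t) = pg N t \<bind> (\<lambda>w. PiM {..<N} (\<lambda>_. law N t w))"
  by (simp add: law_def)

lemma pg_prob_algebra:
  assumes N: "N \<ge> 1"
  shows "pg N t \<in> space (prob_algebra (borel_pow N))"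
proof (induction t)
  case 0
  show ?case
    by (auto simp: space_prob_algebra sets_mu intro!: prob_space_PiM prob_space_init sets_PiM_cong)
next
  case (Suc t)
  then show ?case
    unfolding pg_Suc space_prob_algebra
    using prob_space_bind'[OF Suc kernel_measurable[OF N]] sets_bind'[OF Suc kernel_measurable[OF N]] by simp
qed

lemma pg_prob: "N \<ge> 1 \<Longrightarrow> prob_space (pg N t)"
  and sets_pg: "N \<ge> 1 \<Longrightarrow> sets (pg N t) = sets (borel_pow N)"
  using pg_prob_algebra[of N t] by (auto simp: space_prob_algebra)

lemma nn_integral_pg_Suc:
  assumes N: "N \<ge> 1" and g: "g \<in> borel_measurable (borel_pow N)"
  shows "(\<integral>\<^sup>+p. g p \<partial>pg N (Suc t)) = (\<integral>\<^sup>+w. \<integral>\<^sup>+p. g p \<partial>PiM {..<N} (\<lambda>_. law N t w) \<partial>pg N t)"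
  unfolding pg_Suc
proof (rule nn_integral_bind[OF g])
  show "(\<lambda>w. PiM {..<N} (\<lambda>_. law N t w)) \<in> pg N t \<rightarrow>\<^sub>M subprob_algebra (borel_pow N)"
    using measurable_prob_algebraD[OF kernel_measurable[OF N, of t]]
    by (simp add: measurable_cong_sets[OF sets_pg[OF N] refl])
qed

end

section \<open>Induction over the generations\<close>

text \<open>\<open>x\<close>, \<open>y\<close>, \<open>z\<close> stand for the empirical means of L
  1, L g and L g^2. Plain continuity gives a single \<delta> for both the inverse denominator and
  the conditional variance.\<close>

lemma ratio_continuity:
  fixes k y0 z0 \<eta> :: real
  assumes k: "k \<noteq> 0" and \<eta>: "\<eta> > 0"
  shows "\<exists>\<delta>>0. \<forall>x y z. \<bar>x - k\<bar> < \<delta> \<longrightarrow> \<bar>y - y0\<bar> < \<delta> \<longrightarrow> \<bar>z - z0\<bar> < \<delta> \<longrightarrow>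
     \<bar>1 / x - 1 / k\<bar> < \<eta> \<and> \<bar>(z / x - (y / x)\<^sup>2) - (z0 / k - (y0 / k)\<^sup>2)\<bar> < \<eta>"
proof -
  define f where "f = (\<lambda>p :: real \<times> real \<times> real. 1 / fst p)"
  define g where "g = (\<lambda>p :: real \<times> real \<times> real. snd (snd p) / fst p - (fst (snd p) / fst p)\<^sup>2)"
  have f: "isCont f (k, y0, z0)" and g: "isCont g (k, y0, z0)"
    unfolding f_def g_def using k by (auto intro!: continuous_intros)
  obtain d1 where d1: "d1 > 0" "\<And>p. dist p (k, y0, z0) < d1 \<Longrightarrow> dist (f p) (f (k, y0, z0)) < \<eta>"
    using f \<eta> unfolding continuous_at_eps_delta by blast
  obtain d2 where d2: "d2 > 0" "\<And>p. dist p (k, y0, z0) < d2 \<Longrightarrow> dist (g p) (g (k, y0, z0)) < \<eta>"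
    using g \<eta> unfolding continuous_at_eps_delta by blast
  define \<delta> where "\<delta> = min d1 d2 / 3"
  have "\<bar>1 / x - 1 / k\<bar> < \<eta> \<and> \<bar>(z / x - (y / x)\<^sup>2) - (z0 / k - (y0 / k)\<^sup>2)\<bar> < \<eta>"
    if "\<bar>x - k\<bar> < \<delta>" "\<bar>y - y0\<bar> < \<delta>" "\<bar>z - z0\<bar> < \<delta>" for x y z
  proof -
    have "dist (x, y, z) (k, y0, z0) = norm (x - k, y - y0, z - z0)" by (simp add: dist_norm)
    also have "... \<le> norm (x - k) + norm (y - y0, z - z0)" by (rule norm_Pair_le)
    also have "... \<le> norm (x - k) + (norm (y - y0) + norm (z - z0))" by (intro add_left_mono norm_Pair_le)
    also have "... < min d1 d2" using that by (simp add: \<delta>_def)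
    finally show ?thesis using d1(2)[of "(x, y, z)"] d2(2)[of "(x, y, z)"] by (simp add: f_def g_def dist_real_def)
  qed
  moreover have "\<delta> > 0" using d1 d2 by (simp add: \<delta>_def)
  ultimately show ?thesis by blast
qed

text \<open>The summand 1 makes the constant positive, so that a tolerance can be divided by
  it.\<close>

lemma perturbation_bound:
  fixes l z p q c d :: real
  assumes p: "\<bar>p\<bar> \<le> d" and q: "\<bar>q\<bar> \<le> d" and z: "\<bar>z\<bar> \<le> c"
  shows "\<bar>l * z * p + l\<^sup>2 / 2 * q\<bar> \<le> (\<bar>l\<bar> * \<bar>c\<bar> + l\<^sup>2 / 2 + 1) * d"
proof -
  have "\<bar>l * z * p + l\<^sup>2 / 2 * q\<bar> \<le> \<bar>l\<bar> * \<bar>z\<bar> * \<bar>p\<bar> + l\<^sup>2 / 2 * \<bar>q\<bar>"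
    by (rule order.trans[OF abs_triangle_ineq]) (simp add: abs_mult)
  also have "... \<le> \<bar>l\<bar> * \<bar>c\<bar> * d + l\<^sup>2 / 2 * d"
    using assms by (intro add_mono mult_mono) auto
  also have "... \<le> (\<bar>l\<bar> * \<bar>c\<bar> + l\<^sup>2 / 2 + 1) * d"
    using p by (simp add: distrib_right)
  finally show ?thesis .
qed

section \<open>Scales and normalised sums in the moderate deviation regime\<close>

locale hmm_filter_rate = hmm_filter +
  fixes b :: "nat \<Rightarrow> real"
  assumes b_pos: "\<And>N. N \<ge> 1 \<Longrightarrow> b N > 0"
    and b_top: "filterlim b at_top sequentially"
    and sqrt_b_top: "filterlim (\<lambda>N. sqrt (real N) / b N) at_top sequentially"
begin

text \<open>For N \<ge> 1 the scales are linked by N * \<open>(e N)\<^sup>2\<close> =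
  \<open>s N\<close>, \<open>e N\<close> = 1 / \<open>r N\<close> and
  \<open>s N * r N = e N * (tau N)\<^sup>2 / (s N)\<close> = \<open>tau N\<close>. Here
  \<open>e N\<close> is the tilt received by one particle and \<open>r N\<close> the order of the
  largest value of a normalised bounded sum.\<close>

definition s :: "nat \<Rightarrow> real" where "s N = (b N)\<^sup>2"
definition e :: "nat \<Rightarrow> real" where "e N = b N / sqrt (real N)"
definition r :: "nat \<Rightarrow> real" where "r N = sqrt (real N) / b N"
definition tau :: "nat \<Rightarrow> real" where "tau N = b N * sqrt (real N)"

lemma s_top: "filterlim s at_top sequentially"
  unfolding s_def[abs_def] by (intro filterlim_pow_at_top b_top) simp

lemma r_top: "filterlim r at_top sequentially"
  using sqrt_b_top by (simp add: r_def[abs_def])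

lemma sqrt_top: "filterlim (\<lambda>N. sqrt (real N)) at_top sequentially"
  by (rule filterlim_compose[OF sqrt_at_top filterlim_real_sequentially])

lemma tau_top: "filterlim tau at_top sequentially"
  unfolding tau_def[abs_def] by (rule filterlim_at_top_mult_at_top[OF b_top sqrt_top])

lemma e_lim: "e \<longlonglongrightarrow> 0"
proof -
  have "e = (\<lambda>N. inverse (r N))" by (auto simp: e_def r_def)
  then show ?thesis using tendsto_inverse_0_at_top[OF r_top] by simp
qed

lemma ev_ge1: "\<forall>\<^sub>F N in sequentially. N \<ge> (1::nat)"
  by (rule eventually_ge_at_top)

lemma e_pos: "\<forall>\<^sub>F N in sequentially. e N > 0"
  using ev_ge1 by eventually_elim (simp add: e_def b_pos)

text \<open>The truncation bias contributes \<open>e N / (tau N)\<^sup>2\<close> per particle, and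
  this divergence makes it negligible against \<open>(e N)\<^sup>2\<close>.\<close>

lemma e_tau_top: "filterlim (\<lambda>N. e N * (tau N)\<^sup>2) at_top sequentially"
proof (rule filterlim_mono_eventually)
  show "filterlim (\<lambda>N. b N ^ 3 * sqrt (real N)) at_top sequentially"
    by (intro filterlim_at_top_mult_at_top filterlim_pow_at_top b_top sqrt_top) simp
  show "\<forall>\<^sub>F N in sequentially. b N ^ 3 * sqrt (real N) = e N * (tau N)\<^sup>2"
    using ev_ge1
  proof eventually_elim
    case (elim N)
    then have "sqrt (real N) > 0" by simp
    then show ?case by (simp add: e_def tau_def power2_eq_square power3_eq_cube field_simps)
  qed
qed auto

abbreviation PG :: "nat \<Rightarrow> nat \<Rightarrow> (nat \<Rightarrow> 'a) measure" where "PG t \<equiv> \<lambda>N. pg N t"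

abbreviation V :: "nat \<Rightarrow> ('a \<Rightarrow> real) \<Rightarrow> ennreal" where "V \<equiv> Vvar mu a0 a bt"

definition Z :: "nat \<Rightarrow> ('a \<Rightarrow> real) \<Rightarrow> nat \<Rightarrow> (nat \<Rightarrow> 'a) \<Rightarrow> real" where
  "Z t g N w = (\<Sum>i<N. g (w i) - m t g) / (b N * sqrt (real N))"

text \<open>Only the summands are truncated, not the centring, so \<open>Zt\<close> coincides with
  \<open>Z\<close> as long as no particle exceeds the level.\<close>

definition Zt :: "nat \<Rightarrow> ('a \<Rightarrow> real) \<Rightarrow> nat \<Rightarrow> (nat \<Rightarrow> 'a) \<Rightarrow> real" where
  "Zt t g N w = (\<Sum>i<N. trunc (tau N) (g (w i)) - m t g) / (b N * sqrt (real N))"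

lemma PG_measurable_iff: "N \<ge> 1 \<Longrightarrow> f \<in> borel_measurable (PG t N) \<longleftrightarrow> f \<in> borel_measurable (borel_pow N)"
  by (simp add: measurable_cong_sets[OF sets_pg refl])

lemma Z_measurable [measurable (raw)]:
  assumes [measurable]: "g \<in> borel_measurable borel"
  shows "Z t g N \<in> borel_measurable (borel_pow N)"
  unfolding Z_def[abs_def] by measurable

lemma Zt_measurable [measurable (raw)]:
  assumes [measurable]: "g \<in> borel_measurable borel"
  shows "Zt t g N \<in> borel_measurable (borel_pow N)"
  unfolding Zt_def[abs_def] by measurable

lemma Z_emp:
  assumes "N \<ge> 1"
  shows "Z t g N w = (emp N g w - m t g) * r N"
proof -
  have N: "real N > 0" "sqrt (real N) > 0" using assms by auto
  have 1: "(\<Sum>i<N. g (w i) - m t g) = (emp N g w - m t g) * real N"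
    using N by (simp add: emp_def sum_subtractf left_diff_distrib)
  have 2: "real N / (b N * sqrt (real N)) = r N"
    unfolding r_def using real_div_sqrt[of "real N"] by (metis divide_divide_eq_left mult.commute of_nat_0_le_iff)
  show ?thesis unfolding Z_def 1 2[symmetric] by simp
qed

text \<open>The induction hypothesis ranges over all bounded functions, because one step applies it
  to \<open>innov t g\<close> and, through concentration, to L 1, L g and L g^2.\<close>

definition laplace_bounded :: "nat \<Rightarrow> bool" where
  "laplace_bounded t \<longleftrightarrow> (\<forall>g l. g \<in> borel_measurable borel \<longrightarrow> (\<exists>B. \<forall>x. \<bar>g x\<bar> \<le> B) \<longrightarrow>
     exp_rate (PG t) s (\<lambda>N w. l * Z t g N w) (l\<^sup>2 * enn2real (V t g) / 2))"

lemma laplace_boundedD: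
  assumes "laplace_bounded t" "g \<in> borel_measurable borel" "\<And>x. \<bar>g x\<bar> \<le> B"
  shows "exp_rate (PG t) s (\<lambda>N w. l * Z t g N w) (l\<^sup>2 * enn2real (V t g) / 2)"
  using assms unfolding laplace_bounded_def by blast

text \<open>\<open>s N * U t g l N w\<close> is, up to \<open>o(s N)\<close>, the conditional log-Laplace transform of generation
  \<open>Suc t\<close> given that generation \<open>t\<close> is \<open>w\<close>.\<close>
definition U :: "nat \<Rightarrow> ('a \<Rightarrow> real) \<Rightarrow> real \<Rightarrow> nat \<Rightarrow> (nat \<Rightarrow> 'a) \<Rightarrow> real" where
  "U t g l N w = l * (emp N (L t g) w / emp N (L t (\<lambda>_. 1)) w - m (Suc t) g) / e N
     + l\<^sup>2 / 2 * (emp N (L t (\<lambda>x. (g x)\<^sup>2)) w / emp N (L t (\<lambda>_. 1)) w - (emp N (L t g) w / emp N (L t (\<lambda>_. 1)) w)\<^sup>2)"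

text \<open>The function to which the variance recursion applies the previous variance. Its
  empirical mean is the numerator of the drift.\<close>

definition innov :: "nat \<Rightarrow> ('a \<Rightarrow> real) \<Rightarrow> 'a \<Rightarrow> real" where
  "innov t g x = L t g x - m (Suc t) g * L t (\<lambda>_. 1) x"

lemma innov_bounded:
  assumes g: "integrable (rho t) g"
  obtains B where "\<And>x. \<bar>innov t g x\<bar> \<le> B"
proof
  fix x
  have "\<bar>innov t g x\<bar> \<le> \<bar>L t g x\<bar> + \<bar>m (Suc t) g\<bar> * \<bar>L t (\<lambda>_. 1) x\<bar>"
    unfolding innov_def abs_mult[symmetric] by (rule abs_triangle_ineq4)
  also have "... \<le> Ca * (\<integral>u. \<bar>g u\<bar> \<partial>rho t) + \<bar>m (Suc t) g\<bar> * (Ca * (\<integral>u. \<bar>1 :: real\<bar> \<partial>rho t))"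
    by (intro add_mono mult_left_mono Lop_abs_le g) auto
  finally show "\<bar>innov t g x\<bar> \<le> Ca * (\<integral>u. \<bar>g u\<bar> \<partial>rho t) + \<bar>m (Suc t) g\<bar> * (Ca * (\<integral>u. \<bar>1 :: real\<bar> \<partial>rho t))" .
qed

lemma innov_measurable [measurable (raw)]:
  assumes [measurable]: "g \<in> borel_measurable borel"
  shows "innov t g \<in> borel_measurable borel"
  unfolding innov_def[abs_def] by measurable

text \<open>\<open>U\<close> is the normalised sum of \<open>innov t g\<close> with a random
  coefficient plus a random variance. Both random quantities are functions of three empirical means
  that concentrate superexponentially, so \<open>exp_rate_perturb\<close> may replace them by their
  limits.\<close>

lemma exp_rate_U:
  assumes lap: "laplace_bounded t" and g: "integrable (rho t) g" and g2: "integrable (rho t) (\<lambda>x. (g x)\<^sup>2)"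
  shows "exp_rate (PG t) s (U t g l)
    ((l / m t (L t (\<lambda>_. 1)))\<^sup>2 * enn2real (V t (innov t g)) / 2 + l\<^sup>2 / 2 * (m (Suc t) (\<lambda>x. (g x)\<^sup>2) - (m (Suc t) g)\<^sup>2))"
proof -
  note [measurable] = integrable_rho_measurable[OF g]
  let ?one = "\<lambda>_ :: 'a. 1 :: real" and ?g2 = "\<lambda>x. (g x)\<^sup>2"
  let ?cv = "\<lambda>N w. emp N (L t ?g2) w / emp N (L t ?one) w - (emp N (L t g) w / emp N (L t ?one) w)\<^sup>2"
  define k where "k = m t (L t ?one)"
  define Y where "Y = Z t (innov t g)"
  define B1 where "B1 = Ca * (\<integral>u. \<bar>?one u\<bar> \<partial>rho t)"
  define Bg where "Bg = Ca * (\<integral>u. \<bar>g u\<bar> \<partial>rho t)"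
  define B2 where "B2 = Ca * (\<integral>u. \<bar>?g2 u\<bar> \<partial>rho t)"
  have k: "k > 0" unfolding k_def by (rule kappa_pos)
  have b1: "\<bar>L t ?one x\<bar> \<le> B1" for x unfolding B1_def by (rule Lop_abs_le) simp
  have bg: "\<bar>L t g x\<bar> \<le> Bg" for x unfolding Bg_def by (rule Lop_abs_le[OF g])
  have b2: "\<bar>L t ?g2 x\<bar> \<le> B2" for x unfolding B2_def by (rule Lop_abs_le[OF g2])
  obtain BI where bi: "\<And>x. \<bar>innov t g x\<bar> \<le> BI" using innov_bounded[OF g] by blast
  have mg: "m t (L t g) = k * m (Suc t) g" and mg2: "m t (L t ?g2) = k * m (Suc t) ?g2"
    using mfilt_Suc(2)[OF g] mfilt_Suc(2)[OF g2] k by (simp_all add: k_def)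
  \<comment> \<open>The filter mean at time \<open>Suc t\<close> is the ratio of the filter means of
    L g and L 1 at time \<open>t\<close>, so the two terms cancel and \<open>Y\<close> needs no
    centring.\<close>
  have mi: "m t (innov t g) = 0"
  proof -
    have "m t (innov t g) = m t (L t g) - m (Suc t) g * k"
      unfolding mfilt_def[of _ _ _ _ t] k_def innov_def left_diff_distrib mult.assoc
      using integrable_bounded_times[OF integrable_filt _ bg] integrable_bounded_times[OF integrable_filt _ b1]
      by simp
    then show ?thesis by (simp add: mg)
  qed
  have Yrate: "exp_rate (PG t) s (\<lambda>N w. l * Y N w) (l\<^sup>2 * enn2real (V t (innov t g)) / 2)" for l
    unfolding Y_def by (rule laplace_boundedD[OF lap _ bi]) measurable
  have Z_rate: "exp_rate (PG t) s (\<lambda>N w. l * Z t h N w) (l\<^sup>2 * enn2real (V t h) / 2)"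
    if "h \<in> borel_measurable borel" "\<And>x. \<bar>h x\<bar> \<le> B" for l h B
    by (rule laplace_boundedD[OF lap that])
  have low1: "low t \<le> emp N (L t ?one) w" if "N \<ge> 1" for N w using emp_Lop_one_ge[OF that] .
  have Y_emp: "Y N w = (emp N (L t g) w - m (Suc t) g * emp N (L t ?one) w) * r N" if "N \<ge> 1" for N w
    unfolding Y_def Z_emp[OF that] mi
    by (simp add: emp_def innov_def sum_subtractf sum_distrib_left[symmetric] diff_divide_distrib)
  \<comment> \<open>An exact identity, not a linearisation: over the common denominator the drift
    has the numerator of \<open>Y\<close>, and dividing by \<open>e N\<close> is multiplying by
    \<open>r N\<close>.\<close>
  have U_Y: "U t g l N w = l * Y N w / emp N (L t ?one) w
     + l\<^sup>2 / 2 * ?cv N w" if N: "N \<ge> 1" for N w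
  proof -
    have "emp N (L t ?one) w > 0" using low1[OF N, of w] low_pos[of t] by linarith
    then show ?thesis using b_pos[OF N] N unfolding U_def Y_emp[OF N] e_def r_def by (simp add: field_simps)
  qed
  define M where "M = l\<^sup>2 / 2 * (B2 / low t + (Bg / low t)\<^sup>2)"
  have U_bd: "\<bar>U t g l N w\<bar> \<le> \<bar>l\<bar> / low t * \<bar>Y N w\<bar> + M" if N: "N \<ge> 1" for N w
  proof -
    let ?A = "emp N (L t ?one) w"
    have A: "low t \<le> ?A" "0 < ?A" using low1[OF N, of w] low_pos[of t] by linarith+
    have dv: "\<bar>x / ?A\<bar> \<le> B / low t" if "\<bar>x\<bar> \<le> B" for x B
      using that A low_pos[of t] by (simp add: abs_divide) (intro frac_le, auto)
    have "\<bar>U t g l N w\<bar> \<le> \<bar>l * Y N w / ?A\<bar> + l\<^sup>2 / 2 * \<bar>emp N (L t ?g2) w / ?A - (emp N (L t g) w / ?A)\<^sup>2\<bar>"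
      unfolding U_Y[OF N] by (rule order.trans[OF abs_triangle_ineq]) (simp add: abs_mult)
    also have "... \<le> \<bar>l * Y N w\<bar> / low t + l\<^sup>2 / 2 * (B2 / low t + (Bg / low t)\<^sup>2)"
    proof (intro add_mono mult_left_mono dv order.refl)
      have "\<bar>emp N (L t g) w / ?A\<bar> \<le> Bg / low t" by (rule dv[OF abs_emp_le[OF N bg]])
      then have "\<bar>emp N (L t g) w / ?A\<bar>\<^sup>2 \<le> (Bg / low t)\<^sup>2" by (rule power_mono) simp
      then have "(emp N (L t g) w / ?A)\<^sup>2 \<le> (Bg / low t)\<^sup>2" by (simp only: power2_abs)
      moreover have "\<bar>emp N (L t ?g2) w / ?A\<bar> \<le> B2 / low t" by (rule dv[OF abs_emp_le[OF N b2]])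
      ultimately show "\<bar>emp N (L t ?g2) w / ?A - (emp N (L t g) w / ?A)\<^sup>2\<bar> \<le> B2 / low t + (Bg / low t)\<^sup>2"
        by (intro order.trans[OF abs_triangle_ineq4] add_mono) auto
    qed simp
    finally show ?thesis by (simp add: M_def abs_mult)
  qed
  have M0: "M \<ge> 0" using b2[of undefined] low_pos[of t] unfolding M_def by (intro mult_nonneg_nonneg add_nonneg_nonneg divide_nonneg_nonneg) auto
  have Y_bd: "\<bar>Y N w\<bar> \<le> BI * r N" if N: "N \<ge> 1" for N w
  proof -
    have "\<bar>emp N (innov t g) w\<bar> \<le> BI" by (rule abs_emp_le[OF N bi])
    then show ?thesis using b_pos[OF N] unfolding Y_def Z_emp[OF N] mi
      by (simp add: abs_mult r_def) (intro divide_right_mono mult_right_mono, auto)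
  qed
  define v where "v = enn2real (V t (innov t g))"
  define \<sigma> where "\<sigma> = m (Suc t) ?g2 - (m (Suc t) g)\<^sup>2"
  have "exp_rate (PG t) s (U t g l) ((l / k)\<^sup>2 * v / 2 + l\<^sup>2 / 2 * \<sigma>)"
  proof (rule exp_rate_perturb[OF s_top r_top])
    show "\<forall>\<^sub>F N in sequentially. prob_space (PG t N)"
      using ev_ge1 by eventually_elim (rule pg_prob)
    show "exp_rate (PG t) s (\<lambda>N w. l * Y N w) (l\<^sup>2 * v / 2)" for l
      unfolding v_def by (rule Yrate)
    show "\<forall>\<^sub>F N in sequentially. Y N \<in> borel_measurable (PG t N) \<and> U t g l N \<in> borel_measurable (PG t N)"
      using ev_ge1
    proof eventually_elim
      case (elim N)
      show ?case unfolding PG_measurable_iff[OF elim] Y_def U_def[abs_def] by (intro conjI) measurable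
    qed
    have "\<forall>\<^sub>F N in sequentially. r N \<ge> 1" using r_top by (simp add: filterlim_at_top)
    with ev_ge1 show "\<forall>\<^sub>F N in sequentially. \<forall>w\<in>space (PG t N).
        \<bar>U t g l N w\<bar> \<le> (\<bar>l\<bar> / low t * BI + M + BI) * r N \<and> \<bar>Y N w\<bar> \<le> (\<bar>l\<bar> / low t * BI + M + BI) * r N"
    proof eventually_elim
      case (elim N)
      have BI0: "0 \<le> BI" using bi[of undefined] by linarith
      have 1: "M * 1 \<le> M * r N" using M0 elim by (intro mult_left_mono) auto
      have 2: "0 \<le> BI * r N" using BI0 elim by simp
      have 3: "0 \<le> \<bar>l\<bar> / low t * BI * r N" using BI0 elim low_pos[of t] by simp
      show ?case
      proof (intro ballI conjI)
        fix w
        have "\<bar>l\<bar> / low t * \<bar>Y N w\<bar> \<le> \<bar>l\<bar> / low t * (BI * r N)"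
          using Y_bd[OF elim(1), of w] low_pos[of t] by (intro mult_left_mono) auto
        then show "\<bar>U t g l N w\<bar> \<le> (\<bar>l\<bar> / low t * BI + M + BI) * r N"
          using U_bd[OF elim(1), of w] 1 2 unfolding distrib_right mult.assoc by linarith
        show "\<bar>Y N w\<bar> \<le> (\<bar>l\<bar> / low t * BI + M + BI) * r N"
          using Y_bd[OF elim(1), of w] 1 3 M0 unfolding distrib_right mult.assoc by linarith
      qed
    qed
    define K where "K = max (\<bar>l\<bar> / low t) M"
    fix L0 \<eta> :: real assume \<eta>: "\<eta> > 0"
    \<comment> \<open>The denominator is the constant of \<open>perturbation_bound\<close>, so
      tolerances \<open>\<eta>1\<close> on the coefficients add up to \<eta> where \<bar>Y\<bar>
      \<le> L0.\<close>
    define \<eta>1 where "\<eta>1 = \<eta> / (\<bar>l\<bar> * \<bar>L0\<bar> + l\<^sup>2 / 2 + 1)"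
    have dpos: "\<bar>l\<bar> * \<bar>L0\<bar> + l\<^sup>2 / 2 + 1 > 0" by (simp add: add_nonneg_pos)
    have "\<eta>1 > 0" unfolding \<eta>1_def using \<eta> dpos by (rule divide_pos_pos)
    then obtain \<delta> where \<delta>: "\<delta> > 0" and cont: "\<And>x y z. \<bar>x - k\<bar> < \<delta> \<Longrightarrow> \<bar>y - m t (L t g)\<bar> < \<delta> \<Longrightarrow> \<bar>z - m t (L t ?g2)\<bar> < \<delta> \<Longrightarrow>
        \<bar>1 / x - 1 / k\<bar> < \<eta>1 \<and> \<bar>(z / x - (y / x)\<^sup>2) - (m t (L t ?g2) / k - (m t (L t g) / k)\<^sup>2)\<bar> < \<eta>1"
      using ratio_continuity[of k \<eta>1 "m t (L t g)" "m t (L t ?g2)"] k by (metis less_irrefl)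
    \<comment> \<open>In terms of \<open>Z\<close> this is the event that the empirical mean of
      \<open>h\<close> is off by at least \<delta>.\<close>
    define S where "S = (\<lambda>h N. {w\<in>space (PG t N). \<delta> * r N \<le> \<bar>Z t h N w\<bar>})"
    define B where "B = (\<lambda>N. S (L t ?one) N \<union> S (L t g) N \<union> S (L t ?g2) N)"
    have conc: "\<forall>\<^sub>F N in sequentially. S h N \<in> sets (PG t N) \<and> emeasure (PG t N) (S h N) \<le> eexp (- (s N * r N * Cx))"
      if h[measurable]: "h \<in> borel_measurable borel" and B: "\<And>x. \<bar>h x\<bar> \<le> B" for h B Cx
    proof -
      have Zm: "\<forall>\<^sub>F N in sequentially. Z t h N \<in> borel_measurable (PG t N)"
        using ev_ge1 by eventually_elim (simp add: PG_measurable_iff Z_measurable[OF h])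
      show ?thesis
        using exp_rate_concentration[OF s_top r_top Z_rate[OF h B] Zm \<delta>, of Cx] Zm
      proof eventually_elim
        case (elim N)
        note [measurable] = elim(2)
        show ?case using elim(1) unfolding S_def by simp
      qed
    qed
    have "\<forall>\<^sub>F N in sequentially. B N \<in> sets (PG t N) \<and> emeasure (PG t N) (B N) \<le> eexp (- (s N * r N * C))" for C
    proof -
      have mL: "L t ?one \<in> borel_measurable borel" "L t g \<in> borel_measurable borel" "L t ?g2 \<in> borel_measurable borel"
        by measurable
      have "\<forall>\<^sub>F N in sequentially. s N \<ge> 2" using s_top by (simp add: filterlim_at_top)
      moreover have "\<forall>\<^sub>F N in sequentially. r N \<ge> 1" using r_top by (simp add: filterlim_at_top)
      ultimately show ?thesis
        using conc[OF mL(1) b1, where Cx = "C + 1"] conc[OF mL(2) bg, where Cx = "C + 1"] conc[OF mL(3) b2, where Cx = "C + 1"]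
      proof eventually_elim
        case (elim N)
        note h = elim(1,2) conjunct1[OF elim(3)] conjunct1[OF elim(4)] conjunct1[OF elim(5)]
          conjunct2[OF elim(3)] conjunct2[OF elim(4)] conjunct2[OF elim(5)]
        let ?x = "eexp (- (s N * r N * (C + 1)))"
        have "emeasure (PG t N) (B N) \<le> emeasure (PG t N) (S (L t ?one) N \<union> S (L t g) N) + emeasure (PG t N) (S (L t ?g2) N)"
          unfolding B_def by (intro emeasure_subadditive sets.Un h)
        also have "... \<le> (emeasure (PG t N) (S (L t ?one) N) + emeasure (PG t N) (S (L t g) N)) + emeasure (PG t N) (S (L t ?g2) N)"
          by (intro add_right_mono emeasure_subadditive h)
        also have "... \<le> ?x + ?x + ?x" by (intro add_mono h)
        also have "... = ennreal (3 * exp (- (s N * r N * (C + 1))))"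
          by (simp add: ennreal_plus[symmetric] del: ennreal_plus)
        also have "... \<le> eexp (- (s N * r N * C))"
        proof (rule ennreal_leI)
          \<comment> \<open>The union of three events costs a factor 3, which the step from
            \<open>C + 1\<close> to \<open>C\<close> in the exponent absorbs.\<close>
          have "2 * 1 \<le> s N * r N" using h(1,2) by (intro mult_mono) auto
          then have "3 \<le> exp (s N * r N)" using exp_ge_add_one_self[of "s N * r N"] by linarith
          then have "3 * exp (- (s N * r N * (C + 1))) \<le> exp (s N * r N) * exp (- (s N * r N * (C + 1)))"
            by (rule mult_right_mono) simp
          then show "3 * exp (- (s N * r N * (C + 1))) \<le> exp (- (s N * r N * C))"
            by (simp add: exp_add[symmetric] algebra_simps)
        qed
        finally have "emeasure (PG t N) (B N) \<le> eexp (- (s N * r N * C))" .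
        moreover have "B N \<in> sets (PG t N)" unfolding B_def by (intro sets.Un h)
        ultimately show ?case by (rule conjI[rotated])
      qed
    qed
    moreover have "\<forall>\<^sub>F N in sequentially. \<forall>w\<in>space (PG t N) - B N. \<bar>U t g l N w\<bar> \<le> K * \<bar>Y N w\<bar> + K \<and>
          (\<bar>Y N w\<bar> \<le> L0 \<longrightarrow> \<bar>U t g l N w - (l / k * Y N w + l\<^sup>2 / 2 * \<sigma>)\<bar> \<le> \<eta>)"
      using ev_ge1
    proof eventually_elim
      case (elim N)
      have rp: "r N > 0" using b_pos[OF elim] elim by (simp add: r_def)
      show ?case
      proof (intro ballI conjI impI)
        fix w assume w: "w \<in> space (PG t N) - B N"
        have "\<bar>l\<bar> / low t * \<bar>Y N w\<bar> \<le> K * \<bar>Y N w\<bar>" unfolding K_def by (intro mult_right_mono) auto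
        moreover have "M \<le> K" by (simp add: K_def)
        ultimately show "\<bar>U t g l N w\<bar> \<le> K * \<bar>Y N w\<bar> + K" using U_bd[OF elim, of w] by linarith
        assume YL: "\<bar>Y N w\<bar> \<le> L0"
        have near: "\<bar>emp N h w - m t h\<bar> < \<delta>" if "w \<notin> S h N" for h
        proof -
          have "\<bar>Z t h N w\<bar> < \<delta> * r N" using that w by (auto simp: S_def)
          then have "\<bar>emp N h w - m t h\<bar> * r N < \<delta> * r N" using rp by (simp add: Z_emp[OF elim] abs_mult)
          then show ?thesis using rp by (simp add: mult_less_cancel_right)
        qed
        have wS: "w \<notin> S (L t ?one) N" "w \<notin> S (L t g) N" "w \<notin> S (L t ?g2) N"
          using w unfolding B_def by blast+
        have \<sigma>_eq: "\<sigma> = m t (L t ?g2) / k - (m t (L t g) / k)\<^sup>2"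
          unfolding \<sigma>_def mg mg2 using k by simp
        have c: "\<bar>1 / emp N (L t ?one) w - 1 / k\<bar> < \<eta>1"
          "\<bar>?cv N w - \<sigma>\<bar> < \<eta>1"
          using cont[OF near[OF wS(1), folded k_def] near[OF wS(2)] near[OF wS(3)]] unfolding \<sigma>_eq by blast+
        have "U t g l N w - (l / k * Y N w + l\<^sup>2 / 2 * \<sigma>) = l * Y N w * (1 / emp N (L t ?one) w - 1 / k)
          + l\<^sup>2 / 2 * (?cv N w - \<sigma>)"
          unfolding U_Y[OF elim] by (simp add: algebra_simps)
        also have "\<bar>...\<bar> \<le> (\<bar>l\<bar> * \<bar>L0\<bar> + l\<^sup>2 / 2 + 1) * \<eta>1"
          by (rule perturbation_bound[OF less_imp_le[OF c(1)] less_imp_le[OF c(2)] YL])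
        also have "... = \<eta>" unfolding \<eta>1_def using dpos by (metis less_irrefl nonzero_mult_div_cancel_left times_divide_eq_right)
        finally show "\<bar>U t g l N w - (l / k * Y N w + l\<^sup>2 / 2 * \<sigma>)\<bar> \<le> \<eta>" .
      qed
    qed
    ultimately show "\<exists>B. superneg (PG t) s r B \<and>
      (\<forall>\<^sub>F N in sequentially. \<forall>w\<in>space (PG t N) - B N. \<bar>U t g l N w\<bar> \<le> K * \<bar>Y N w\<bar> + K \<and>
          (\<bar>Y N w\<bar> \<le> L0 \<longrightarrow> \<bar>U t g l N w - (l / k * Y N w + l\<^sup>2 / 2 * \<sigma>)\<bar> \<le> \<eta>))"
      by blast
  qed
  then show ?thesis by (simp add: k_def v_def \<sigma>_def)
qed

end

section \<open>Truncated moments and the passage to the next generation\<close>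

lemma cube_le_exp:
  assumes "0 \<le> y" "c > (0::real)"
  shows "y ^ 3 \<le> 27 / c ^ 3 * exp (c * y)"
proof -
  \<comment> \<open>The factor 27 appears on cubing this inequality.\<close>
  have "c * y / 3 \<le> exp (c * y / 3)" using exp_ge_add_one_self[of "c * y / 3"] by linarith
  then have "(c * y / 3) ^ 3 \<le> exp (c * y / 3) ^ 3" using assms by (intro power_mono) auto
  also have "... = exp (c * y)" by (simp add: exp_of_nat_mult[symmetric])
  finally show ?thesis using assms by (simp add: power_divide power_mult_distrib field_simps)
qed

lemma nn_integral_dominated:
  assumes "\<And>x. f x \<le> C * G x" "C \<ge> 0" "\<And>x. 0 \<le> G x" and fin: "(\<integral>\<^sup>+x. ennreal (G x) \<partial>M) < \<infinity>"
    and [measurable]: "G \<in> borel_measurable M"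
  shows "(\<integral>\<^sup>+x. ennreal (f x) \<partial>M) \<le> ennreal (C * enn2real (\<integral>\<^sup>+x. ennreal (G x) \<partial>M))"
proof -
  have "(\<integral>\<^sup>+x. ennreal (f x) \<partial>M) \<le> (\<integral>\<^sup>+x. ennreal C * ennreal (G x) \<partial>M)"
    using assms by (intro nn_integral_mono) (auto simp: ennreal_mult[symmetric] intro!: ennreal_leI)
  also have "... = ennreal C * (\<integral>\<^sup>+x. ennreal (G x) \<partial>M)" by (rule nn_integral_cmult) measurable
  also have "... = ennreal (C * enn2real (\<integral>\<^sup>+x. ennreal (G x) \<partial>M))"
    using fin assms(2) by (simp add: ennreal_mult)
  finally show ?thesis .
qed

lemma exponential_markov:
  assumes [measurable]: "G \<in> borel_measurable M"
  shows "emeasure M {x \<in> space M. c \<le> G x} \<le> eexp (- c) * (\<integral>\<^sup>+x. eexp (G x) \<partial>M)"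
proof -
  have "emeasure M {x \<in> space M. c \<le> G x} = (\<integral>\<^sup>+x. indicator {x \<in> space M. c \<le> G x} x \<partial>M)" by simp
  also have "... \<le> (\<integral>\<^sup>+x. eexp (- c) * eexp (G x) \<partial>M)"
    by (intro nn_integral_mono) (auto simp: indicator_def ennreal_mult[symmetric] exp_add[symmetric])
  also have "... = eexp (- c) * (\<integral>\<^sup>+x. eexp (G x) \<partial>M)" by (rule nn_integral_cmult) measurable
  finally show ?thesis .
qed

lemma emeasure_iid_exists_le:
  assumes q: "prob_space q" and [measurable]: "A \<in> sets q"
  shows "emeasure (PiM {..<N} (\<lambda>_. q)) {p \<in> space (PiM {..<N} (\<lambda>_. q)). \<exists>i<N. p i \<in> A} \<le> of_nat N * emeasure q A"
proof -
  interpret product_prob_space "\<lambda>_. q" "{..<N}"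
    using q by (intro product_prob_spaceI)
  let ?P = "PiM {..<N} (\<lambda>_. q)"
  have "emeasure ?P {p \<in> space ?P. \<exists>i<N. p i \<in> A} = emeasure ?P (\<Union>i\<in>{..<N}. {p \<in> space ?P. p i \<in> A})"
    by (rule arg_cong[where f = "emeasure ?P"]) auto
  also have "... \<le> (\<Sum>i<N. emeasure ?P {p \<in> space ?P. p i \<in> A})"
    by (rule emeasure_subadditive_finite) auto
  also have "... = (\<Sum>i<N. emeasure q A)"
  proof (rule sum.cong[OF refl])
    fix i assume i: "i \<in> {..<N}"
    have "emeasure q A = emeasure (distr ?P q (\<lambda>p. p i)) A" using PiM_component[OF i] by simp
    also have "... = emeasure ?P ((\<lambda>p. p i) -` A \<inter> space ?P)" using i by (intro emeasure_distr) auto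
    also have "(\<lambda>p. p i) -` A \<inter> space ?P = {p \<in> space ?P. p i \<in> A}" by auto
    finally show "emeasure ?P {p \<in> space ?P. p i \<in> A} = emeasure q A" ..
  qed
  finally show ?thesis by simp
qed

context hmm_filter_rate
begin

declare Vvar.simps(2) [simp del]

abbreviation trunc_moment :: "'a measure \<Rightarrow> ('a \<Rightarrow> real) \<Rightarrow> real \<Rightarrow> nat \<Rightarrow> ennreal" where
  "trunc_moment R g l N \<equiv> \<integral>\<^sup>+x. ennreal (\<bar>trunc (tau N) (g x)\<bar> ^ 3 * exp (\<bar>l * e N\<bar> * \<bar>trunc (tau N) (g x)\<bar>)) \<partial>R"

text \<open>The truncation level \<open>tau N = b N * sqrt N\<close> is the size of a single summand that moves the
  normalised sum by \<open>1\<close>, so exceeding it must be excluded anyway.\<close>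
definition tame :: "'a measure \<Rightarrow> ('a \<Rightarrow> real) \<Rightarrow> bool" where
  "tame R g \<longleftrightarrow> (\<exists>K\<ge>0. (\<integral>\<^sup>+x. ennreal (\<bar>g x\<bar> ^ 3) \<partial>R) \<le> ennreal K) \<and>
     (\<forall>l. \<exists>K\<ge>0. \<forall>\<^sub>F N in sequentially.
        trunc_moment R g l N \<le> ennreal K)"

lemma bounded_tame:
  assumes R: "finite_measure R" and g: "\<And>x. \<bar>g x\<bar> \<le> B"
  shows "tame R g"
  unfolding tame_def
proof (intro conjI allI)
  interpret finite_measure R by fact
  have B: "0 \<le> B" using g[of undefined] by linarith
  have K: "(\<integral>\<^sup>+x. ennreal (f x) \<partial>R) \<le> ennreal (C * enn2real (\<integral>\<^sup>+x. ennreal 1 \<partial>R))"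
    if "\<And>x. f x \<le> C" "C \<ge> 0" for f C
    by (rule nn_integral_dominated) (use that emeasure_finite[of "space R"] in \<open>auto simp: less_top[symmetric]\<close>)
  show "\<exists>K\<ge>0. (\<integral>\<^sup>+x. ennreal (\<bar>g x\<bar> ^ 3) \<partial>R) \<le> ennreal K"
  proof (intro exI conjI)
    show "(\<integral>\<^sup>+x. ennreal (\<bar>g x\<bar> ^ 3) \<partial>R) \<le> ennreal (B ^ 3 * enn2real (\<integral>\<^sup>+x. ennreal 1 \<partial>R))"
      by (rule K) (use g B in \<open>auto intro: power_mono\<close>)
  qed (use B in simp)
  fix l
  have "\<forall>\<^sub>F N in sequentially. e N < 1" using e_lim by (rule order_tendstoD) simp
  with e_pos have "\<forall>\<^sub>F N in sequentially.
      trunc_moment R g l N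
        \<le> ennreal (B ^ 3 * exp (\<bar>l\<bar> * B) * enn2real (\<integral>\<^sup>+x. ennreal 1 \<partial>R))"
  proof eventually_elim
    case (elim N)
    show ?case
    proof (rule K)
      fix x
      have t: "\<bar>trunc (tau N) (g x)\<bar> \<le> B" using abs_trunc_le[of "tau N" "g x"] g[of x] by linarith
      have "\<bar>l * e N\<bar> \<le> \<bar>l\<bar>" using elim by (simp add: abs_mult mult_left_le)
      then have "\<bar>l * e N\<bar> * \<bar>trunc (tau N) (g x)\<bar> \<le> \<bar>l\<bar> * B" using t by (intro mult_mono) auto
      then show "\<bar>trunc (tau N) (g x)\<bar> ^ 3 * exp (\<bar>l * e N\<bar> * \<bar>trunc (tau N) (g x)\<bar>) \<le> B ^ 3 * exp (\<bar>l\<bar> * B)"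
        using t B by (intro mult_mono power_mono) auto
    qed (use B in simp)
  qed
  then show "\<exists>K\<ge>0. \<forall>\<^sub>F N in sequentially.
      trunc_moment R g l N \<le> ennreal K"
    using B by (intro exI[of _ "B ^ 3 * exp (\<bar>l\<bar> * B) * enn2real (\<integral>\<^sup>+x. ennreal 1 \<partial>R)"]) auto
qed

lemma tame_integrable:
  assumes "tame (rho t) g" and [measurable]: "g \<in> borel_measurable borel"
  shows "integrable (rho t) g" "integrable (rho t) (\<lambda>x. (g x)\<^sup>2)"
proof -
  have fin: "(\<integral>\<^sup>+x. ennreal (\<bar>g x\<bar> ^ 3) \<partial>rho t) < \<infinity>"
    using assms(1) unfolding tame_def by (auto intro: order.strict_trans1[OF _ ennreal_less_top])
  have "g \<in> borel_measurable (rho t)" by measurable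
  note finite_measure.third_moment_integrable[OF finite_rho this fin]
  then show "integrable (rho t) g" "integrable (rho t) (\<lambda>x. (g x)\<^sup>2)" by blast+
qed

lemma Zt_iid:
  assumes N: "N \<ge> 1" and q: "prob_space q" and sq[measurable_cong]: "sets q = sets borel" and [measurable]: "g \<in> borel_measurable borel"
  shows "(\<integral>\<^sup>+p. eexp (s N * (l * Zt t g N p)) \<partial>PiM {..<N} (\<lambda>_. q))
    = (\<integral>\<^sup>+x. eexp (l * e N * (trunc (tau N) (g x) - m t g)) \<partial>q) ^ N"
proof -
  have "s N * (l * Zt t g N p) = (\<Sum>i<N. l * e N * (trunc (tau N) (g (p i)) - m t g))" for p
    using b_pos[OF N] N unfolding sum_distrib_left[symmetric] by (simp add: Zt_def s_def e_def power2_eq_square field_simps)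
  then show ?thesis
    using nn_integral_iid_exp_sum[OF q, of "\<lambda>x. l * e N * (trunc (tau N) (g x) - m t g)" N] by simp
qed

text \<open>Moments are checked once under \<open>R\<close> and carried to every dominated law, so
  the threshold for \<open>N\<close> does not depend on \<open>p\<close>. Later \<open>R\<close> is
  \<open>rho t\<close> with C = Ca / low t, or the initial law with C = 1.\<close>

lemma tame_one_step:
  assumes g[measurable]: "g \<in> borel_measurable borel" and R[measurable_cong]: "sets R = sets borel" and tame: "tame R g" and C: "C \<ge> 0" and \<eta>: "\<eta> > 0"
  shows "\<forall>\<^sub>F N in sequentially. \<forall>p. prob_space p \<longrightarrow> sets p = sets borel \<longrightarrow>
     (\<forall>h\<in>borel_measurable borel. (\<integral>\<^sup>+x. h x \<partial>p) \<le> ennreal C * (\<integral>\<^sup>+x. h x \<partial>R)) \<longrightarrow>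
     (let u = l * ((\<integral>x. g x \<partial>p) - m t g) / e N + l\<^sup>2 / 2 * ((\<integral>x. (g x)\<^sup>2 \<partial>p) - (\<integral>x. g x \<partial>p)\<^sup>2);
          q = (\<integral>\<^sup>+w. eexp (s N * (l * Zt t g N w)) \<partial>PiM {..<N} (\<lambda>_. p))
      in eexp (s N * (u - \<eta>)) \<le> q \<and> q \<le> eexp (s N * (u + \<eta>)))"
proof -
  obtain K1 where K1: "K1 \<ge> 0" "(\<integral>\<^sup>+x. ennreal (\<bar>g x\<bar> ^ 3) \<partial>R) \<le> ennreal K1" using tame unfolding tame_def by blast
  obtain K2 where K2: "K2 \<ge> 0" "\<forall>\<^sub>F N in sequentially.
        trunc_moment R g l N \<le> ennreal K2"
    using tame unfolding tame_def by blast
  define K where "K = C * (K1 + K2)"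
  have K: "K \<ge> 0" using C K1 K2 by (simp add: K_def)
  have bound: "(\<integral>\<^sup>+x. h x \<partial>p) \<le> ennreal K"
    if "\<forall>h\<in>borel_measurable borel. (\<integral>\<^sup>+x. h x \<partial>p) \<le> ennreal C * (\<integral>\<^sup>+x. h x \<partial>R)" "h \<in> borel_measurable borel"
      "(\<integral>\<^sup>+x. h x \<partial>R) \<le> ennreal k" "k \<le> K1 + K2" "k \<ge> 0" for h p k
  proof -
    have "(\<integral>\<^sup>+x. h x \<partial>p) \<le> ennreal C * (\<integral>\<^sup>+x. h x \<partial>R)" using that by blast
    also have "... \<le> ennreal C * ennreal k" by (intro mult_left_mono that) simp
    also have "... \<le> ennreal K" using C that by (simp add: ennreal_mult[symmetric] K_def mult_left_mono ennreal_leI)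
    finally show ?thesis .
  qed
  from one_step_rate[OF e_pos e_lim tau_top e_tau_top g K \<eta>, of l "m t g"] K2(2) ev_ge1
  show ?thesis
  proof eventually_elim
    case (elim N)
    show ?case
    proof (intro allI impI)
      fix p :: "'a measure" assume p: "prob_space p" "sets p = sets borel"
        "\<forall>h\<in>borel_measurable borel. (\<integral>\<^sup>+x. h x \<partial>p) \<le> ennreal C * (\<integral>\<^sup>+x. h x \<partial>R)"
      define u where "u = l * ((\<integral>x. g x \<partial>p) - m t g) / e N + l\<^sup>2 / 2 * ((\<integral>x. (g x)\<^sup>2 \<partial>p) - (\<integral>x. g x \<partial>p)\<^sup>2)"
      define q where "q = (\<integral>\<^sup>+x. eexp (l * e N * (trunc (tau N) (g x) - m t g)) \<partial>p)"
      have "(\<integral>\<^sup>+x. ennreal (\<bar>g x\<bar> ^ 3) \<partial>p) \<le> ennreal K"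
        by (rule bound[OF p(3) _ K1(2)]) (use K1 K2 in auto)
      moreover have "trunc_moment p g l N \<le> ennreal K"
        by (rule bound[OF p(3) _ elim(2)]) (measurable, use K1 K2 in auto)
      ultimately have "eexp ((e N)\<^sup>2 * (u - \<eta>)) \<le> q \<and> q \<le> eexp ((e N)\<^sup>2 * (u + \<eta>))"
        using elim(1)[rule_format, OF p(1,2)] unfolding u_def q_def Let_def by blast
      then have "eexp ((e N)\<^sup>2 * (u - \<eta>)) ^ N \<le> q ^ N \<and> q ^ N \<le> eexp ((e N)\<^sup>2 * (u + \<eta>)) ^ N"
        by (auto intro: power_mono)
      \<comment> \<open>Independence gives an N-th power, and N * \<open>(e N)\<^sup>2\<close> =
        \<open>s N\<close> restores the speed.\<close>
      moreover have "eexp ((e N)\<^sup>2 * x) ^ N = eexp (s N * x)" for x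
        using elim(3) by (simp add: ennreal_power exp_of_nat_mult[symmetric] e_def s_def power_divide)
      ultimately show "let u = l * ((\<integral>x. g x \<partial>p) - m t g) / e N + l\<^sup>2 / 2 * ((\<integral>x. (g x)\<^sup>2 \<partial>p) - (\<integral>x. g x \<partial>p)\<^sup>2);
          q = (\<integral>\<^sup>+w. eexp (s N * (l * Zt t g N w)) \<partial>PiM {..<N} (\<lambda>_. p))
        in eexp (s N * (u - \<eta>)) \<le> q \<and> q \<le> eexp (s N * (u + \<eta>))"
        unfolding Let_def u_def[symmetric] Zt_iid[OF elim(3) p(1,2) g] q_def by simp
    qed
  qed
qed

text \<open>Real-valued form of the recursion. An unbounded \<open>g\<close> is allowed, since
  finiteness at time \<open>t\<close> is only required for the bounded function
  \<open>innov t g\<close>.\<close>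

lemma Vvar_Suc:
  assumes "integrable (rho t) g" "integrable (rho t) (\<lambda>x. (g x)\<^sup>2)" and fin: "V t (innov t g) < \<infinity>"
  shows "V (Suc t) g < \<infinity>"
    "enn2real (V (Suc t) g) = (m (Suc t) (\<lambda>x. (g x)\<^sup>2) - (m (Suc t) g)\<^sup>2) + enn2real (V t (innov t g)) / (m t (L t (\<lambda>_. 1)))\<^sup>2"
proof -
  note [measurable] = integrable_rho_measurable[OF assms(1)]
  have [simp]: "innov t g = (\<lambda>x. L t g x - m (Suc t) g * L t (\<lambda>_. 1) x)" by (simp add: innov_def fun_eq_iff)
  note s2 = sigma2_eq[OF _ mfilt_Suc(1)[OF assms(1)] mfilt_Suc(1)[OF assms(2)]]
  have V: "V (Suc t) g = ennreal (m (Suc t) (\<lambda>x. (g x)\<^sup>2) - (m (Suc t) g)\<^sup>2) + ennreal (1 / (m t (L t (\<lambda>_. 1)))\<^sup>2) * V t (innov t g)"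
    using s2(1) by (simp add: Vvar.simps(2) kappa_Suc)
  show "V (Suc t) g < \<infinity>" unfolding V using fin by (simp add: ennreal_mult_less_top)
  show "enn2real (V (Suc t) g) = (m (Suc t) (\<lambda>x. (g x)\<^sup>2) - (m (Suc t) g)\<^sup>2) + enn2real (V t (innov t g)) / (m t (L t (\<lambda>_. 1)))\<^sup>2"
    unfolding V using fin s2(2) by (simp add: enn2real_plus enn2real_mult ennreal_mult_less_top)
qed

lemma Vvar_bounded_finite:
  assumes "g \<in> borel_measurable borel" "\<And>x. \<bar>g x\<bar> \<le> B"
  shows "V t g < \<infinity>"
  using assms
proof (induction t arbitrary: g B)
  case 0
  note [measurable] = 0(1)
  have 2: "\<bar>(g x)\<^sup>2\<bar> \<le> B\<^sup>2" for x using power_mono[OF 0(2), of x 2] by simp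
  show ?case using sigma2_eq[OF 0(1) integrable_bounded_times[OF integrable_filt 0] integrable_bounded_times[OF integrable_filt _ 2], of 0] by simp
next
  case (Suc t)
  note [measurable] = Suc(2)
  note int = tame_integrable[OF bounded_tame[OF finite_rho Suc(3)] Suc(2)]
  obtain B' where B': "\<And>x. \<bar>innov t g x\<bar> \<le> B'" using innov_bounded[OF int(1)] by blast
  show ?case by (rule Vvar_Suc(1)[OF int Suc.IH[OF _ B']]) measurable
qed

text \<open>Conditioning on generation \<open>t\<close>: by domination the inner Laplace transform
  lies within exp(s N * (U \<plusminus> \<eta>)) simultaneously for all \<open>w\<close>, so
  integrating over \<open>w\<close> reduces the claim to the rate of \<open>U\<close>.\<close>

lemma laplace_step:
  assumes lap: "laplace_bounded t" and g[measurable]: "g \<in> borel_measurable borel" and tame: "tame (rho t) g"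
  shows "exp_rate (PG (Suc t)) s (\<lambda>N w. l * Zt (Suc t) g N w) (l\<^sup>2 * enn2real (V (Suc t) g) / 2)"
proof (rule exp_rate_transfer[OF s_top])
  note int = tame_integrable[OF tame g]
  obtain B' where B': "\<And>x. \<bar>innov t g x\<bar> \<le> B'" using innov_bounded[OF int(1)] by blast
  have fin: "V t (innov t g) < \<infinity>" by (rule Vvar_bounded_finite[OF _ B']) measurable
  \<comment> \<open>The slope of \<open>Y\<close> is l / kappa; squaring it produces the factor 1 /
    kappa^2 of the recursion, while the conditional variance supplies sigma^2.\<close>
  have "(l / m t (L t (\<lambda>_. 1)))\<^sup>2 * enn2real (V t (innov t g)) / 2 + l\<^sup>2 / 2 * (m (Suc t) (\<lambda>x. (g x)\<^sup>2) - (m (Suc t) g)\<^sup>2)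
      = l\<^sup>2 * enn2real (V (Suc t) g) / 2"
    unfolding Vvar_Suc(2)[OF int fin] by (simp add: power_divide algebra_simps add_divide_distrib diff_divide_distrib)
  with exp_rate_U[OF lap int, of l]
  show "exp_rate (PG t) s (U t g l) (l\<^sup>2 * enn2real (V (Suc t) g) / 2)" by (simp only:)
  fix \<eta> R :: real assume \<eta>: "\<eta> > 0"
  let ?Q = "\<lambda>N. \<integral>\<^sup>+w. eexp (s N * (l * Zt (Suc t) g N w)) \<partial>PG (Suc t) N"
  let ?P = "\<lambda>N. \<integral>\<^sup>+w. eexp (s N * U t g l N w) \<partial>PG t N"
  define q where "q = (\<lambda>N w. \<integral>\<^sup>+p. eexp (s N * (l * Zt (Suc t) g N p)) \<partial>PiM {..<N} (\<lambda>_. law N t w))"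
  have C: "Ca / low t \<ge> 0" using Ca_pos low_pos[of t] by simp
  from ev_ge1 tame_one_step[OF g sets_rho tame C \<eta>, of l "Suc t"]
  have main: "\<forall>\<^sub>F N in sequentially. ?Q N \<le> eexp (s N * \<eta>) * ?P N \<and> ?P N \<le> eexp (s N * \<eta>) * ?Q N"
  proof eventually_elim
    case (elim N)
    have Um: "U t g l N \<in> borel_measurable (PG t N)"
      unfolding PG_measurable_iff[OF elim(1)] U_def[abs_def] by measurable
    have Q: "?Q N = (\<integral>\<^sup>+w. q N w \<partial>PG t N)"
      unfolding q_def by (rule nn_integral_pg_Suc[OF elim(1)]) measurable
    have qb: "eexp (s N * (U t g l N w - \<eta>)) \<le> q N w \<and> q N w \<le> eexp (s N * (U t g l N w + \<eta>))" for w
    proof -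
      have "\<forall>h\<in>borel_measurable borel. (\<integral>\<^sup>+x. h x \<partial>law N t w) \<le> ennreal (Ca / low t) * (\<integral>\<^sup>+x. h x \<partial>rho t)"
        using nn_integral_law_le[OF elim(1)] by blast
      from elim(2)[THEN spec, THEN mp, THEN mp, THEN mp, OF prob_space_law[OF elim(1)] sets_law this]
      show ?thesis unfolding Let_def law_integral[OF elim(1) int(1)] law_integral[OF elim(1) int(2)] q_def U_def .
    qed
    have eq: "eexp (s N * (x + y)) = eexp (s N * y) * eexp (s N * x)" for x y
      by (simp add: ennreal_mult[symmetric] exp_add[symmetric] algebra_simps)
    have "?Q N \<le> (\<integral>\<^sup>+w. eexp (s N * \<eta>) * eexp (s N * U t g l N w) \<partial>PG t N)"
      unfolding Q eq[symmetric] by (intro nn_integral_mono) (use qb in auto)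
    also have "... = eexp (s N * \<eta>) * ?P N" using Um by (intro nn_integral_cmult) measurable
    finally have 1: "?Q N \<le> eexp (s N * \<eta>) * ?P N" .
    have "eexp (s N * - \<eta>) * ?P N = (\<integral>\<^sup>+w. eexp (s N * - \<eta>) * eexp (s N * U t g l N w) \<partial>PG t N)"
      using Um by (intro nn_integral_cmult[symmetric]) measurable
    also have "... \<le> ?Q N" unfolding Q eq[symmetric] by (intro nn_integral_mono) (use qb in auto)
    finally have "eexp (s N * \<eta>) * (eexp (s N * - \<eta>) * ?P N) \<le> eexp (s N * \<eta>) * ?Q N"
      by (rule mult_left_mono) simp
    moreover have "eexp (s N * \<eta>) * (eexp (s N * - \<eta>) * x) = x" for x
      by (simp add: mult.assoc[symmetric] ennreal_mult[symmetric] exp_add[symmetric])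
    ultimately show ?case using 1 by simp
  qed
  from main show "\<forall>\<^sub>F N in sequentially. ?Q N \<le> eexp (s N * \<eta>) * ?P N + eexp (s N * R)"
    by eventually_elim (rule add_increasing2[OF zero_le conjunct1])
  from main show "\<forall>\<^sub>F N in sequentially. ?P N \<le> eexp (s N * \<eta>) * ?Q N + eexp (s N * R)"
    by eventually_elim (rule add_increasing2[OF zero_le conjunct2])
qed

lemma Z_eq_Zt:
  assumes "\<And>x. \<bar>g x\<bar> \<le> B"
  shows "\<forall>\<^sub>F N in sequentially. (\<lambda>w. l * Zt t g N w) = (\<lambda>w. l * Z t g N w)"
proof -
  have "\<forall>\<^sub>F N in sequentially. tau N \<ge> B" using tau_top by (simp add: filterlim_at_top)
  then show ?thesis
  proof eventually_elim
    case (elim N)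
    have "trunc (tau N) (g x) = g x" for x using assms[of x] elim by (simp add: trunc_def)
    then show ?case by (simp add: Zt_def Z_def)
  qed
qed

lemma laplace_bounded_all: "laplace_bounded t"
proof (induction t)
  case 0
  show ?case unfolding laplace_bounded_def
  proof (intro allI impI, elim exE)
    fix g :: "'a \<Rightarrow> real" and l B :: real assume g[measurable]: "g \<in> borel_measurable borel" and "\<forall>x. \<bar>g x\<bar> \<le> B"
    then have B: "\<And>x. \<bar>g x\<bar> \<le> B" by simp
    let ?R = "density mu (\<lambda>x. ennreal (a0 x))"
    interpret R: prob_space ?R by (rule prob_space_init)
    have sR: "sets ?R = sets borel" by (simp add: sets_mu)
    have tame: "tame ?R g" by (rule bounded_tame[OF _ B]) (rule R.finite_measure)
    have I: "(\<integral>x. h x \<partial>?R) = m 0 h" if [measurable]: "h \<in> borel_measurable borel" for h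
      by (subst integral_density) (auto simp: mfilt_def a0_nonneg mult.commute)
    have 2: "\<bar>(g x)\<^sup>2\<bar> \<le> B\<^sup>2" for x using power_mono[OF B, of x 2] by simp
    note sig = sigma2_eq[OF g integrable_bounded_times[OF integrable_filt g B] integrable_bounded_times[OF integrable_filt _ 2]]
    define u where "u = l\<^sup>2 / 2 * (m 0 (\<lambda>x. (g x)\<^sup>2) - (m 0 g)\<^sup>2)"
    have u: "l\<^sup>2 * enn2real (V 0 g) / 2 = u" unfolding u_def using sig[of 0] by simp
    have "exp_rate (PG 0) s (\<lambda>N w. l * Zt 0 g N w) u"
      unfolding exp_rate_def
    proof (intro allI impI)
      fix \<eta> :: real assume "\<eta> > 0"
      \<comment> \<open>At time 0 the sample is exactly i.i.d. with the law defining
        \<open>m 0\<close>, so the drift vanishes and only the variance is left.\<close>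
      from tame_one_step[OF g sR tame zero_le_one this, of l 0] ev_ge1
      show "\<forall>\<^sub>F N in sequentially. eexp (s N * (u - \<eta>)) \<le> (\<integral>\<^sup>+w. eexp (s N * (l * Zt 0 g N w)) \<partial>PG 0 N) \<and>
         (\<integral>\<^sup>+w. eexp (s N * (l * Zt 0 g N w)) \<partial>PG 0 N) \<le> eexp (s N * (u + \<eta>))"
      proof eventually_elim
        case (elim N)
        from elim(1)[rule_format, OF prob_space_init sR] show ?case
          by (simp add: Let_def I u_def)
      qed
    qed
    then show "exp_rate (PG 0) s (\<lambda>N w. l * Z 0 g N w) (l\<^sup>2 * enn2real (V 0 g) / 2)"
      unfolding u exp_rate_cong[OF Z_eq_Zt[OF B], symmetric] .
  qed
next
  case (Suc t)
  show ?case unfolding laplace_bounded_def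
  proof (intro allI impI, elim exE)
    fix g :: "'a \<Rightarrow> real" and l B :: real assume g: "g \<in> borel_measurable borel" and "\<forall>x. \<bar>g x\<bar> \<le> B"
    then have B: "\<And>x. \<bar>g x\<bar> \<le> B" by simp
    from laplace_step[OF Suc g bounded_tame[OF finite_rho B], of l]
    show "exp_rate (PG (Suc t)) s (\<lambda>N w. l * Z (Suc t) g N w) (l\<^sup>2 * enn2real (V (Suc t) g) / 2)"
      unfolding exp_rate_cong[OF Z_eq_Zt[OF B], symmetric] .
  qed
qed

end

section \<open>Moment conditions and the main theorem\<close>

text \<open>Powers of \<bar>x\<bar> lose against exp of any positive power of \<bar>x\<bar>: with an
  integer n > 3/\<gamma> the cube is at most y^n for y = \<bar>x\<bar>^\<gamma>, and y^n \<le> n^n *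
  exp y. The summand 1 handles \<bar>x\<bar> \<le> 1.\<close>

lemma cube_le_exp_powr:
  fixes \<gamma> :: real
  assumes \<gamma>: "\<gamma> > 0"
  obtains C where "C \<ge> 0" "\<And>x. \<bar>x\<bar> ^ 3 \<le> C * exp (\<bar>x\<bar> powr \<gamma>)"
proof -
  obtain n :: nat where n: "3 / \<gamma> < real n" using reals_Archimedean2 by blast
  then have n0: "n > 0" using \<gamma> by (metis divide_pos_pos gr0I less_asym of_nat_0 zero_less_numeral)
  have "\<bar>x\<bar> ^ 3 \<le> (1 + real n ^ n) * exp (\<bar>x\<bar> powr \<gamma>)" for x
  proof (cases "\<bar>x\<bar> \<le> 1")
    case True
    then have "\<bar>x\<bar> ^ 3 \<le> 1 * 1" by (simp add: power_le_one)
    also have "... \<le> (1 + real n ^ n) * exp (\<bar>x\<bar> powr \<gamma>)" by (intro mult_mono) auto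
    finally show ?thesis .
  next
    case False
    define y where "y = \<bar>x\<bar> powr \<gamma>"
    have y: "y \<ge> 0" by (simp add: y_def)
    have "\<bar>x\<bar> ^ 3 = \<bar>x\<bar> powr 3" using False by (simp add: powr_numeral)
    also have "... \<le> \<bar>x\<bar> powr (\<gamma> * real n)" using False n \<gamma> by (intro powr_mono) (auto simp: field_simps)
    also have "... = y ^ n" using False by (simp add: y_def powr_powr[symmetric] powr_realpow)
    also have "... = real n ^ n * (y / real n) ^ n" using n0 by (simp add: power_divide)
    also have "(y / real n) ^ n \<le> exp (y / real n) ^ n"
    proof (rule power_mono)
      show "y / real n \<le> exp (y / real n)" using exp_ge_add_one_self[of "y / real n"] by linarith
    qed (use y in simp)
    also have "exp (y / real n) ^ n = exp y" using n0 by (simp add: exp_of_nat_mult[symmetric])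
    finally have "\<bar>x\<bar> ^ 3 \<le> real n ^ n * exp y" by (simp add: mult_left_mono)
    then show ?thesis unfolding y_def[symmetric] by (simp add: distrib_right add_increasing)
  qed
  then show thesis using that[of "1 + real n ^ n"] by simp
qed

context hmm_filter_rate
begin

declare particle_gen.simps(2) [simp del]

text \<open>Union bound over the particles, conditionally on the previous generation, followed by
  domination of the conditional law.\<close>

lemma particle_exceeds_le:
  assumes N: "N \<ge> 1" and g[measurable]: "g \<in> borel_measurable borel"
  shows "emeasure (PG (Suc t) N) {p \<in> space (PG (Suc t) N). \<exists>i<N. tau N < \<bar>g (p i)\<bar>}
    \<le> ennreal (Ca / low t) * (of_nat N * emeasure (rho t) {x. tau N < \<bar>g x\<bar>})"
proof -
  let ?A = "{x. tau N < \<bar>g x\<bar>}" and ?B = "PiM {..<N} (\<lambda>_. borel :: 'a measure)"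
  let ?S = "{p \<in> space ?B. \<exists>i<N. p i \<in> ?A}"
  have A[measurable]: "?A \<in> sets borel" by measurable
  have S: "?S \<in> sets ?B" by measurable
  have sp: "space (PG (Suc t) N) = space ?B" by (rule sets_eq_imp_space_eq[OF sets_pg[OF N]])
  have "emeasure (PG (Suc t) N) ?S = (\<integral>\<^sup>+p. indicator ?S p \<partial>PG (Suc t) N)"
    by (rule nn_integral_indicator[symmetric]) (simp only: sets_pg[OF N] S)
  also have "... = (\<integral>\<^sup>+w. \<integral>\<^sup>+p. indicator ?S p \<partial>PiM {..<N} (\<lambda>_. law N t w) \<partial>PG t N)"
    by (rule nn_integral_pg_Suc[OF N]) (use S in measurable)
  also have "... \<le> (\<integral>\<^sup>+w. ennreal (Ca / low t) * (of_nat N * emeasure (rho t) ?A) \<partial>PG t N)"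
  proof (rule nn_integral_mono)
    fix w
    have sl: "sets (PiM {..<N} (\<lambda>_. law N t w)) = sets ?B" by (intro sets_PiM_cong refl sets_law)
    have "(\<integral>\<^sup>+p. indicator ?S p \<partial>PiM {..<N} (\<lambda>_. law N t w)) = emeasure (PiM {..<N} (\<lambda>_. law N t w)) ?S"
      by (rule nn_integral_indicator) (simp only: sl S)
    also have "... \<le> of_nat N * emeasure (law N t w) ?A"
      using emeasure_iid_exists_le[OF prob_space_law[OF N, of t w], of ?A N] A
      by (simp add: sets_law sets_eq_imp_space_eq[OF sl])
    also have "emeasure (law N t w) ?A = (\<integral>\<^sup>+x. indicator ?A x \<partial>law N t w)"
      by (rule nn_integral_indicator[symmetric]) (simp only: sets_law A)
    also have "... \<le> ennreal (Ca / low t) * (\<integral>\<^sup>+x. indicator ?A x \<partial>rho t)"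
      by (rule nn_integral_law_le[OF N]) measurable
    also have "(\<integral>\<^sup>+x. indicator ?A x \<partial>rho t) = emeasure (rho t) ?A"
      by (rule nn_integral_indicator) (simp only: sets_rho A)
    finally show "(\<integral>\<^sup>+p. indicator ?S p \<partial>PiM {..<N} (\<lambda>_. law N t w)) \<le> ennreal (Ca / low t) * (of_nat N * emeasure (rho t) ?A)"
      by (simp add: mult.left_commute mult_left_mono)
  qed
  also have "... = ennreal (Ca / low t) * (of_nat N * emeasure (rho t) ?A)"
    using prob_space.emeasure_space_1[OF pg_prob[OF N, of t]] by simp
  finally show ?thesis by (simp add: sp)
qed

text \<open>Common to both moment conditions: tameness gives the Laplace limit of the truncated sum,
  and the tail hypothesis makes truncation invisible at speed \<open>s N\<close>.\<close>

lemma moderate_deviations: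
  assumes g[measurable]: "g \<in> borel_measurable borel" and tame: "tame (rho t) g"
    and tail: "\<And>R. \<forall>\<^sub>F N in sequentially. of_nat N * emeasure (rho t) {x. tau N < \<bar>g x\<bar>} \<le> eexp (s N * R)"
  shows "V (Suc t) g < \<infinity>"
    "dev_principle (PG (Suc t)) (\<lambda>N p. (1 / (b N * sqrt (real N))) * (\<Sum>i<N. (g (p i) - m (Suc t) g))) b
       (\<lambda>x. SUP l. ereal (l * x - l\<^sup>2 * enn2real (V (Suc t) g) / 2))"
proof -
  note int = tame_integrable[OF tame g]
  obtain B' where B': "\<And>x. \<bar>innov t g x\<bar> \<le> B'" using innov_bounded[OF int(1)] by blast
  have fin: "V t (innov t g) < \<infinity>" by (rule Vvar_bounded_finite[OF _ B']) measurable
  show "V (Suc t) g < \<infinity>" by (rule Vvar_Suc(1)[OF int fin])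
  have Z: "(1 / (b N * sqrt (real N))) * (\<Sum>i<N. (g (p i) - m (Suc t) g)) = Z (Suc t) g N p" for N p
    by (simp add: Z_def)
  show "dev_principle (PG (Suc t)) (\<lambda>N p. (1 / (b N * sqrt (real N))) * (\<Sum>i<N. (g (p i) - m (Suc t) g))) b
       (\<lambda>x. SUP l. ereal (l * x - l\<^sup>2 * enn2real (V (Suc t) g) / 2))"
    unfolding Z
  proof (rule gaertner_ellis_quadratic[OF b_top])
    show "\<forall>\<^sub>F N in sequentially. prob_space (PG (Suc t) N)" using ev_ge1 by eventually_elim (rule pg_prob)
    show "exp_rate (PG (Suc t)) (\<lambda>N. (b N)\<^sup>2) (\<lambda>N w. l * Zt (Suc t) g N w) (l\<^sup>2 * enn2real (V (Suc t) g) / 2)" for l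
      using laplace_step[OF laplace_bounded_all g tame, of l] by (simp add: s_def[abs_def])
    show "\<forall>\<^sub>F N in sequentially. Z (Suc t) g N \<in> borel_measurable (PG (Suc t) N) \<and> Zt (Suc t) g N \<in> borel_measurable (PG (Suc t) N)"
      using ev_ge1 by eventually_elim (simp add: PG_measurable_iff Z_measurable[OF g] Zt_measurable[OF g])
    fix R :: real
    \<comment> \<open>The tail hypothesis is used at \<open>R - 1\<close> so that the spare unit
      absorbs the domination constant.\<close>
    have "\<forall>\<^sub>F N in sequentially. Ca / low t * exp (s N * (R - 1)) \<le> exp (s N * R)"
      by (rule eventually_const_exp_le[OF s_top]) simp
    with ev_ge1 tail[of "R - 1"]
    show "\<forall>\<^sub>F N in sequentially. measure (PG (Suc t) N) {w \<in> space (PG (Suc t) N). Z (Suc t) g N w \<noteq> Zt (Suc t) g N w} \<le> exp ((b N)\<^sup>2 * R)"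
    proof eventually_elim
      case (elim N)
      interpret prob_space "PG (Suc t) N" by (rule pg_prob[OF elim(1)])
      let ?E = "{p \<in> space (PG (Suc t) N). \<exists>i<N. tau N < \<bar>g (p i)\<bar>}"
      have "?E \<in> sets (borel_pow N)"
        unfolding sets_eq_imp_space_eq[OF sets_pg[OF elim(1)]] by measurable
      then have E: "?E \<in> sets (PG (Suc t) N)" unfolding sets_pg[OF elim(1)] .
      have "prob {w \<in> space (PG (Suc t) N). Z (Suc t) g N w \<noteq> Zt (Suc t) g N w} \<le> prob ?E"
      proof (rule finite_measure_mono[OF _ E], rule subsetI, rule ccontr)
        fix w assume w: "w \<in> {w \<in> space (PG (Suc t) N). Z (Suc t) g N w \<noteq> Zt (Suc t) g N w}" and "w \<notin> ?E"
        then have "\<forall>i<N. \<bar>g (w i)\<bar> \<le> tau N" by simp (metis linorder_not_less)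
        then have "\<And>i. i < N \<Longrightarrow> trunc (tau N) (g (w i)) = g (w i)" by (simp add: trunc_def)
        then have "Zt (Suc t) g N w = Z (Suc t) g N w" unfolding Zt_def Z_def by simp
        with w show False by simp
      qed
      moreover have "ennreal (prob ?E) \<le> eexp (s N * R)"
      proof -
        have "ennreal (prob ?E) \<le> ennreal (Ca / low t) * (of_nat N * emeasure (rho t) {x. tau N < \<bar>g x\<bar>})"
          using particle_exceeds_le[OF elim(1) g, of t] by (simp add: emeasure_eq_measure)
        also have "... \<le> ennreal (Ca / low t) * eexp (s N * (R - 1))" by (intro mult_left_mono elim) simp
        also have "... = ennreal (Ca / low t * exp (s N * (R - 1)))"
          by (rule ennreal_mult''[symmetric]) simp
        also have "... \<le> eexp (s N * R)" using elim(3) by (rule ennreal_leI)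
        finally show ?thesis .
      qed
      then have "prob ?E \<le> exp (s N * R)" by (subst (asm) ennreal_le_iff) auto
      ultimately show ?case by (simp add: s_def)
    qed
  qed simp
qed

lemma tail_le:
  assumes [measurable]: "g \<in> borel_measurable borel" and G[measurable]: "G \<in> borel_measurable borel"
    and fin: "(\<integral>\<^sup>+x. eexp (G x) \<partial>rho t) < \<infinity>"
    and sub: "\<And>x. tau N < \<bar>g x\<bar> \<Longrightarrow> c \<le> G x"
  shows "of_nat N * emeasure (rho t) {x. tau N < \<bar>g x\<bar>} \<le> ennreal (real N * exp (- c) * enn2real (\<integral>\<^sup>+x. eexp (G x) \<partial>rho t))"
proof -
  have Gr: "G \<in> borel_measurable (rho t)" by measurable
  have sp: "space (rho t) = UNIV" using sets_eq_imp_space_eq[OF sets_rho[of t]] by simp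
  have "{x \<in> space (rho t). c \<le> G x} \<in> sets (rho t)" by measurable
  then have "emeasure (rho t) {x. tau N < \<bar>g x\<bar>} \<le> emeasure (rho t) {x \<in> space (rho t). c \<le> G x}"
    using sub by (intro emeasure_mono) (auto simp: sp)
  also have "... \<le> eexp (- c) * (\<integral>\<^sup>+x. eexp (G x) \<partial>rho t)" by (rule exponential_markov[OF Gr])
  also have "... = ennreal (exp (- c) * enn2real (\<integral>\<^sup>+x. eexp (G x) \<partial>rho t))"
    using fin by (simp add: ennreal_mult)
  finally have "of_nat N * emeasure (rho t) {x. tau N < \<bar>g x\<bar>} \<le> of_nat N * ennreal (exp (- c) * enn2real (\<integral>\<^sup>+x. eexp (G x) \<partial>rho t))"
    by (rule mult_left_mono) simp
  then show ?thesis by (simp add: ennreal_of_nat_eq_real_of_nat ennreal_mult[symmetric] mult.assoc)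
qed

text \<open>Since \<open>e N\<close> tends to 0, any fixed exponential moment eventually covers the
  tilt \<bar>l * e N\<bar>: half of \<beta> pays for the tilt and half for the cube. The tail is of
  order exp(- \<beta> * tau N), while \<open>s N = e N * tau N\<close> is of smaller order than
  \<open>tau N\<close>.\<close>

lemma exponential_moment_case:
  assumes g[measurable]: "g \<in> borel_measurable borel" and \<beta>: "\<beta> > 0"
    and fin: "(\<integral>\<^sup>+x. eexp (\<beta> * \<bar>g x\<bar>) \<partial>rho t) < \<infinity>"
  shows "tame (rho t) g"
    "\<forall>\<^sub>F N in sequentially. of_nat N * emeasure (rho t) {x. tau N < \<bar>g x\<bar>} \<le> eexp (s N * R)"
proof -
  define j where "j = enn2real (\<integral>\<^sup>+x. eexp (\<beta> * \<bar>g x\<bar>) \<partial>rho t)"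
  have j: "j \<ge> 0" by (simp add: j_def)
  have dom: "(\<integral>\<^sup>+x. ennreal (f x) \<partial>rho t) \<le> ennreal (C * j)"
    if "\<And>x. f x \<le> C * exp (\<beta> * \<bar>g x\<bar>)" "C \<ge> 0" for f C
    unfolding j_def by (rule nn_integral_dominated[OF that _ fin]) (simp, measurable)
  show "tame (rho t) g" unfolding tame_def
  proof (intro conjI allI)
    show "\<exists>K\<ge>0. (\<integral>\<^sup>+x. ennreal (\<bar>g x\<bar> ^ 3) \<partial>rho t) \<le> ennreal K"
      by (intro exI[of _ "27 / \<beta> ^ 3 * j"] conjI dom cube_le_exp) (use \<beta> j in auto)
    fix l
    have "(\<lambda>N. \<bar>l * e N\<bar>) \<longlonglongrightarrow> \<bar>l * 0\<bar>" by (intro tendsto_intros e_lim)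
    then have "\<forall>\<^sub>F N in sequentially. \<bar>l * e N\<bar> < \<beta> / 2" using \<beta> by (intro order_tendstoD(2)) auto
    then have "\<forall>\<^sub>F N in sequentially.
        trunc_moment (rho t) g l N \<le> ennreal (27 / (\<beta>/2) ^ 3 * j)"
    proof eventually_elim
      case (elim N)
      show ?case
      proof (rule dom)
        fix x
        let ?y = "\<bar>trunc (tau N) (g x)\<bar>"
        have "?y ^ 3 * exp (\<bar>l * e N\<bar> * ?y) \<le> (27 / (\<beta>/2) ^ 3 * exp (\<beta>/2 * ?y)) * exp (\<beta>/2 * ?y)"
        proof (intro mult_mono cube_le_exp)
          show "exp (\<bar>l * e N\<bar> * ?y) \<le> exp (\<beta>/2 * ?y)"
            using elim by (subst exp_le_cancel_iff) (intro mult_right_mono, auto)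
        qed (use \<beta> in auto)
        also have "... = 27 / (\<beta>/2) ^ 3 * exp (\<beta> * ?y)" by (simp add: mult.assoc exp_add[symmetric])
        also have "... \<le> 27 / (\<beta>/2) ^ 3 * exp (\<beta> * \<bar>g x\<bar>)"
          using \<beta> abs_trunc_le[of "tau N" "g x"] by (intro mult_left_mono) auto
        finally show "?y ^ 3 * exp (\<bar>l * e N\<bar> * ?y) \<le> 27 / (\<beta>/2) ^ 3 * exp (\<beta> * \<bar>g x\<bar>)" .
      qed (use \<beta> in simp)
    qed
    then show "\<exists>K\<ge>0. \<forall>\<^sub>F N in sequentially.
        trunc_moment (rho t) g l N \<le> ennreal K"
      using \<beta> j by (intro exI[of _ "27 / (\<beta>/2) ^ 3 * j"]) auto
  qed
  have "(\<lambda>N. \<bar>R * e N\<bar>) \<longlonglongrightarrow> \<bar>R * 0\<bar>" by (intro tendsto_intros e_lim)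
  then have Re: "\<forall>\<^sub>F N in sequentially. \<bar>R * e N\<bar> < \<beta> / 2" using \<beta> by (intro order_tendstoD(2)) auto
  have b1: "\<forall>\<^sub>F N in sequentially. b N \<ge> 1" using b_top by (simp add: filterlim_at_top)
  \<comment> \<open>This threshold gives j * \<open>(tau N)\<^sup>2\<close> \<le> (\<beta>/2)^3 / 27
    * tau N ^ 3, which \<open>cube_le_exp\<close> bounds by exp(\<beta>/2 * tau N). With N \<le>
    \<open>(tau N)\<^sup>2\<close> the prefactor N * j is absorbed.\<close>
  have t1: "\<forall>\<^sub>F N in sequentially. tau N \<ge> max 0 (27 * j / (\<beta>/2) ^ 3)" using tau_top by (simp only: filterlim_at_top)
  from ev_ge1 Re b1 t1
  show "\<forall>\<^sub>F N in sequentially. of_nat N * emeasure (rho t) {x. tau N < \<bar>g x\<bar>} \<le> eexp (s N * R)"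
  proof eventually_elim
    case (elim N)
    have "of_nat N * emeasure (rho t) {x. tau N < \<bar>g x\<bar>} \<le> ennreal (real N * exp (- (\<beta> * tau N)) * j)"
      unfolding j_def by (rule tail_le[OF g _ fin]) (use \<beta> in auto)
    also have "... \<le> eexp (s N * R)"
    proof (rule ennreal_leI)
      have t0: "tau N \<ge> 0" using elim by simp
      have "1 * sqrt (real N) \<le> tau N" unfolding tau_def using elim by (intro mult_right_mono) auto
      then have "sqrt (real N) * sqrt (real N) \<le> tau N * tau N" by (intro mult_mono) (use t0 in auto)
      then have "real N * j \<le> (tau N)\<^sup>2 * j" using j by (intro mult_right_mono) (auto simp: power2_eq_square)
      also have "... \<le> (tau N)\<^sup>2 * (tau N * ((\<beta>/2) ^ 3 / 27))" using elim \<beta> by (intro mult_left_mono) (auto simp: field_simps)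
      also have "... = tau N ^ 3 * ((\<beta>/2) ^ 3 / 27)" by (simp add: power3_eq_cube power2_eq_square)
      also have "... \<le> 27 / (\<beta>/2) ^ 3 * exp (\<beta>/2 * tau N) * ((\<beta>/2) ^ 3 / 27)"
        by (intro mult_right_mono cube_le_exp t0) (use \<beta> in auto)
      also have "... = exp (\<beta>/2 * tau N)" using \<beta> by simp
      finally have "real N * j * exp (- (\<beta> * tau N)) \<le> exp (\<beta>/2 * tau N) * exp (- (\<beta> * tau N))"
        by (intro mult_right_mono) auto
      also have "... = exp (- (\<beta>/2) * tau N)" by (simp add: exp_add[symmetric])
      also have "... \<le> exp (s N * R)"
      proof -
        have "s N * R = (R * e N) * tau N" using elim(1) by (simp add: s_def e_def tau_def power2_eq_square)
        moreover have "- (\<beta>/2) * tau N \<le> (R * e N) * tau N" using elim(2) t0 by (intro mult_right_mono) auto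
        ultimately have "- (\<beta>/2) * tau N \<le> s N * R" by (simp only:)
        then show ?thesis by (rule iffD2[OF exp_le_cancel_iff])
      qed
      finally show "real N * exp (- (\<beta> * tau N)) * j \<le> exp (s N * R)" by (simp add: mult_ac)
    qed
    finally show ?case .
  qed
qed

text \<open>Here \<open>tau N powr \<gamma> = s N = e N * tau N\<close>, hence \<open>e N * \<bar>x\<bar> \<le> \<bar>x\<bar> powr \<gamma>\<close> below the truncation level.\<close>
lemma stretched_exponential_case:
  assumes g[measurable]: "g \<in> borel_measurable borel" and \<alpha>: "0 < \<alpha>" "\<alpha> < 1/2"
    and b: "\<And>N. N \<ge> 1 \<Longrightarrow> b N = real N powr \<alpha>" and \<gamma>_eq: "\<gamma> = 4 * \<alpha> / (1 + 2 * \<alpha>)"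
    and fin: "\<And>\<beta>. \<beta> > 0 \<Longrightarrow> (\<integral>\<^sup>+x. eexp (\<beta> * \<bar>g x\<bar> powr \<gamma>) \<partial>rho t) < \<infinity>"
  shows "tame (rho t) g"
    "\<forall>\<^sub>F N in sequentially. of_nat N * emeasure (rho t) {x. tau N < \<bar>g x\<bar>} \<le> eexp (s N * R)"
proof -
  have \<gamma>: "0 < \<gamma>" "\<gamma> < 1" using \<alpha> by (auto simp: \<gamma>_eq field_simps)
  have tau: "tau N = real N powr (\<alpha> + 1/2)" and s: "s N = real N powr (2 * \<alpha>)" and tau_\<gamma>: "tau N powr \<gamma> = s N"
    and e_tau: "e N * tau N = s N" if N: "N \<ge> 1" for N
  proof -
    show t: "tau N = real N powr (\<alpha> + 1/2)" using b[OF N] N by (simp add: tau_def powr_add powr_half_sqrt)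
    show s: "s N = real N powr (2 * \<alpha>)" using b[OF N] N by (simp add: s_def power2_eq_square powr_add[symmetric])
    have "(\<alpha> + 1/2) * \<gamma> = 2 * \<alpha>" using \<alpha> unfolding \<gamma>_eq by (simp add: field_simps)
    then show "tau N powr \<gamma> = s N" by (simp add: t s powr_powr)
    show "e N * tau N = s N" using N by (simp add: e_def tau_def s_def power2_eq_square)
  qed
  define j where "j = (\<lambda>\<beta>. enn2real (\<integral>\<^sup>+x. eexp (\<beta> * \<bar>g x\<bar> powr \<gamma>) \<partial>rho t))"
  have j: "j \<beta> \<ge> 0" for \<beta> by (simp add: j_def)
  have dom: "(\<integral>\<^sup>+x. ennreal (f x) \<partial>rho t) \<le> ennreal (C * j \<beta>)"
    if "\<And>x. f x \<le> C * exp (\<beta> * \<bar>g x\<bar> powr \<gamma>)" "C \<ge> 0" "\<beta> > 0" for f C \<beta>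
    unfolding j_def by (rule nn_integral_dominated[OF that(1,2) _ fin[OF that(3)]]) (simp, measurable)
  obtain C where C: "C \<ge> 0" "\<And>x. \<bar>x\<bar> ^ 3 \<le> C * exp (\<bar>x\<bar> powr \<gamma>)" using cube_le_exp_powr[OF \<gamma>(1)] by blast
  show "tame (rho t) g" unfolding tame_def
  proof (intro conjI allI)
    show "\<exists>K\<ge>0. (\<integral>\<^sup>+x. ennreal (\<bar>g x\<bar> ^ 3) \<partial>rho t) \<le> ennreal K"
      by (intro exI[of _ "C * j 1"] conjI dom) (use C j in auto)
    fix l
    have "\<forall>\<^sub>F N in sequentially.
        trunc_moment (rho t) g l N \<le> ennreal (C * j (1 + \<bar>l\<bar>))"
      using ev_ge1 e_pos
    proof eventually_elim
      case (elim N)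
      show ?case
      proof (rule dom)
        fix x
        show "\<bar>trunc (tau N) (g x)\<bar> ^ 3 * exp (\<bar>l * e N\<bar> * \<bar>trunc (tau N) (g x)\<bar>) \<le> C * exp ((1 + \<bar>l\<bar>) * \<bar>g x\<bar> powr \<gamma>)"
        proof (cases "\<bar>g x\<bar> \<le> tau N \<and> g x \<noteq> 0")
          case False
          then have "trunc (tau N) (g x) = 0" by (auto simp: trunc_def)
          then show ?thesis using C by simp
        next
          case True
          \<comment> \<open>Since 1 - \<gamma> > 0, the first power of \<bar>g x\<bar> may be
            replaced by that of the level, and e N * tau N powr (1 - \<gamma>) = 1.\<close>
          have "e N * \<bar>g x\<bar> = e N * (\<bar>g x\<bar> powr (1 - \<gamma>) * \<bar>g x\<bar> powr \<gamma>)"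
            using True by (simp add: powr_add[symmetric])
          also have "... \<le> e N * (tau N powr (1 - \<gamma>) * \<bar>g x\<bar> powr \<gamma>)"
            using True \<gamma> elim by (intro mult_left_mono mult_right_mono powr_mono2) auto
          also have "e N * (tau N powr (1 - \<gamma>) * \<bar>g x\<bar> powr \<gamma>) = \<bar>g x\<bar> powr \<gamma>"
          proof -
            have tp: "tau N > 0" using True by linarith
            have "e N * tau N powr (1 - \<gamma>) = 1"
              using tp e_tau[OF elim(1)] tau_\<gamma>[OF elim(1)] elim by (simp add: powr_diff) (metis less_irrefl powr_gt_zero)
            then show ?thesis by (simp add: mult.assoc[symmetric])
          qed
          finally have "\<bar>l\<bar> * (e N * \<bar>g x\<bar>) \<le> \<bar>l\<bar> * \<bar>g x\<bar> powr \<gamma>" by (rule mult_left_mono) simp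
          then have "\<bar>g x\<bar> ^ 3 * exp (\<bar>l\<bar> * (e N * \<bar>g x\<bar>)) \<le> (C * exp (\<bar>g x\<bar> powr \<gamma>)) * exp (\<bar>l\<bar> * \<bar>g x\<bar> powr \<gamma>)"
            using C by (intro mult_mono) auto
          also have "... = C * exp ((1 + \<bar>l\<bar>) * \<bar>g x\<bar> powr \<gamma>)" by (simp add: mult.assoc exp_add[symmetric] distrib_right)
          finally show ?thesis using True elim by (simp add: trunc_def abs_mult mult.assoc)
        qed
      qed (use C in auto)
    qed
    then show "\<exists>K\<ge>0. \<forall>\<^sub>F N in sequentially.
        trunc_moment (rho t) g l N \<le> ennreal K"
      using C j by (intro exI[of _ "C * j (1 + \<bar>l\<bar>)"]) auto
  qed
  \<comment> \<open>1/(2\<alpha>) pays for the factor N, because ln N \<le> s N / (2\<alpha>); 1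
    pays for the moment \<open>j \<beta>\<close>; \<bar>R\<bar> is the target. As \<open>R\<close>
    is arbitrary, moments of every order \<beta> are called for.\<close>
  define \<beta> where "\<beta> = 1 / (2 * \<alpha>) + \<bar>R\<bar> + 1"
  have \<beta>: "\<beta> > 0" using \<alpha> by (simp add: \<beta>_def add_pos_nonneg)
  have sj: "\<forall>\<^sub>F N in sequentially. s N \<ge> j \<beta>" using s_top by (simp add: filterlim_at_top)
  from ev_ge1 sj
  show "\<forall>\<^sub>F N in sequentially. of_nat N * emeasure (rho t) {x. tau N < \<bar>g x\<bar>} \<le> eexp (s N * R)"
  proof eventually_elim
    case (elim N)
    have s0: "s N \<ge> 0" by (simp add: s_def)
    have "of_nat N * emeasure (rho t) {x. tau N < \<bar>g x\<bar>} \<le> ennreal (real N * exp (- (\<beta> * s N)) * j \<beta>)"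
      unfolding j_def
    proof (rule tail_le[OF g _ fin[OF \<beta>]])
      fix x assume "tau N < \<bar>g x\<bar>"
      then have "tau N powr \<gamma> \<le> \<bar>g x\<bar> powr \<gamma>" using \<gamma> tau[OF elim(1)] by (intro powr_mono2) auto
      then show "\<beta> * s N \<le> \<beta> * \<bar>g x\<bar> powr \<gamma>" using \<beta> tau_\<gamma>[OF elim(1)] by (intro mult_left_mono) auto
    qed measurable
    also have "... \<le> eexp (s N * R)"
    proof (rule ennreal_leI)
      have "ln (real N) \<le> real N powr (2 * \<alpha>) / (2 * \<alpha>)" using elim \<alpha> by (intro ln_powr_bound) auto
      then have "ln (real N) \<le> s N / (2 * \<alpha>)" by (simp add: s[OF elim(1)])
      then have N: "real N \<le> exp (s N / (2 * \<alpha>))" using elim(1) by (metis exp_le_cancel_iff exp_ln of_nat_0_less_iff zero_less_one order_less_le_trans)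
      have "j \<beta> \<le> exp (s N)" using elim(2) exp_ge_add_one_self[of "s N"] by linarith
      then have "real N * exp (- (\<beta> * s N)) * j \<beta> \<le> exp (s N / (2 * \<alpha>)) * exp (- (\<beta> * s N)) * exp (s N)"
        using N j by (intro mult_mono) auto
      also have "... = exp (- (s N * \<bar>R\<bar>))" by (simp add: exp_add[symmetric] \<beta>_def algebra_simps)
      also have "... \<le> exp (s N * R)"
      proof -
        have "s N * (- \<bar>R\<bar>) \<le> s N * R" using s0 by (intro mult_left_mono) auto
        then show ?thesis by simp
      qed
      finally show "real N * exp (- (\<beta> * s N)) * j \<beta> \<le> exp (s N * R)" .
    qed
    finally show ?case .
  qed
qed

end

theorem theorem4p1:
  fixes mu :: "'a::euclidean_space measure"
    and nu :: "'b measure"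
    and a0 :: "'a \<Rightarrow> real"
    and a :: "nat \<Rightarrow> 'a \<Rightarrow> 'a \<Rightarrow> real"
    and b :: "nat \<Rightarrow> 'a \<Rightarrow> 'b \<Rightarrow> real"
    and y :: "nat \<Rightarrow> 'b"
    and Ca :: real
    and hp hm :: "nat \<Rightarrow> 'a \<Rightarrow> real"
    and T :: nat
    and bN :: "nat \<Rightarrow> real"
    and psi :: "'a \<Rightarrow> real"
  assumes mu: "sets mu = sets borel" "sigma_finite_measure mu"
    and a0_dens: "a0 \<in> borel_measurable borel" "\<And>x. 0 \<le> a0 x" "(\<integral>\<^sup>+x. ennreal (a0 x) \<partial>mu) = 1"
    and a_dens: "\<And>t. t \<ge> 1 \<Longrightarrow> case_prod (a t) \<in> borel_measurable borel"
      "\<And>t x x'. t \<ge> 1 \<Longrightarrow> 0 \<le> a t x x'"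
      "\<And>t x. t \<ge> 1 \<Longrightarrow> (\<integral>\<^sup>+x'. ennreal (a t x x') \<partial>mu) = 1"
    and b_dens: "\<And>t x. t \<ge> 1 \<Longrightarrow> b t x \<in> borel_measurable nu"
      "\<And>t. t \<ge> 1 \<Longrightarrow> (\<lambda>x. b t x (y t)) \<in> borel_measurable borel"
      "\<And>t x y'. t \<ge> 1 \<Longrightarrow> 0 \<le> b t x y'"
      "\<And>t x. t \<ge> 1 \<Longrightarrow> (\<integral>\<^sup>+y'. ennreal (b t x y') \<partial>nu) = 1"
    and A1: "Ca > 0"
      "\<And>t. t \<ge> 1 \<Longrightarrow> hp t \<in> borel_measurable borel \<and> hm t \<in> borel_measurable borel"
      "\<And>t x. t \<ge> 1 \<Longrightarrow> 0 \<le> hp t x \<and> 0 \<le> hm t x"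
      "\<And>t x x'. t \<ge> 1 \<Longrightarrow> hm t x' / Ca \<le> a t x x' \<and> a t x x' \<le> Ca * hp t x'"
      "\<And>t. t \<ge> 1 \<Longrightarrow> 0 < ennreal (1 / Ca) * (\<integral>\<^sup>+x. ennreal (hm t x * b t x (y t)) \<partial>mu)"
      "\<And>t. t \<ge> 1 \<Longrightarrow> ennreal (1 / Ca) * (\<integral>\<^sup>+x. ennreal (hm t x * b t x (y t)) \<partial>mu)
                 \<le> ennreal Ca * (\<integral>\<^sup>+x. ennreal (hp t x * b t x (y t)) \<partial>mu)"
      "\<And>t. t \<ge> 1 \<Longrightarrow> ennreal Ca * (\<integral>\<^sup>+x. ennreal (hp t x * b t x (y t)) \<partial>mu) < \<infinity>"
    and T: "T \<ge> 1"
    and bN: "\<And>N. N \<ge> 1 \<Longrightarrow> bN N > 0" "filterlim bN at_top sequentially"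
      "filterlim (\<lambda>N. sqrt (real N) / bN N) at_top sequentially"
    and psi: "psi \<in> borel_measurable borel"
  shows
    "let bt = (\<lambda>t x. b t x (y t));
         V = Vvar mu a0 a bt T psi;
         I = (\<lambda>x. SUP l. ereal (l * x - l\<^sup>2 * enn2real V / 2));
         P = (\<lambda>N. particle_gen mu a0 a bt N T);
         M = (\<lambda>s N p. (1 / (s N * sqrt (real N)))
                 * (\<Sum>i<N. (psi (p i) - mfilt mu a0 a bt T psi)))
     in ((\<exists>beta>0. (\<integral>\<^sup>+x. ennreal (exp (beta * \<bar>psi x\<bar>) * hp T x * bt T x) \<partial>mu) < \<infinity>)
           \<longrightarrow> V < \<infinity> \<and> dev_principle P (M bN) bN I \<and> good_rate_function I)
      \<and> (\<forall>alpha. 0 < alpha \<and> alpha < 1/2 \<and> (\<forall>N\<ge>1. bN N = real N powr alpha)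
           \<and> (\<forall>beta>0. (\<integral>\<^sup>+x. ennreal (exp (beta * \<bar>psi x\<bar> powr (4 * alpha / (1 + 2 * alpha)))
                              * hp T x * bt T x) \<partial>mu) < \<infinity>)
           \<longrightarrow> V < \<infinity> \<and> dev_principle P (M bN) bN I \<and> good_rate_function I)"
proof -
  define bt where "bt = (\<lambda>t x. b t x (y t))"
  interpret hmm_filter_rate mu a0 a bt Ca hp hm bN
  proof (unfold_locales; (rule mu a0_dens A1(1) bN; assumption?)?)
    fix t x x'
    show "case_prod (a (Suc t)) \<in> borel_measurable borel" by (rule a_dens) simp
    show "0 \<le> a (Suc t) x x'" by (rule a_dens) simp
    show "bt (Suc t) \<in> borel_measurable borel" unfolding bt_def by (rule b_dens) simp
    show "0 \<le> bt (Suc t) x" unfolding bt_def by (rule b_dens) simp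
    show "hp (Suc t) \<in> borel_measurable borel" "hm (Suc t) \<in> borel_measurable borel" using A1(2)[of "Suc t"] by auto
    show "0 \<le> hp (Suc t) x" "0 \<le> hm (Suc t) x" using A1(3)[of "Suc t"] by auto
    show "hm (Suc t) x' / Ca \<le> a (Suc t) x x'" "a (Suc t) x x' \<le> Ca * hp (Suc t) x'" using A1(4)[of "Suc t"] by auto
    show "0 < (\<integral>\<^sup>+x. ennreal (hm (Suc t) x * bt (Suc t) x) \<partial>mu)"
      using A1(5)[of "Suc t"] unfolding bt_def by (auto simp: ennreal_zero_less_mult_iff)
    show "(\<integral>\<^sup>+x. ennreal (hp (Suc t) x * bt (Suc t) x) \<partial>mu) < \<infinity>"
      using A1(7)[of "Suc t"] A1(1) unfolding bt_def by (auto simp: ennreal_mult_less_top)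
  qed (use mu(2) in \<open>simp_all add: sigma_finite_measure_def\<close>)
  obtain t where t: "T = Suc t" using T by (cases T) auto
  note [measurable] = psi
  \<comment> \<open>Rewrites both moment hypotheses as exponential moments under the dominating
    measure of the last transition, from \<open>t\<close> to T = Suc t.\<close>
  have rho_eq: "(\<integral>\<^sup>+x. eexp (G x) \<partial>rho t) = (\<integral>\<^sup>+x. ennreal (exp (G x) * hp T x * bt T x) \<partial>mu)"
    if [measurable]: "G \<in> borel_measurable borel" for G
    unfolding t by (subst nn_integral_rho) (auto simp: ennreal_mult[symmetric] h_nonneg bt_nonneg mult_ac intro!: nn_integral_cong)
  let ?I = "\<lambda>x. SUP l. ereal (l * x - l\<^sup>2 * enn2real (V T psi) / 2)"
  let ?concl = "V T psi < \<infinity> \<and>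
    dev_principle (PG T) (\<lambda>N p. (1 / (bN N * sqrt (real N))) * (\<Sum>i<N. (psi (p i) - m T psi))) bN ?I \<and> good_rate_function ?I"
  have main: ?concl
    if "tame (rho t) psi" "\<And>R. \<forall>\<^sub>F N in sequentially. of_nat N * emeasure (rho t) {x. tau N < \<bar>psi x\<bar>} \<le> eexp (s N * R)"
    unfolding t using moderate_deviations[OF psi that] good_rate_function_quadratic by blast
  have part1: ?concl
    if \<beta>: "beta > 0" and fin: "(\<integral>\<^sup>+x. ennreal (exp (beta * \<bar>psi x\<bar>) * hp T x * bt T x) \<partial>mu) < \<infinity>" for beta
  proof -
    have "(\<integral>\<^sup>+x. eexp (beta * \<bar>psi x\<bar>) \<partial>rho t) < \<infinity>" using fin by (subst rho_eq) auto
    then show ?thesis by (intro main exponential_moment_case[OF psi \<beta>])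
  qed
  have part2: ?concl
    if \<alpha>: "0 < alpha" "alpha < 1/2" and b: "\<And>N. N \<ge> 1 \<Longrightarrow> bN N = real N powr alpha"
      and fin: "\<And>beta. beta > 0 \<Longrightarrow> (\<integral>\<^sup>+x. ennreal (exp (beta * \<bar>psi x\<bar> powr (4 * alpha / (1 + 2 * alpha))) * hp T x * bt T x) \<partial>mu) < \<infinity>" for alpha
  proof -
    have f: "(\<integral>\<^sup>+x. eexp (beta * \<bar>psi x\<bar> powr (4 * alpha / (1 + 2 * alpha))) \<partial>rho t) < \<infinity>" if "beta > 0" for beta
      using fin[OF that] by (subst rho_eq) auto
    show ?thesis by (intro main stretched_exponential_case[OF psi \<alpha> b refl f])
  qed
  show ?thesis
    unfolding Let_def bt_def[symmetric] using part1 part2 by blast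
qed

end
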